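(* Let $m\ge1$ and $1<p<\infty$. For $i\in\{1,2,3\}$ the twisted martingale square function $$S_{mart}^{(i)}(f)(\mathbf x)=\Big(\sum_{\mathbf k\in\mathbb Z^2}\big|\Delta_{\mathbf k}^{(i)}f(\mathbf x)\big|^2\Big)^{1/2}$$ is bounded on $L^p(\mathbb R^{2m})$. Furthermore, for all $f\in L^p(\mathbb R^{2m})$, $$\big\|S_{mart}^{(i)}(f)\big\|_{L^p(\mathbb R^{2m})}\simeq\|f\|_{L^p(\mathbb R^{2m})},\qquad i\in\{1,2,3\},$$ where the implicit constants depend only on $p$ and $m$.
   Context: $\mathscr D_k$ denotes the standard (half-open) dyadic cubes in $\mathbb R^m$ of side length $2^{-k}$. On $\mathbb R^{2m}=\mathbb R^m\times\mathbb R^m$ put $T_1=\mathrm{Id}$, $T_2(x_1,x_2)=(x_1-x_2,x_2)$, $T_3(x_1,x_2)=(x_1,x_2-x_1)$. For $\mathbf k=(k_1,k_2)\in\mathbb Z^2$ and $i\in\{1,2,3\}$, $\mathscr F_{\mathbf k}^{(i)}$ is the $\sigma$-algebra generated by the sets $T_i^{-1}(I\times J)$, $I\in\mathscr D_{k_1}$, $J\in\mathscr D_{k_2}$, and $E_{\mathbf k}^{(i)}$ is the associated conditional expectation, i.e. $E_{\mathbf k}^{(i)}f(\mathbf x)$ is the average of $f$ over the unique such set containing $\mathbf x$. The bi-parameter martingale differences are $$\Delta_{\mathbf k}^{(i)}=E_{k_1+1,k_2+1}^{(i)}-E_{k_1+1,k_2}^{(i)}-E_{k_1,k_2+1}^{(i)}+E_{k_1,k_2}^{(i)}.$$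 $A\simeq B$ means $c\,B\le A\le C\,B$ for constants $0<c\le C<\infty$. *)

theory Defs
  imports "HOL-Analysis.Analysis"
begin

text \<open>
  The space \<open>\<real>\<^sup>m\<close> is \<open>real^'m\<close> with \<open>m = CARD('m)\<close>, and \<open>\<real>\<^sup>2\<^sup>m\<close> is the product
  \<open>(real^'m) \<times> (real^'m)\<close>. All function spaces are taken with respect to Lebesgue (not just
  Borel) measurable functions.
\<close>

definition dyadic_cubes :: "int \<Rightarrow> (real^'m) set set" where
  "dyadic_cubes k =
     {{x. \<forall>j. of_int (n j) * 2 powi (- k) \<le> x $ j \<and> x $ j < (of_int (n j) + 1) * 2 powi (- k)}
      | n :: 'm \<Rightarrow> int. True}"

text \<open>The index \<open>i\<close> is meant to range over \<open>{1, 2, 3}\<close>.\<close>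

definition twist :: "nat \<Rightarrow> (real^'m) \<times> (real^'m) \<Rightarrow> (real^'m) \<times> (real^'m)" where
  "twist i = (\<lambda>(x1, x2). if i = 2 then (x1 - x2, x2)
                         else if i = 3 then (x1, x2 - x1)
                         else (x1, x2))"

text \<open>
  The generators of the \<open>\<sigma>\<close>-algebra \<open>\<F>\<^bsub>k\<^esub>\<^sup>(\<^sup>i\<^sup>)\<close>. They form a countable partition of
  the space, so they are its atoms.
\<close>

definition twisted_cells :: "nat \<Rightarrow> int \<times> int \<Rightarrow> ((real^'m) \<times> (real^'m)) set set" where
  "twisted_cells i k =
     {twist i -` (I \<times> J) | I J. I \<in> dyadic_cubes (fst k) \<and> J \<in> dyadic_cubes (snd k)}"

definition twisted_cell ::
    "nat \<Rightarrow> int \<times> int \<Rightarrow> (real^'m) \<times> (real^'m) \<Rightarrow> ((real^'m) \<times> (real^'m)) set" where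
  "twisted_cell i k x = (THE Q. Q \<in> twisted_cells i k \<and> x \<in> Q)"

definition cond_avg ::
    "nat \<Rightarrow> int \<times> int \<Rightarrow> ((real^'m) \<times> (real^'m) \<Rightarrow> 'b::{banach, second_countable_topology})
      \<Rightarrow> (real^'m) \<times> (real^'m) \<Rightarrow> 'b" where
  "cond_avg i k f x =
     (LINT y:twisted_cell i k x|lebesgue. f y) /\<^sub>R measure lebesgue (twisted_cell i k x)"

definition mart_diff ::
    "nat \<Rightarrow> int \<times> int \<Rightarrow> ((real^'m) \<times> (real^'m) \<Rightarrow> 'b::{banach, second_countable_topology})
      \<Rightarrow> (real^'m) \<times> (real^'m) \<Rightarrow> 'b" where
  "mart_diff i k f x =
     (case k of (k1, k2) \<Rightarrow>
        cond_avg i (k1 + 1, k2 + 1) f x - cond_avg i (k1 + 1, k2) f x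
        - cond_avg i (k1, k2 + 1) f x + cond_avg i (k1, k2) f x)"

text \<open>
  The sum below is real-valued, hence meaningful only at points where it converges; convergence
  almost everywhere has to be asserted separately, see \<open>mart_square_converges\<close>.
\<close>

definition mart_square ::
    "nat \<Rightarrow> ((real^'m) \<times> (real^'m) \<Rightarrow> 'b::{banach, second_countable_topology})
      \<Rightarrow> (real^'m) \<times> (real^'m) \<Rightarrow> real" where
  "mart_square i f x = sqrt (\<Sum>\<^sub>\<infinity>k\<in>UNIV. (norm (mart_diff i k f x))\<^sup>2)"

definition mart_square_converges ::
    "nat \<Rightarrow> ((real^'m) \<times> (real^'m) \<Rightarrow> 'b::{banach, second_countable_topology}) \<Rightarrow> bool" where
  "mart_square_converges i f \<longleftrightarrow>
     (AE x in lebesgue. (\<lambda>k. (norm (mart_diff i k f x))\<^sup>2) summable_on UNIV)"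

definition Lp_space :: "real \<Rightarrow> ('a::euclidean_space \<Rightarrow> 'b::real_normed_vector) set" where
  "Lp_space p = {f. f \<in> borel_measurable lebesgue \<and> integrable lebesgue (\<lambda>x. norm (f x) powr p)}"

definition Lp_norm :: "real \<Rightarrow> ('a::euclidean_space \<Rightarrow> 'b::real_normed_vector) \<Rightarrow> real" where
  "Lp_norm p f = (LINT x|lebesgue. norm (f x) powr p) powr (1 / p)"

text \<open>
  The remaining lemmas show that the definite description and the division above are
  well defined: every point lies in exactly one cell, and cells have finite positive measure.
\<close>

lemma ex1_dyadic_cube: "\<exists>!Q. Q \<in> dyadic_cubes k \<and> (x :: real^'m) \<in> Q"
proof -
  define d :: real where "d = 2 powi (- k)"
  have d: "d > 0" by (simp add: d_def)
  have *: "of_int n * d \<le> t \<and> t < (of_int n + 1) * d \<longleftrightarrow> n = \<lfloor>t / d\<rfloor>" for n t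
    proof -
    have "n = \<lfloor>t / d\<rfloor> \<longleftrightarrow> of_int n \<le> t / d \<and> t / d < of_int n + 1"
      by (metis floor_eq_iff)
    then show ?thesis using d by (simp add: pos_le_divide_eq pos_divide_less_eq)
  qed
  show ?thesis
    unfolding dyadic_cubes_def d_def[symmetric] *
    by (rule ex1I[of _ "{y. \<forall>j. \<lfloor>x $ j / d\<rfloor> = \<lfloor>y $ j / d\<rfloor>}"]) auto
qed

lemma ex1_twisted_cell: "\<exists>!Q. Q \<in> twisted_cells i k \<and> x \<in> Q"
proof -
  obtain I where I: "I \<in> dyadic_cubes (fst k)" "fst (twist i x) \<in> I"
      "\<And>I'. I' \<in> dyadic_cubes (fst k) \<Longrightarrow> fst (twist i x) \<in> I' \<Longrightarrow> I' = I"
    using ex1_dyadic_cube[of "fst k" "fst (twist i x)"] by blast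
  obtain J where J: "J \<in> dyadic_cubes (snd k)" "snd (twist i x) \<in> J"
      "\<And>J'. J' \<in> dyadic_cubes (snd k) \<Longrightarrow> snd (twist i x) \<in> J' \<Longrightarrow> J' = J"
    using ex1_dyadic_cube[of "snd k" "snd (twist i x)"] by blast
  show ?thesis
  proof (rule ex1I[of _ "twist i -` (I \<times> J)"])
    show "twist i -` (I \<times> J) \<in> twisted_cells i k \<and> x \<in> twist i -` (I \<times> J)"
      unfolding twisted_cells_def using I(1,2) J(1,2) by (auto simp: mem_Times_iff)
  next
    fix Q assume "Q \<in> twisted_cells i k \<and> x \<in> Q"
    then obtain I' J' where "Q = twist i -` (I' \<times> J')" "I' \<in> dyadic_cubes (fst k)"
        "J' \<in> dyadic_cubes (snd k)" "twist i x \<in> I' \<times> J'"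
      by (auto simp: twisted_cells_def)
    then show "Q = twist i -` (I \<times> J)"
      using I(3)[of I'] J(3)[of J'] by (simp add: mem_Times_iff)
  qed
qed

lemma continuous_twist: "continuous_on UNIV (twist i)"
  unfolding twist_def case_prod_unfold
  by (cases "i = 2"; cases "i = 3") (auto intro!: continuous_on_Pair continuous_on_diff
       continuous_on_fst continuous_on_snd continuous_on_id)

lemma dyadic_cube_props:
  assumes "(I :: (real^'m) set) \<in> dyadic_cubes k"
  shows "bounded I" and "I \<in> sets borel" and "interior I \<noteq> {}"
proof -
  obtain n where n: "I = {x. \<forall>j. of_int (n j) * 2 powi (- k) \<le> x $ j
      \<and> x $ j < (of_int (n j) + 1) * 2 powi (- k)}"
    using assms by (auto simp: dyadic_cubes_def)
  define a b :: "real^'m" where "a = (\<chi> j. of_int (n j) * 2 powi (- k))"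
    and "b = (\<chi> j. (of_int (n j) + 1) * 2 powi (- k))"
  have eq: "I = {x. \<forall>j. a $ j \<le> x $ j \<and> x $ j < b $ j}"
    by (simp add: n a_def b_def)
  have ab: "a $ j < b $ j" for j
    by (simp add: a_def b_def)
  show "bounded I"
    by (rule bounded_subset[of "cbox a b"]) (auto simp: eq mem_box_cart less_imp_le)
  show "I \<in> sets borel"
    unfolding eq by measurable
  have "box a b \<subseteq> interior I"
    by (rule interior_maximal) (auto simp: eq mem_box_cart less_imp_le)
  moreover have "box a b \<noteq> {}"
    using ab by (auto simp: interval_ne_empty_cart)
  ultimately show "interior I \<noteq> {}" by auto
qed

lemma measure_twisted_cell:
  fixes Q :: "((real^'m) \<times> (real^'m)) set"
  assumes "Q \<in> twisted_cells i k"
  shows "Q \<in> lmeasurable" and "measure lebesgue Q > 0"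
proof -
  obtain I J where Q: "Q = twist i -` (I \<times> J)"
    and I: "I \<in> dyadic_cubes (fst k)" and J: "J \<in> dyadic_cubes (snd k)"
    using assms by (auto simp: twisted_cells_def)
  define S :: "(real^'m) \<times> (real^'m) \<Rightarrow> (real^'m) \<times> (real^'m)" where
    "S = (\<lambda>x. if i = 2 then (fst x + snd x, snd x)
              else if i = 3 then (fst x, snd x + fst x) else x)"
  have S1: "S (twist i x) = x" and S2: "twist i (S x) = x" for x
    by (auto simp: S_def twist_def split: prod.splits)
  have "Q \<subseteq> S ` (I \<times> J)"
  proof
    fix x assume "x \<in> Q"
    then have "twist i x \<in> I \<times> J" by (simp add: Q)
    then show "x \<in> S ` (I \<times> J)" using image_eqI[of x S "twist i x"] by (simp add: S1)
  qed
  moreover have "linear S"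
    by (rule linearI) (auto simp: S_def algebra_simps)
  then have "bounded_linear S"
    by (simp add: linear_conv_bounded_linear)
  ultimately have "bounded Q"
    using bounded_subset[OF bounded_linear_image[OF
        bounded_Times[OF dyadic_cube_props(1)[OF I] dyadic_cube_props(1)[OF J]]]]
    by simp
  moreover have "Q \<in> sets borel"
  proof -
    have "I \<times> J \<in> sets borel"
      using pair_measureI[OF dyadic_cube_props(2)[OF I] dyadic_cube_props(2)[OF J]]
      unfolding borel_prod .
    then show ?thesis
      using measurable_sets_borel[OF borel_measurable_continuous_onI[OF continuous_twist]]
      by (simp add: Q)
  qed
  ultimately show lm: "Q \<in> lmeasurable"
    by (intro bounded_set_imp_lmeasurable) auto
  obtain u v where uv: "u \<in> interior I" "v \<in> interior J"
    using dyadic_cube_props(3)[OF I] dyadic_cube_props(3)[OF J] by blast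
  let ?U = "twist i -` (interior I \<times> interior J)"
  have "open ?U"
    using continuous_twist by (intro open_vimage open_Times) auto
  moreover have "S (u, v) \<in> ?U"
    using uv by (simp add: S2)
  ultimately have "\<not> negligible ?U"
    using open_not_negligible by blast
  moreover have "?U \<subseteq> Q"
    using interior_subset[of I] interior_subset[of J] by (auto simp: Q)
  ultimately have "\<not> negligible Q"
    using negligible_subset by blast
  then show "measure lebesgue Q > 0"
    using lm by (metis negligible_iff_measure zero_less_measure_iff)
qed

end

theory Submission
  imports Defs
begin

text \<open>
  The cells \<open>twist i -` (I \<times> J)\<close> form a two-parameter grid: each is cut out by one index that depends
  on \<open>k\<^sub>1\<close> alone and one that depends on \<open>k\<^sub>2\<close> alone, every pair of indices occurs, and the volume of a
  cell is a product of a factor for \<open>k\<^sub>1\<close> and a factor for \<open>k\<^sub>2\<close>. Moreover fine cells refine coarse ones,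
  shrink to points as both levels increase, and become arbitrarily long as one level decreases. The
  argument uses only these properties of the cells, so the three twists are treated together, as instances of
  the locale \<open>generating_grid\<close>, and the constants come out independent of \<open>i\<close> and even of \<open>m\<close>.

  The product structure makes averaging in one index commute with averaging in the other
  (lemma \<open>tower\<close>). For fixed \<open>N\<close>, the row
  \<open>E k (l + 1) f - E k l f\<close>, \<open>-N \<le> l < N\<close>, is therefore a vector-valued martingale in \<open>k\<close>, whose
  square function is the bi-parameter square function, and whose norm at time \<open>k\<close> is the square
  function of the one-parameter martingale \<open>E k l f\<close> in \<open>l\<close>. A one-parameter square function
  theorem for vectors, with constants independent of the number of components, can thus be applied
  twice (\<open>square_trunc_upper\<close> and \<open>square_trunc_lower\<close>).

  The one-parameter theorem follows Burkholder. Along a martingale with norm \<open>X\<close> and square function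
  \<open>y\<close>, a step \<open>h\<close> turns \<open>X\<^sup>2\<close> into \<open>X\<^sup>2 + 2c + |h|\<^sup>2\<close> and \<open>y\<^sup>2\<close> into \<open>y\<^sup>2 + |h|\<^sup>2\<close>, where \<open>c\<close> is the inner product
  of the current value with \<open>h\<close> and has mean zero. If a function \<open>U\<close> satisfies
  \<open>U X' y' \<le> U X y + A X y * c\<close> for each such step, then its integral along the martingale decreases; if
  moreover \<open>U X y \<ge> y powr p - C * X powr p\<close> and \<open>U X 0 \<le> 0\<close>, the square function is bounded by the
  martingale in \<open>L\<^sup>p\<close>. Exchanging the roles of \<open>X\<close> and \<open>y\<close> gives the converse estimate. Both functions are
  averages over all scales of a function that is built piecewise from \<open>y\<^sup>2 - X\<^sup>2\<close> and functions of \<open>X\<close>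
  or of \<open>y\<close> alone (\<open>burkholder_function\<close>): the increment of \<open>y\<^sup>2 - X\<^sup>2\<close> is exactly linear in \<open>c\<close>, and the
  rest is controlled because the norm is convex and the square function increases.

  The upper bound then follows by letting \<open>N\<close> tend to infinity. In the lower bound two boundary terms
  remain, with averages over cells that are very long in one index and very short in the other, and
  these tend to \<open>0\<close> in \<open>L\<^sup>p\<close> because \<open>p > 1\<close> (\<open>E_vanishes\<close>); and the averages over the fine cells
  converge to \<open>f\<close> in \<open>L\<^sup>p\<close> (\<open>deviation_tendsto_0\<close>).
\<close>

section \<open>Burkholder functions for the square function\<close>

text \<open>
  One martingale step, seen only through scalars: \<open>X\<close> is the norm of the current vector, \<open>y\<close> the square
  function so far, \<open>H\<close> the norm of the increment, and \<open>c\<close> the inner product of vector and increment, so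
  that the bound on \<open>c\<close> is the Cauchy--Schwarz inequality.
\<close>
definition sq_step :: "real \<Rightarrow> real \<Rightarrow> real \<Rightarrow> real \<Rightarrow> real \<Rightarrow> bool" where
  "sq_step X y c X' y' \<longleftrightarrow> 0 \<le> X \<and> 0 \<le> y \<and> 0 \<le> X' \<and> 0 \<le> y' \<and>
     (\<exists>H\<ge>0. X'\<^sup>2 = X\<^sup>2 + 2 * c + H\<^sup>2 \<and> y'\<^sup>2 = y\<^sup>2 + H\<^sup>2 \<and> \<bar>c\<bar> \<le> X * H)"

text \<open>
  The triangle inequality \<open>|X' - X| \<le> H\<close>, the bounds \<open>H \<le> y' \<le> y + H\<close>, convexity of the norm
  (\<open>X\<^sup>2 + c \<le> X * X'\<close>), and the identity behind the whole section: the increment of \<open>X\<^sup>2 - y\<^sup>2\<close> is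
  \<open>2 * c\<close>, without a quadratic term.
\<close>
lemma sq_stepD:
  assumes "sq_step X y c X' y'"
  shows "0 \<le> X" "0 \<le> y" "0 \<le> X'" "y \<le> y'" "X' \<le> X + y'" "y' \<le> y + X + X'"
    "X\<^sup>2 + c \<le> X * X'" "X'\<^sup>2 - y'\<^sup>2 = X\<^sup>2 - y\<^sup>2 + 2 * c" "X = 0 \<Longrightarrow> c = 0"
proof -
  obtain H where nn: "0 \<le> X" "0 \<le> y" "0 \<le> X'" "0 \<le> y'" "0 \<le> H"
    and X': "X'\<^sup>2 = X\<^sup>2 + 2 * c + H\<^sup>2" and y': "y'\<^sup>2 = y\<^sup>2 + H\<^sup>2" and c: "\<bar>c\<bar> \<le> X * H"
    using assms unfolding sq_step_def by auto
  show "0 \<le> X" "0 \<le> y" "0 \<le> X'" by fact+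
  show "y \<le> y'" by (rule power2_le_imp_le) (use nn y' in auto)
  have Hy: "H \<le> y'" by (rule power2_le_imp_le) (use nn y' in auto)
  have "X' \<le> X + H"
    by (rule power2_le_imp_le) (use nn X' c in \<open>auto simp: power2_sum\<close>)
  then show "X' \<le> X + y'" using Hy by simp
  have "H - X \<le> X'"
    by (rule power2_le_imp_le) (use nn X' c in \<open>auto simp: power2_diff abs_le_iff mult.commute\<close>)
  moreover have "y' \<le> y + H"
    by (rule power2_le_imp_le) (use nn y' in \<open>auto simp: power2_sum\<close>)
  ultimately show "y' \<le> y + X + X'" by simp
  have c2: "c\<^sup>2 \<le> (X * H)\<^sup>2" using power_mono[OF c, of 2] by simp
  show "X\<^sup>2 + c \<le> X * X'"
  proof (rule power2_le_imp_le)
    have "(X\<^sup>2 + c)\<^sup>2 = X\<^sup>2 * X\<^sup>2 + 2 * c * X\<^sup>2 + c\<^sup>2"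
      by (simp add: power2_eq_square algebra_simps)
    also have "\<dots> \<le> X\<^sup>2 * X\<^sup>2 + 2 * c * X\<^sup>2 + (X * H)\<^sup>2" using c2 by simp
    also have "\<dots> = X\<^sup>2 * X'\<^sup>2" unfolding X' by (simp add: power2_eq_square algebra_simps)
    finally show "(X\<^sup>2 + c)\<^sup>2 \<le> (X * X')\<^sup>2" by (simp add: power_mult_distrib)
  qed (use nn in simp)
  show "X'\<^sup>2 - y'\<^sup>2 = X\<^sup>2 - y\<^sup>2 + 2 * c" using X' y' by simp
  show "c = 0" if "X = 0" using c that by simp
qed

lemma sq_step_scale:
  assumes "sq_step X y c X' y'" "t > 0"
  shows "sq_step (X/t) (y/t) (c/t\<^sup>2) (X'/t) (y'/t)"
proof -
  obtain H where nn: "0 \<le> X" "0 \<le> y" "0 \<le> X'" "0 \<le> y'" "0 \<le> H"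
    and *: "X'\<^sup>2 = X\<^sup>2 + 2 * c + H\<^sup>2" "y'\<^sup>2 = y\<^sup>2 + H\<^sup>2" "\<bar>c\<bar> \<le> X * H"
    using assms unfolding sq_step_def by auto
  have "\<bar>c\<bar> / t\<^sup>2 \<le> X * H / t\<^sup>2" using * by (intro divide_right_mono) auto
  then have "\<bar>c / t\<^sup>2\<bar> \<le> X / t * (H / t)" by (simp add: abs_divide power2_eq_square)
  moreover have "(X' / t)\<^sup>2 = (X / t)\<^sup>2 + 2 * (c / t\<^sup>2) + (H / t)\<^sup>2" "(y' / t)\<^sup>2 = (y / t)\<^sup>2 + (H / t)\<^sup>2"
    by (simp_all add: * power_divide add_divide_distrib)
  ultimately show ?thesis unfolding sq_step_def
    using nn \<open>t > 0\<close> by (auto intro!: exI[of _ "H / t"])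
qed

text \<open>
  Burkholder's functions at unit scale. Near the origin \<open>w_lt\<close> is \<open>b\<^sup>2 - a\<^sup>2\<close> and \<open>w_gt\<close> is \<open>0\<close>; far
  out \<open>w_lt\<close> grows linearly and \<open>w_gt\<close> is \<open>b\<^sup>2 - a\<^sup>2\<close> up to a function of \<open>b\<close> alone. The decay at the origin and the
  growth at infinity decide for which \<open>p\<close> the average over all scales converges: \<open>p < 2\<close> for \<open>w_lt\<close>
  and \<open>p > 2\<close> for \<open>w_gt\<close>. With \<open>(a, b) = (X, y)\<close> they control the square function by the martingale,
  with \<open>(a, b) = (y, X)\<close> the other way round.
\<close>
definition w_lt :: "real \<Rightarrow> real \<Rightarrow> real" where
  "w_lt a b = (if a + b \<le> 1 then b\<^sup>2 - a\<^sup>2 else 1 - 2 * a)"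

definition w_gt :: "real \<Rightarrow> real \<Rightarrow> real" where
  "w_gt a b = (if a + b \<le> 1 then 0 else (b - 1)\<^sup>2 - a\<^sup>2)"

lemma power2_le_of_abs_le: "b\<^sup>2 \<le> a\<^sup>2" if "b \<le> a" "- b \<le> a" for a b :: real
  using that by (simp add: abs_le_square_iff[symmetric])

lemma sq_step_slope: "X + c / X \<le> X'" if "sq_step X y c X' y'"
  using sq_stepD(1,3,7)[OF that] by (cases "X = 0") (auto simp: power2_eq_square field_simps)

text \<open>
  On \<open>X + y \<le> 1\<close> the inequality holds because \<open>w_lt\<close> never exceeds \<open>y'\<^sup>2 - X'\<^sup>2\<close> at a point that one step
  can reach from there; beyond, because \<open>w_lt\<close> lies below \<open>1 - 2 * X\<close> and the norm is convex. The
  following three lemmas have the same pattern.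
\<close>
lemma step_up_lt:
  assumes s: "sq_step X y c X' y'"
  shows "w_lt X' y' \<le> w_lt X y + (if X + y \<le> 1 then - 2 else - 2 / X) * c"
proof (cases "X + y \<le> 1")
  case True
  have "(1 - X')\<^sup>2 \<le> y'\<^sup>2" if "\<not> X' + y' \<le> 1"
    by (rule power2_le_of_abs_le) (use sq_stepD[OF s] True that in linarith)+
  then show ?thesis using sq_stepD(8)[OF s] True
    by (auto simp: w_lt_def power2_diff)
next
  case False
  have "y'\<^sup>2 \<le> (1 - X')\<^sup>2" if "X' + y' \<le> 1"
    by (rule power2_le_of_abs_le) (use sq_stepD[OF s] that in linarith)+
  then show ?thesis using sq_step_slope[OF s] False by (auto simp: w_lt_def power2_diff)
qed

lemma step_lo_lt:
  assumes s: "sq_step X y c X' y'"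
  shows "w_lt y' X' \<le> w_lt y X + (if X + y \<le> 1 then 2 else 0) * c"
proof (cases "X + y \<le> 1")
  case True
  have "(1 - y')\<^sup>2 \<le> X'\<^sup>2" if "\<not> X' + y' \<le> 1"
    by (rule power2_le_of_abs_le) (use sq_stepD[OF s] True that in linarith)+
  then show ?thesis using sq_stepD(8)[OF s] True
    by (auto simp: w_lt_def power2_diff add.commute)
next
  case False
  have "X'\<^sup>2 \<le> (1 - y')\<^sup>2" if "X' + y' \<le> 1"
    by (rule power2_le_of_abs_le) (use sq_stepD[OF s] that in linarith)+
  then show ?thesis using sq_stepD(4)[OF s] False by (auto simp: w_lt_def power2_diff add.commute)
qed

lemma step_up_gt:
  assumes s: "sq_step X y c X' y'"
  shows "w_gt X' y' \<le> w_gt X y + (if X + y \<le> 1 then 0 else - 2) * c"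
proof (cases "X + y \<le> 1")
  case True
  have "(y' - 1)\<^sup>2 \<le> X'\<^sup>2" if "\<not> X' + y' \<le> 1"
    by (rule power2_le_of_abs_le) (use sq_stepD[OF s] True that in linarith)+
  then show ?thesis using True by (auto simp: w_gt_def)
next
  case False
  have "X'\<^sup>2 \<le> (1 - y')\<^sup>2" if "X' + y' \<le> 1"
    by (rule power2_le_of_abs_le) (use sq_stepD[OF s] that in linarith)+
  then show ?thesis using sq_stepD(4,8)[OF s] False by (auto simp: w_gt_def power2_diff algebra_simps)
qed

lemma step_lo_gt:
  assumes s: "sq_step X y c X' y'"
  shows "w_gt y' X' \<le> w_gt y X + (if X + y \<le> 1 then 0 else 2 - 2 / X) * c"
proof (cases "X + y \<le> 1")
  case True
  have "(X' - 1)\<^sup>2 \<le> y'\<^sup>2" if "\<not> X' + y' \<le> 1"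
    by (rule power2_le_of_abs_le) (use sq_stepD[OF s] True that in linarith)+
  then show ?thesis using True by (auto simp: w_gt_def add.commute)
next
  case False
  have *: "y'\<^sup>2 \<le> (1 - X')\<^sup>2" if "X' + y' \<le> 1"
    by (rule power2_le_of_abs_le) (use sq_stepD[OF s] that in linarith)+
  have "(X - 1)\<^sup>2 - y\<^sup>2 + (2 - 2 / X) * c = X'\<^sup>2 - y'\<^sup>2 - 2 * (X + c / X) + 1"
    using sq_stepD(8)[OF s] by (simp add: power2_diff algebra_simps)
  then have "(X' - 1)\<^sup>2 - y'\<^sup>2 \<le> (X - 1)\<^sup>2 - y\<^sup>2 + (2 - 2 / X) * c"
    using sq_step_slope[OF s] by (simp add: power2_diff)
  then show ?thesis using False * by (auto simp: w_gt_def add.commute power2_commute[of X' 1])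
qed

text \<open>
  This integral represents all averages over scales that occur. The coefficients \<open>c3\<close> and \<open>d\<close> belong to
  \<open>t powr (p - 3)\<close>, which is integrable at \<open>0\<close> only for \<open>p > 2\<close> and at infinity only for \<open>p < 2\<close>.
\<close>
lemma piecewise_powr_integral:
  fixes s p c1 c2 c3 d :: real
  assumes s: "s > 0" and p: "p > 1" and c3: "p > 2 \<or> c3 = 0" and d: "p < 2 \<or> d = 0"
  shows "((\<lambda>t. if t \<le> s then c1 * t powr (p-1) + c2 * t powr (p-2) + c3 * t powr (p-3)
                else d * t powr (p-3)) has_integral
          (c1 * s powr p / p + c2 * s powr (p-1) / (p-1) + (c3 - d) * s powr (p-2) / (p-2))) {0..}"
proof -
  have "((\<lambda>t. c1 * t powr (p-1)) has_integral c1 * (s powr p / p)) {0..s}"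
    using has_integral_powr_from_0[of "p-1" s] s p by (intro has_integral_mult_right) auto
  moreover have "((\<lambda>t. c2 * t powr (p-2)) has_integral c2 * (s powr (p-1) / (p-1))) {0..s}"
    using has_integral_powr_from_0[of "p-2" s] s p by (intro has_integral_mult_right) auto
  moreover have "((\<lambda>t. c3 * t powr (p-3)) has_integral c3 * (s powr (p-2) / (p-2))) {0..s}"
  proof (cases "c3 = 0")
    case False
    then show ?thesis
      using has_integral_powr_from_0[of "p-3" s] s c3 by (intro has_integral_mult_right) auto
  qed auto
  ultimately have 1: "((\<lambda>t. c1 * t powr (p-1) + c2 * t powr (p-2) + c3 * t powr (p-3)) has_integral
      (c1 * (s powr p / p) + c2 * (s powr (p-1) / (p-1)) + c3 * (s powr (p-2) / (p-2)))) {0..s}"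
    by (intro has_integral_add)
  have 2: "((\<lambda>t. d * t powr (p-3)) has_integral d * (- (s powr (p-2)) / (p-2))) {s..}"
  proof (cases "d = 0")
    case False
    then have "p < 2" using d by auto
    then show ?thesis
      using has_integral_powr_to_inf[of "p-3" s] s by (intro has_integral_mult_right) (auto simp: field_simps)
  qed auto
  have l1: "((\<lambda>t. if t \<le> s then c1 * t powr (p-1) + c2 * t powr (p-2) + c3 * t powr (p-3)
                else d * t powr (p-3)) has_integral
      (c1 * (s powr p / p) + c2 * (s powr (p-1) / (p-1)) + c3 * (s powr (p-2) / (p-2)))) {0..s}"
    by (rule has_integral_eq[OF _ 1]) auto
  have l2: "((\<lambda>t. if t \<le> s then c1 * t powr (p-1) + c2 * t powr (p-2) + c3 * t powr (p-3)
                else d * t powr (p-3)) has_integral d * (- (s powr (p-2)) / (p-2))) {s..}"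
    by (rule has_integral_spike[of "{s}", OF _ _ 2]) auto
  have "{0..s} \<inter> {s..} = {s}" "{0..s} \<union> {s..} = {0..}" using s by auto
  then show ?thesis using has_integral_Un[OF l1 l2] by (simp add: algebra_simps add_divide_distrib diff_divide_distrib)
qed

text \<open>
  Steps scale, so a step inequality for \<open>w\<close> holds for \<open>w (a / t) (b / t)\<close> at every \<open>t\<close> and can be integrated
  against \<open>t powr (p - 1)\<close>. At \<open>X = y = 0\<close> the coefficient need not be integrable, but there \<open>c = 0\<close>.
\<close>
lemma step_integrate:
  fixes w A :: "real \<Rightarrow> real \<Rightarrow> real"
  assumes s: "sq_step X y c X' y'"
  and step: "\<And>X y c X' y'. sq_step X y c X' y' \<Longrightarrow> w X' y' \<le> w X y + A X y * c"
  and Phi: "\<And>a b. a \<ge> 0 \<Longrightarrow> b \<ge> 0 \<Longrightarrow> ((\<lambda>t. t powr (p-1) * w (a/t) (b/t)) has_integral Phi a b) {0..}"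
  and A: "X + y > 0 \<Longrightarrow> (\<lambda>t. t powr (p-3) * A (X/t) (y/t)) integrable_on {0..}"
  shows "Phi X' y' \<le> Phi X y + integral {0..} (\<lambda>t. t powr (p-3) * A (X/t) (y/t)) * c"
proof (rule has_integral_le)
  have "((\<lambda>t. t powr (p-3) * A (X/t) (y/t) * c) has_integral
     (integral {0..} (\<lambda>t. t powr (p-3) * A (X/t) (y/t)) * c)) {0..}"
  proof (cases "X + y > 0")
    case False
    then have "c = 0" using sq_stepD[OF s] by auto
    then show ?thesis by simp
  qed (intro has_integral_mult_left integrable_integral A)
  moreover show "((\<lambda>t. t powr (p-1) * w (X'/t) (y'/t)) has_integral Phi X' y') {0..}"
    using sq_stepD[OF s] by (intro Phi) auto
  ultimately show "((\<lambda>t. t powr (p-1) * w (X/t) (y/t) + t powr (p-3) * A (X/t) (y/t) * c) has_integral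
     (Phi X y + integral {0..} (\<lambda>t. t powr (p-3) * A (X/t) (y/t)) * c)) {0..}"
    using sq_stepD[OF s] by (intro has_integral_add Phi) auto
  fix t :: real assume "t \<in> {0..}"
  show "t powr (p-1) * w (X'/t) (y'/t) \<le> t powr (p-1) * w (X/t) (y/t) + t powr (p-3) * A (X/t) (y/t) * c"
  proof (cases "t = 0")
    case False
    then have t: "t > 0" using \<open>t \<in> {0..}\<close> by simp
    have *: "t powr (p-3) = t powr (p-1) / t\<^sup>2"
      using t by (simp add: powr_diff powr_numeral power2_eq_square power3_eq_cube)
    show ?thesis
      using mult_left_mono[OF step[OF sq_step_scale[OF s t]], of "t powr (p-1)"] t
      by (simp add: * algebra_simps)
  qed simp
qed

text \<open>
  The averages of \<open>w_lt\<close> and \<open>w_gt\<close> over all scales have this form, which up to the constants is Burkholder's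
  special function for the \<open>L\<^sup>p\<close> inequality.
\<close>
definition majorant :: "real \<Rightarrow> real \<Rightarrow> real \<Rightarrow> real \<Rightarrow> real \<Rightarrow> real" where
  "majorant \<mu> \<nu> p a b = (a + b) powr (p - 1) * (\<mu> * b - \<nu> * a)"

lemma integral_w_lt:
  assumes p: "1 < p" "p < 2" and ab: "a \<ge> 0" "b \<ge> 0"
  shows "((\<lambda>t. t powr (p-1) * w_lt (a/t) (b/t)) has_integral
     majorant (1 / p + 1 / (2-p)) (2 / (p-1) + 1 / (2-p) - 1 / p) p a b) {0..}"
proof (cases "a + b = 0")
  case True
  then have "a = 0" "b = 0" using ab by auto
  then show ?thesis by (simp add: majorant_def w_lt_def)
next
  case False
  let ?s = "a + b"
  have s: "?s > 0" using False ab by auto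
  note I = piecewise_powr_integral[OF s, of p 0 "b\<^sup>2 - a\<^sup>2" 1 "- 2 * a"]
  have p2: "?s powr (p-1) = ?s * ?s powr (p-2)" "?s powr p = ?s * ?s powr (p-1)"
    using s powr_add[of ?s 1 "p-2"] powr_add[of ?s 1 "p-1"] by auto
  have e: "majorant (1 / p + 1 / (2-p)) (2 / (p-1) + 1 / (2-p) - 1 / p) p a b =
    1 * ?s powr p / p + (- 2 * a) * ?s powr (p-1) / (p-1) + (0 - (b\<^sup>2 - a\<^sup>2)) * ?s powr (p-2) / (p-2)"
  proof -
    have *: "(0 - (b\<^sup>2 - a\<^sup>2)) * ?s powr (p-2) = (a - b) * ?s powr (p-1)"
      unfolding p2(1) by (simp add: power2_eq_square algebra_simps)
    define u v z where "u = 1 / p" "v = 1 / (2 - p)" "z = 1 / (p - 1)"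
    have uvz: "x / p = x * u" "x / (p - 1) = x * z" "x / (p - 2) = - (x * v)" for x
      using minus_divide_right[of x "2 - p"] by (auto simp: u_v_z_def)
    have "majorant (u + v) (2 * z + v - u) p a b = 1 * ?s powr p / p
       + (- 2 * a) * ?s powr (p-1) / (p-1) + (0 - (b\<^sup>2 - a\<^sup>2)) * ?s powr (p-2) / (p-2)"
      unfolding majorant_def * uvz p2(2) by (simp add: algebra_simps)
    then show ?thesis by (simp add: u_v_z_def)
  qed
  show ?thesis unfolding e
  proof (rule has_integral_spike[of "{0,?s}", OF _ _ I])
    fix t assume "t \<in> {0..} - {0,?s}"
    then have t: "t > 0" "t \<noteq> ?s" by auto
    have q: "t powr (p-1) = t\<^sup>2 * t powr (p-3)" "t powr (p-2) = t * t powr (p-3)"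
      using t powr_add[of t 2 "p-3"] powr_add[of t 1 "p-3"] by auto
    have "a / t + b / t \<le> 1 \<longleftrightarrow> ?s \<le> t" using t by (simp add: field_simps)
    then show "t powr (p-1) * w_lt (a/t) (b/t) = (if t \<le> ?s then 1 * t powr (p-1) + (- 2 * a) * t powr (p-2) + 0 * t powr (p-3)
                else (b\<^sup>2 - a\<^sup>2) * t powr (p-3))"
      unfolding w_lt_def q using t by (auto simp: power_divide field_simps power2_eq_square)
  qed (use p in auto)
qed

lemma integral_w_gt:
  assumes p: "p > 2" and ab: "a \<ge> 0" "b \<ge> 0"
  shows "((\<lambda>t. t powr (p-1) * w_gt (a/t) (b/t)) has_integral
     majorant (1 / p + 1 / (p-2) - 2 / (p-1)) (1 / (p-2) - 1 / p) p a b) {0..}"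
proof (cases "a + b = 0")
  case True
  then have "a = 0" "b = 0" using ab by auto
  then show ?thesis by (simp add: majorant_def w_gt_def)
next
  case False
  let ?s = "a + b"
  have s: "?s > 0" using False ab by auto
  note I = piecewise_powr_integral[OF s, of p "b\<^sup>2 - a\<^sup>2" 0 1 "- 2 * b"]
  have p2: "?s powr (p-1) = ?s * ?s powr (p-2)" "?s powr p = ?s * ?s powr (p-1)"
    using s powr_add[of ?s 1 "p-2"] powr_add[of ?s 1 "p-1"] by auto
  have e: "majorant (1 / p + 1 / (p-2) - 2 / (p-1)) (1 / (p-2) - 1 / p) p a b =
    1 * ?s powr p / p + (- 2 * b) * ?s powr (p-1) / (p-1) + ((b\<^sup>2 - a\<^sup>2) - 0) * ?s powr (p-2) / (p-2)"
  proof -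
    have *: "((b\<^sup>2 - a\<^sup>2) - 0) * ?s powr (p-2) = (b - a) * ?s powr (p-1)"
      unfolding p2(1) by (simp add: power2_eq_square algebra_simps)
    show ?thesis unfolding majorant_def * p2(2)
      by (simp add: algebra_simps add_divide_distrib diff_divide_distrib)
  qed
  show ?thesis unfolding e
  proof (rule has_integral_spike[of "{0,?s}", OF _ _ I])
    fix t assume "t \<in> {0..} - {0,?s}"
    then have t: "t > 0" "t \<noteq> ?s" by auto
    have q: "t powr (p-1) = t\<^sup>2 * t powr (p-3)" "t powr (p-2) = t * t powr (p-3)"
      using t powr_add[of t 2 "p-3"] powr_add[of t 1 "p-3"] by auto
    have "a / t + b / t \<le> 1 \<longleftrightarrow> ?s \<le> t" using t by (simp add: field_simps)
    then show "t powr (p-1) * w_gt (a/t) (b/t) = (if t \<le> ?s then 1 * t powr (p-1) + (- 2 * b) * t powr (p-2) + (b\<^sup>2 - a\<^sup>2) * t powr (p-3)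
                else 0 * t powr (p-3))"
      unfolding w_gt_def q using t by (auto simp: power_divide field_simps power2_eq_square)
  qed (use p in auto)
qed

lemma integrable_coeff:
  fixes X y p c d e :: real
  assumes p: "1 < p" and s: "X + y > 0"
    and d: "p < 2 \<or> d = 0" and c: "p > 2 \<or> c = 0"
    and A: "\<And>X y. A X y = (if X + y \<le> 1 then d else c + e / X)"
  shows "(\<lambda>t. t powr (p-3) * A (X/t) (y/t)) integrable_on {0..}"
proof -
  let ?s = "X + y"
  have "(\<lambda>t. if t \<le> ?s then 0 * t powr (p-1) + (e/X) * t powr (p-2) + c * t powr (p-3)
                else d * t powr (p-3)) integrable_on {0..}"
    using piecewise_powr_integral[OF s p, of c d 0 "e/X"] c d by blast
  then show ?thesis
  proof (rule integrable_spike[of _ _ "{0,?s}"])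
    fix t assume "t \<in> {0..} - {0,?s}"
    then have t: "t > 0" "t \<noteq> ?s" by auto
    have q: "t powr (p-2) = t * t powr (p-3)"
      using t powr_add[of t 1 "p-3"] by auto
    have "X / t + y / t \<le> 1 \<longleftrightarrow> ?s \<le> t" using t by (simp add: field_simps)
    then show "t powr (p-3) * A (X/t) (y/t) = (if t \<le> ?s then 0 * t powr (p-1) + (e/X) * t powr (p-2) + c * t powr (p-3)
                else d * t powr (p-3))"
      unfolding A q using t by (auto simp: field_simps)
  qed auto
qed

text \<open>
  For \<open>p = 2\<close> the majorant is \<open>b\<^sup>2 - a\<^sup>2\<close> itself.
\<close>
lemma burkholder_function:
  assumes p: "1 < p"
  obtains \<mu> \<nu> :: real and A B :: "real \<Rightarrow> real \<Rightarrow> real" where "\<mu> > 0" "\<nu> > 0"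
    "\<And>X y c X' y'. sq_step X y c X' y' \<Longrightarrow> majorant \<mu> \<nu> p X' y' \<le> majorant \<mu> \<nu> p X y + A X y * c"
    "\<And>X y c X' y'. sq_step X y c X' y' \<Longrightarrow> majorant \<mu> \<nu> p y' X' \<le> majorant \<mu> \<nu> p y X + B X y * c"
proof -
  consider "p < 2" | "p = 2" | "p > 2" by linarith
  then show thesis
  proof cases
    case 1
    let ?A1 = "\<lambda>X y. integral {0..} (\<lambda>t. t powr (p-3) * (if X/t + y/t \<le> 1 then - 2 else - 2 / (X/t)))"
    let ?B1 = "\<lambda>X y. integral {0..} (\<lambda>t. t powr (p-3) * (if X/t + y/t \<le> 1 then 2 else 0))"
    show thesis
    proof (rule that[of "1 / p + 1 / (2-p)" "2 / (p-1) + 1 / (2-p) - 1 / p" ?A1 ?B1])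
      show "0 < 1 / p + 1 / (2-p)" using p 1 by (simp add: add_pos_pos)
      have "1 / p < 2 / (p-1)" using p by (simp add: field_simps)
      moreover have "0 < 1 / (2-p)" using 1 by simp
      ultimately show "0 < 2 / (p-1) + 1 / (2-p) - 1 / p" by linarith
    next
      fix X y c X' y' assume s: "sq_step X y c X' y'"
      show "majorant (1 / p + 1 / (2-p)) (2 / (p-1) + 1 / (2-p) - 1 / p) p X' y'
         \<le> majorant (1 / p + 1 / (2-p)) (2 / (p-1) + 1 / (2-p) - 1 / p) p X y + ?A1 X y * c"
        by (rule step_integrate[where w = "w_lt" and A = "\<lambda>X y. if X + y \<le> 1 then - 2 else - 2 / X" and Phi = "majorant (1 / p + 1 / (2-p)) (2 / (p-1) + 1 / (2-p) - 1 / p) p", OF s step_up_lt integral_w_lt[OF p 1]], assumption+)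
           (rule integrable_coeff[OF p, of _ _ "-2" 0 _ "-2"], use 1 in auto)
      show "majorant (1 / p + 1 / (2-p)) (2 / (p-1) + 1 / (2-p) - 1 / p) p y' X'
         \<le> majorant (1 / p + 1 / (2-p)) (2 / (p-1) + 1 / (2-p) - 1 / p) p y X + ?B1 X y * c"
        by (rule step_integrate[where w = "\<lambda>X y. w_lt y X" and A = "\<lambda>X y. if X + y \<le> 1 then 2 else 0" and Phi = "\<lambda>a b. majorant (1 / p + 1 / (2-p)) (2 / (p-1) + 1 / (2-p) - 1 / p) p b a", OF s step_lo_lt integral_w_lt[OF p 1]], assumption+)
           (rule integrable_coeff[OF p, of _ _ 2 0 _ 0], use 1 in auto)
    qed
  next
    case 2
    show thesis
    proof (rule that[of 1 1 "\<lambda>_ _. - 2" "\<lambda>_ _. 2"])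
      have e: "majorant 1 1 p a b = b\<^sup>2 - a\<^sup>2" if "a \<ge> 0" "b \<ge> 0" for a b
        using that 2 by (cases "a + b = 0") (auto simp: majorant_def power2_eq_square algebra_simps add_nonneg_eq_0_iff)
      fix X y c X' y' assume s: "sq_step X y c X' y'"
      have "0 \<le> y'" using sq_stepD[OF s] by simp
      then show "majorant 1 1 p X' y' \<le> majorant 1 1 p X y + - 2 * c" "majorant 1 1 p y' X' \<le> majorant 1 1 p y X + 2 * c"
        using sq_stepD[OF s] by (auto simp: e)
    qed auto
  next
    case 3
    let ?m = "1 / p + 1 / (p-2) - 2 / (p-1)" and ?n = "1 / (p-2) - 1 / p"
    let ?A2 = "\<lambda>X y. integral {0..} (\<lambda>t. t powr (p-3) * (if X/t + y/t \<le> 1 then 0 else - 2))"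
    let ?B2 = "\<lambda>X y. integral {0..} (\<lambda>t. t powr (p-3) * (if X/t + y/t \<le> 1 then 0 else 2 - 2 / (X/t)))"
    show thesis
    proof (rule that[of ?m ?n ?A2 ?B2])
      have "?m = 2 / (p * (p-1) * (p-2))" using 3 by (simp add: field_simps)
      then show "0 < ?m" using 3 by simp
      show "0 < ?n" using 3 by (simp add: field_simps)
    next
      fix X y c X' y' assume s: "sq_step X y c X' y'"
      show "majorant ?m ?n p X' y' \<le> majorant ?m ?n p X y + ?A2 X y * c"
        by (rule step_integrate[where w = "w_gt" and A = "\<lambda>X y. if X + y \<le> 1 then 0 else - 2" and Phi = "majorant ?m ?n p", OF s step_up_gt integral_w_gt[OF 3]], assumption+)
           (rule integrable_coeff[OF p, of _ _ 0 "-2" _ 0], use 3 in auto)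
      show "majorant ?m ?n p y' X' \<le> majorant ?m ?n p y X + ?B2 X y * c"
        by (rule step_integrate[where w = "\<lambda>X y. w_gt y X" and A = "\<lambda>X y. if X + y \<le> 1 then 0 else 2 - 2 / X" and Phi = "\<lambda>a b. majorant ?m ?n p b a", OF s step_lo_gt integral_w_gt[OF 3]], assumption+)
           (rule integrable_coeff[OF p, of _ _ 0 2 _ "-2"], use 3 in auto)
    qed
  qed
qed

text \<open>
  The negative term matters only where \<open>b\<close> is at most a fixed multiple of \<open>a\<close>, and there everything is
  comparable with \<open>a powr p\<close>.
\<close>
lemma majorant_bounds:
  assumes p: "1 < p" and mn: "\<mu> > 0" "\<nu> > 0" and ab: "a \<ge> 0" "b \<ge> 0"
  shows "\<mu> / 2 * b powr p - (\<mu> / 2 * (2*\<nu>/\<mu>) powr p + \<nu> * (1 + 2*\<nu>/\<mu>) powr (p-1)) * a powr p \<le> majorant \<mu> \<nu> p a b"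
    and "\<bar>majorant \<mu> \<nu> p a b\<bar> \<le> (\<mu> + \<nu>) * (a + b) powr p"
    and "majorant \<mu> \<nu> p a 0 \<le> 0" and "majorant \<mu> \<nu> p 0 b = \<mu> * b powr p"
proof -
  have mul: "x powr (p-1) * x = x powr p" if "x \<ge> 0" for x
    using powr_add[of x "p-1" 1] that p by (cases "x = 0") auto
  show "majorant \<mu> \<nu> p a 0 \<le> 0" using ab mn by (simp add: majorant_def mult_nonneg_nonpos)
  show "majorant \<mu> \<nu> p 0 b = \<mu> * b powr p" using mul[of b] ab by (simp add: majorant_def)
  have "\<bar>\<mu> * b - \<nu> * a\<bar> \<le> \<mu> * b + \<nu> * a" using mn ab by (auto simp: abs_le_iff)
  also have "\<dots> \<le> (\<mu> + \<nu>) * (a + b)" using mn ab by (auto simp: algebra_simps)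
  finally have "(a + b) powr (p-1) * \<bar>\<mu> * b - \<nu> * a\<bar> \<le> (a + b) powr (p-1) * ((\<mu> + \<nu>) * (a + b))"
    by (intro mult_left_mono) auto
  also have "\<dots> = (\<mu> + \<nu>) * (a + b) powr p" using mul[of "a + b"] ab by (simp add: mult_ac)
  finally show "\<bar>majorant \<mu> \<nu> p a b\<bar> \<le> (\<mu> + \<nu>) * (a + b) powr p" by (simp add: majorant_def abs_mult)
  define r where "r = 2*\<nu>/\<mu>"
  have r: "r > 0" using mn by (simp add: r_def)
  have "\<mu> / 2 * b powr p - (\<mu> / 2 * r powr p + \<nu> * (1 + r) powr (p-1)) * a powr p \<le> majorant \<mu> \<nu> p a b"
  proof (cases "r * a \<le> b")
    case True
    then have *: "\<mu> * b - \<nu> * a \<ge> \<mu> / 2 * b" using mn by (simp add: r_def field_simps)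
    have "\<mu> / 2 * b powr p = b powr (p-1) * (\<mu> / 2 * b)" using mul[of b] ab by simp
    also have "\<dots> \<le> (a + b) powr (p-1) * (\<mu> * b - \<nu> * a)"
      using * ab p mn by (intro mult_mono powr_mono2) auto
    finally have "\<mu> / 2 * b powr p \<le> majorant \<mu> \<nu> p a b" by (simp add: majorant_def)
    moreover have "0 \<le> (\<mu> / 2 * r powr p + \<nu> * (1 + r) powr (p-1)) * a powr p" using mn by auto
    ultimately show ?thesis by linarith
  next
    case False
    then have b: "b \<le> r * a" by simp
    have "b powr p \<le> (r * a) powr p" using b ab p by (intro powr_mono2) auto
    then have 1: "\<mu> / 2 * b powr p \<le> \<mu> / 2 * r powr p * a powr p"
      using mn r ab by (simp add: powr_mult mult.assoc)
    have "(a + b) powr (p-1) * (\<nu> * a) \<le> ((1 + r) * a) powr (p-1) * (\<nu> * a)"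
      using b ab p mn by (intro mult_right_mono powr_mono2) (auto simp: algebra_simps)
    also have "\<dots> = \<nu> * (1 + r) powr (p-1) * a powr p"
      using mul[of a] ab r by (simp add: powr_mult mult_ac)
    finally have "(a + b) powr (p-1) * (\<nu> * a) \<le> \<nu> * (1 + r) powr (p-1) * a powr p" .
    moreover have "(a + b) powr (p-1) * (\<mu> * b) \<ge> 0" using mn ab by auto
    ultimately show ?thesis using 1 by (simp add: majorant_def algebra_simps)
  qed
  then show "\<mu> / 2 * b powr p - (\<mu> / 2 * (2*\<nu>/\<mu>) powr p + \<nu> * (1 + 2*\<nu>/\<mu>) powr (p-1)) * a powr p \<le> majorant \<mu> \<nu> p a b"
    by (simp add: r_def)
qed

section \<open>Functions and integrals along countable partitions\<close>

text \<open>
  Any function of a countable index is measurable, for instance the composition of an arbitrary majorant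
  with quantities that are constant on the cells of a partition.
\<close>
lemma measurable_const_on_fibers:
  fixes \<pi> :: "'a \<Rightarrow> 'i::countable" and g :: "'a \<Rightarrow> 'c"
  assumes "\<pi> \<in> measurable M (count_space UNIV)" "\<And>x y. \<pi> x = \<pi> y \<Longrightarrow> g x = g y"
    "range g \<subseteq> space N"
  shows "g \<in> measurable M N"
proof -
  define h where "h c = g (SOME x. \<pi> x = c)" for c
  have "g x = h (\<pi> x)" for x
    unfolding h_def by (rule someI2[of "\<lambda>z. \<pi> z = \<pi> x" x]) (auto intro: assms(2)[symmetric])
  then have "g = (\<lambda>x. g (SOME z. \<pi> z = \<pi> x))" by (auto simp: h_def)
  moreover have "(\<lambda>x. g (SOME z. \<pi> z = \<pi> x)) \<in> measurable M N"
    by (rule measurable_compose[OF assms(1), of "\<lambda>c. g (SOME z. \<pi> z = c)"])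
       (use assms(3) in auto)
  ultimately show ?thesis by simp
qed

text \<open>
  Inequalities between integrals only have to be checked on the fibers of a countable partition. This and
  \<open>integral_le_fibers\<close> take the place of conditional expectations.
\<close>
lemma nn_integral_le_fibers:
  fixes \<pi> :: "'a \<Rightarrow> 'i::countable"
  assumes \<pi>: "\<pi> \<in> measurable M (count_space UNIV)" and M: "space M = UNIV"
    and g: "g \<in> borel_measurable M" and h: "h \<in> borel_measurable M"
    and le: "\<And>z. (\<integral>\<^sup>+x. g x * indicator {x. \<pi> x = \<pi> z} x \<partial>M) \<le> (\<integral>\<^sup>+x. h x * indicator {x. \<pi> x = \<pi> z} x \<partial>M)"
  shows "(\<integral>\<^sup>+x. g x \<partial>M) \<le> (\<integral>\<^sup>+x. h x \<partial>M)"
proof -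
  define B where "B n = {x. to_nat (\<pi> x) = n}" for n :: nat
  have B: "B n \<in> sets M" for n
    using measurable_sets[OF \<pi>, of "to_nat -` {n}"] M by (simp add: B_def vimage_def)
  have d: "disjoint_family B" by (auto simp: disjoint_family_on_def B_def)
  have U: "(\<Union>n. B n) = UNIV" by (auto simp: B_def)
  have *: "(\<integral>\<^sup>+x. f x \<partial>M) = (\<Sum>n. \<integral>\<^sup>+x. f x * indicator (B n) x \<partial>M)" if "f \<in> borel_measurable M" for f
    using nn_integral_disjoint_family[OF that _ d] B U by auto
  have "(\<integral>\<^sup>+x. g x * indicator (B n) x \<partial>M) \<le> (\<integral>\<^sup>+x. h x * indicator (B n) x \<partial>M)" for n
  proof (cases "B n = {}")
    case False
    then obtain z where "z \<in> B n" by auto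
    then have "B n = {x. \<pi> x = \<pi> z}" by (auto simp: B_def)
    then show ?thesis using le by simp
  qed simp
  then show ?thesis unfolding *[OF g] *[OF h] by (intro suminf_le) auto
qed

lemma sums_fibers:
  fixes \<pi> :: "'a \<Rightarrow> 'i::countable" and f :: "'a \<Rightarrow> 'b::{banach, second_countable_topology}"
  assumes \<pi>: "\<pi> \<in> measurable M (count_space UNIV)" and M: "space M = UNIV"
    and Q: "Q \<in> sets M" and f: "set_integrable M Q f"
  shows "(\<lambda>n. LINT x:Q \<inter> {x. to_nat (\<pi> x) = n}|M. f x) sums (LINT x:Q|M. f x)"
proof -
  define B where "B n = Q \<inter> {x. to_nat (\<pi> x) = n}" for n :: nat
  have B: "B n \<in> sets M" for n
    using measurable_sets[OF \<pi>, of "to_nat -` {n}"] M Q by (simp add: B_def vimage_def)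
  have U: "(\<Union>n. B n) = Q" by (auto simp: B_def)
  have inc: "incseq (\<lambda>n. \<Union>i<n. B i)" unfolding incseq_def by (intro allI impI UN_mono) auto
  have U': "(\<Union>n. \<Union>i<n. B i) = Q" using U by auto
  have BQ: "set_integrable M (B n) f" for n
    by (rule set_integrable_subset[OF f B]) (auto simp: B_def)
  have "(\<Sum>i<n. LINT x:B i|M. f x) = (LINT x:(\<Union>i<n. B i)|M. f x)" for n
    by (subst set_integral_finite_Union) (auto simp: disjoint_family_on_def B_def intro: B[unfolded B_def] BQ[unfolded B_def])
  moreover have "(\<lambda>n. LINT x:(\<Union>i<n. B i)|M. f x) \<longlonglongrightarrow> (LINT x:Q|M. f x)"
    using set_integral_cont_up[OF _ inc, of M f] f B unfolding U' by auto
  ultimately show ?thesis by (simp add: sums_def B_def)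
qed

lemma integral_le_fibers:
  fixes \<pi> :: "'a \<Rightarrow> 'i::countable" and g h :: "'a \<Rightarrow> real"
  assumes \<pi>: "\<pi> \<in> measurable M (count_space UNIV)" and M: "space M = UNIV"
    and g: "integrable M g" and h: "integrable M h"
    and le: "\<And>z. (LINT x:{x. \<pi> x = \<pi> z}|M. g x) \<le> (LINT x:{x. \<pi> x = \<pi> z}|M. h x)"
  shows "(LINT x|M. g x) \<le> (LINT x|M. h x)"
proof -
  have U: "UNIV \<in> sets M" using M sets.top by metis
  have s: "(\<lambda>n. LINT x:{x. to_nat (\<pi> x) = n}|M. f x) sums (LINT x|M. f x)" if "integrable M f" for f :: "'a \<Rightarrow> real"
    using sums_fibers[OF \<pi> M U, of f] that by (simp add: set_integrable_def set_lebesgue_integral_def)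
  show ?thesis
  proof (rule sums_le[OF _ s[OF g] s[OF h]])
    fix n
    show "(LINT x:{x. to_nat (\<pi> x) = n}|M. g x) \<le> (LINT x:{x. to_nat (\<pi> x) = n}|M. h x)"
    proof (cases "{x. to_nat (\<pi> x) = n} = {}")
      case False
      then obtain z where "to_nat (\<pi> z) = n" by auto
      then have "{x. to_nat (\<pi> x) = n} = {x. \<pi> x = \<pi> z}" by auto
      then show ?thesis using le by simp
    next
      case True
      show ?thesis unfolding True by (simp add: set_lebesgue_integral_def)
    qed
  qed
qed

lemma powr_add_le: "(a + b) powr p \<le> 2 powr p * (a powr p + b powr p)"
  if "a \<ge> 0" "b \<ge> 0" "p \<ge> 0" for a b p :: real
proof -
  have "(a + b) powr p \<le> (2 * max a b) powr p" using that by (intro powr_mono2) auto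
  also have "\<dots> = 2 powr p * (max a b) powr p" using that by (simp add: powr_mult)
  also have "\<dots> \<le> 2 powr p * (a powr p + b powr p)" by (intro mult_left_mono) (auto simp: max_def)
  finally show ?thesis .
qed

lemma integrable_powr_mono:
  fixes f g :: "'a \<Rightarrow> real"
  assumes "integrable M (\<lambda>x. g x powr p)" "f \<in> borel_measurable M" "\<And>x. 0 \<le> f x" "\<And>x. f x \<le> g x" "p \<ge> 0"
  shows "integrable M (\<lambda>x. f x powr p)"
proof (rule Bochner_Integration.integrable_bound[OF assms(1)])
  show "AE x in M. norm (f x powr p) \<le> norm (g x powr p)"
    using assms by (auto intro!: AE_I2 powr_mono2)
qed (use assms(2) in measurable)

lemma integrable_powr_add:
  fixes f g :: "'a \<Rightarrow> real"
  assumes "integrable M (\<lambda>x. f x powr p)" "integrable M (\<lambda>x. g x powr p)"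
    "f \<in> borel_measurable M" "g \<in> borel_measurable M" "\<And>x. 0 \<le> f x" "\<And>x. 0 \<le> g x" "p \<ge> 0"
  shows "integrable M (\<lambda>x. (f x + g x) powr p)"
proof (rule Bochner_Integration.integrable_bound)
  show "integrable M (\<lambda>x. 2 powr p * (f x powr p + g x powr p))" using assms by auto
  show "AE x in M. norm ((f x + g x) powr p) \<le> norm (2 powr p * (f x powr p + g x powr p))"
    using assms(5-7) by (intro AE_I2) (auto intro: powr_add_le)
qed (use assms in measurable)

lemma integrable_powr_sum:
  fixes f :: "'j \<Rightarrow> 'a \<Rightarrow> real"
  assumes "finite J" "p > 0" "\<And>j x. j \<in> J \<Longrightarrow> 0 \<le> f j x" "\<And>j. j \<in> J \<Longrightarrow> integrable M (\<lambda>x. f j x powr p)"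
    "\<And>j. j \<in> J \<Longrightarrow> f j \<in> borel_measurable M"
  shows "integrable M (\<lambda>x. (\<Sum>j\<in>J. f j x) powr p)"
  using assms(1,3-5)
proof (induction J rule: finite_induct)
  case (insert j J)
  then show ?case
    using integrable_powr_add[of M "f j" p "\<lambda>x. \<Sum>j\<in>J. f j x"] assms(2)
    by (auto intro!: sum_nonneg borel_measurable_sum)
qed (use assms(2) in simp)

lemma le_one_plus_powr: "t \<le> 1 + t powr p" if "t \<ge> 0" "p \<ge> 1" for t p :: real
proof (cases "t \<le> 1")
  case False
  then have "t powr 1 \<le> t powr p" using that by (intro powr_mono) auto
  then show ?thesis using that by simp
qed (use that in \<open>simp add: add_increasing2\<close>)

lemma set_integrable_powr:
  fixes f :: "'a \<Rightarrow> 'b::{banach, second_countable_topology}"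
  assumes "f \<in> borel_measurable M" "integrable M (\<lambda>x. norm (f x) powr p)" "p \<ge> 1"
    "Q \<in> sets M" "emeasure M Q < \<infinity>"
  shows "set_integrable M Q f"
  unfolding set_integrable_def
proof (rule Bochner_Integration.integrable_bound)
  show "integrable M (\<lambda>x. indicator Q x + norm (f x) powr p)"
    using assms by (intro Bochner_Integration.integrable_add integrable_real_indicator) auto
  show "AE x in M. norm (indicat_real Q x *\<^sub>R f x) \<le> norm (indicator Q x + norm (f x) powr p :: real)"
    using le_one_plus_powr[OF norm_ge_zero assms(3)] by (intro AE_I2) (auto simp: indicator_def)
qed (use assms in measurable)

section \<open>Vector-valued martingales on countable partitions\<close>

text \<open>
  The functions \<open>U\<close> and \<open>V\<close>, scaled so that \<open>y powr p\<close> and \<open>X powr p\<close> have coefficient \<open>1\<close>, and all constants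
  merged into one. The predicate mentions real numbers only, so that one and the same \<open>C\<close> can
  be used for martingales on different spaces and with values of different dimension.
\<close>
definition square_majorants :: "real \<Rightarrow> real \<Rightarrow> bool" where
  "square_majorants p C \<longleftrightarrow> 0 < C \<and>
     (\<exists>U A V B.
       (\<forall>X y c X' y'. sq_step X y c X' y' \<longrightarrow>
          U X' y' \<le> U X y + A X y * c \<and> V X' y' \<le> V X y + B X y * c) \<and>
       (\<forall>X\<ge>0. \<forall>y\<ge>0. \<bar>U X y\<bar> \<le> C * (X + y) powr p \<and> \<bar>V X y\<bar> \<le> C * (X + y) powr p \<and>
          y powr p - C * X powr p \<le> U X y \<and> X powr p - C * y powr p \<le> V X y \<and>
          U X 0 \<le> 0 \<and> V X 0 \<le> C * X powr p))"

lemma ex_square_majorants: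
  assumes p: "1 < p"
  shows "\<exists>C. square_majorants p C"
proof -
  obtain \<mu> \<nu> :: real and A B :: "real \<Rightarrow> real \<Rightarrow> real" where mn: "\<mu> > 0" "\<nu> > 0" and
    st: "\<And>X y c X' y'. sq_step X y c X' y' \<Longrightarrow> majorant \<mu> \<nu> p X' y' \<le> majorant \<mu> \<nu> p X y + A X y * c"
    "\<And>X y c X' y'. sq_step X y c X' y' \<Longrightarrow> majorant \<mu> \<nu> p y' X' \<le> majorant \<mu> \<nu> p y X + B X y * c"
    using burkholder_function[OF p] by metis
  define K where "K = \<mu> / 2 * (2*\<nu>/\<mu>) powr p + \<nu> * (1 + 2*\<nu>/\<mu>) powr (p-1)"
  define C where "C = 2 / \<mu> * (K + \<mu> + \<nu>)"
  have K: "K \<ge> 0" using mn by (auto simp: K_def)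
  have C: "2 / \<mu> * K \<le> C" "2 / \<mu> * (\<mu> + \<nu>) \<le> C" "2 / \<mu> * \<mu> \<le> C" "C > 0"
    unfolding C_def using mn K by (intro mult_left_mono mult_pos_pos; simp)+
  have e: "2 / \<mu> * (\<mu> / 2 * z) = z" for z using mn by simp
  have lower: "b powr p - C * a powr p \<le> 2 / \<mu> * majorant \<mu> \<nu> p a b" if "a \<ge> 0" "b \<ge> 0" for a b
  proof -
    have "2 / \<mu> * (\<mu> / 2 * b powr p - K * a powr p) \<le> 2 / \<mu> * majorant \<mu> \<nu> p a b"
      using majorant_bounds(1)[OF p mn that] mn unfolding K_def by (intro mult_left_mono) auto
    moreover have "2 / \<mu> * K * a powr p \<le> C * a powr p" using C by (intro mult_right_mono) auto
    ultimately show ?thesis using e[of "b powr p"] by (simp add: right_diff_distrib mult.assoc)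
  qed
  have bd: "\<bar>2 / \<mu> * majorant \<mu> \<nu> p a b\<bar> \<le> C * (a + b) powr p" if "a \<ge> 0" "b \<ge> 0" for a b
  proof -
    have "\<bar>2 / \<mu> * majorant \<mu> \<nu> p a b\<bar> = 2 / \<mu> * \<bar>majorant \<mu> \<nu> p a b\<bar>" using mn by (simp add: abs_mult)
    also have "\<dots> \<le> 2 / \<mu> * ((\<mu> + \<nu>) * (a + b) powr p)"
      using majorant_bounds(2)[OF p mn that] mn by (intro mult_left_mono) auto
    also have "\<dots> = 2 / \<mu> * (\<mu> + \<nu>) * (a + b) powr p" by simp
    also have "\<dots> \<le> C * (a + b) powr p" using C by (intro mult_right_mono) auto
    finally show ?thesis .
  qed
  have z: "2 / \<mu> * majorant \<mu> \<nu> p a 0 \<le> 0" "2 / \<mu> * majorant \<mu> \<nu> p 0 a \<le> C * a powr p" if "a \<ge> 0" for a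
  proof -
    show "2 / \<mu> * majorant \<mu> \<nu> p a 0 \<le> 0"
      using majorant_bounds(3)[OF p mn that, of 0] mn by (intro mult_nonneg_nonpos) auto
    have "2 / \<mu> * \<mu> * a powr p \<le> C * a powr p" using C by (intro mult_right_mono) auto
    then show "2 / \<mu> * majorant \<mu> \<nu> p 0 a \<le> C * a powr p"
      using majorant_bounds(4)[OF p mn _ that, of 0] by (simp only: order_refl mult.assoc)
  qed
  have sc: "2 / \<mu> * u' \<le> 2 / \<mu> * u + 2 / \<mu> * a * c" if "u' \<le> u + a * c" for u u' a c
    using mult_left_mono[OF that, of "2 / \<mu>"] mn by (simp add: distrib_left mult.assoc)
  define U V where "U X y = 2 / \<mu> * majorant \<mu> \<nu> p X y" and "V X y = 2 / \<mu> * majorant \<mu> \<nu> p y X" for X y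
  have "\<forall>X y c X' y'. sq_step X y c X' y' \<longrightarrow>
      U X' y' \<le> U X y + 2 / \<mu> * A X y * c \<and> V X' y' \<le> V X y + 2 / \<mu> * B X y * c"
    unfolding U_def V_def using sc[OF st(1)] sc[OF st(2)] by blast
  moreover have "\<bar>U X y\<bar> \<le> C * (X + y) powr p \<and> \<bar>V X y\<bar> \<le> C * (X + y) powr p \<and>
      y powr p - C * X powr p \<le> U X y \<and> X powr p - C * y powr p \<le> V X y \<and>
      U X 0 \<le> 0 \<and> V X 0 \<le> C * X powr p" if "0 \<le> X" "0 \<le> y" for X y
    unfolding U_def V_def using bd[OF that] bd[OF that(2,1)] lower[OF that] lower[OF that(2,1)] z[OF that(1)]
    by (simp only: add.commute[of y X] simp_thms)
  ultimately show ?thesis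
    unfolding square_majorants_def using C(4)
    by (intro exI[of _ C] conjI exI[of _ U] exI[of _ "\<lambda>X y. 2 / \<mu> * A X y"] exI[of _ V]
      exI[of _ "\<lambda>X y. 2 / \<mu> * B X y"]) auto
qed

text \<open>
  A finite family of martingales with respect to the \<open>\<sigma>\<close>-algebras generated by successively finer countable
  partitions, into the fibers of \<open>\<pi> n\<close>; the family is treated as one vector with components indexed by \<open>J\<close>.
\<close>
locale atomic_martingale =
  fixes M :: "'a measure" and \<pi> :: "nat \<Rightarrow> 'a \<Rightarrow> 'i::countable" and J :: "'j set"
    and F :: "nat \<Rightarrow> 'j \<Rightarrow> 'a \<Rightarrow> 'b::euclidean_space" and p :: real
  assumes space: "space M = UNIV"
    and p: "1 < p"
    and measurable_index: "\<And>n. \<pi> n \<in> measurable M (count_space UNIV)"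
    and refine: "\<And>n x y. \<pi> (Suc n) x = \<pi> (Suc n) y \<Longrightarrow> \<pi> n x = \<pi> n y"
    and finite_fiber: "\<And>n z. emeasure M {x. \<pi> n x = \<pi> n z} < \<infinity>"
    and finite_J: "finite J"
    and const: "\<And>n j x y. j \<in> J \<Longrightarrow> \<pi> n x = \<pi> n y \<Longrightarrow> F n j x = F n j y"
    and Lp: "\<And>n j. j \<in> J \<Longrightarrow> integrable M (\<lambda>x. norm (F n j x) powr p)"
    and mart: "\<And>n j z. j \<in> J \<Longrightarrow>
       (LINT x:{x. \<pi> n x = \<pi> n z}|M. F (Suc n) j x) = (LINT x:{x. \<pi> n x = \<pi> n z}|M. F n j x)"
begin

definition path_norm :: "nat \<Rightarrow> 'a \<Rightarrow> real" where
  "path_norm n x = sqrt (\<Sum>j\<in>J. (norm (F n j x))\<^sup>2)"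

definition path_square :: "nat \<Rightarrow> 'a \<Rightarrow> real" where
  "path_square n x = sqrt (\<Sum>i<n. \<Sum>j\<in>J. (norm (F (Suc i) j x - F i j x))\<^sup>2)"

lemma sets_fiber: "{x. \<pi> n x = c} \<in> sets M"
  using measurable_sets[OF measurable_index, of "{c}" n] space by (simp add: vimage_def)

lemma refine_le: "m \<le> n \<Longrightarrow> \<pi> n x = \<pi> n y \<Longrightarrow> \<pi> m x = \<pi> m y"
  by (induction n rule: dec_induct) (auto intro: refine)

lemma const_le: "j \<in> J \<Longrightarrow> m \<le> n \<Longrightarrow> \<pi> n x = \<pi> n y \<Longrightarrow> F m j x = F m j y"
  using const refine_le by blast

lemma path_norm_const: "\<pi> n x = \<pi> n y \<Longrightarrow> path_norm n x = path_norm n y"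
  unfolding path_norm_def using const by (metis (mono_tags, lifting) sum.cong)

lemma path_square_const: "\<pi> n x = \<pi> n y \<Longrightarrow> path_square n x = path_square n y"
  unfolding path_square_def using const_le[of _ _ n x y]
  by (intro arg_cong[of _ _ sqrt] sum.cong refl) (simp add: Suc_leI)

lemma measurable_F: "j \<in> J \<Longrightarrow> F n j \<in> borel_measurable M"
  by (rule measurable_const_on_fibers[OF measurable_index const]) auto

lemma measurable_of_index:
  fixes g :: "'a \<Rightarrow> real"
  assumes "\<And>x y. \<pi> n x = \<pi> n y \<Longrightarrow> g x = g y"
  shows "g \<in> borel_measurable M"
  by (rule measurable_const_on_fibers[OF measurable_index assms]) simp_all

lemma measurable_path: "path_norm n \<in> borel_measurable M" "path_square n \<in> borel_measurable M"
  using measurable_of_index[of n "path_norm n"] measurable_of_index[of n "path_square n"] path_norm_const path_square_const by metis+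

lemma path_nonneg [simp]: "0 \<le> path_norm n x" "0 \<le> path_square n x" "path_square 0 x = 0"
  by (auto simp: path_norm_def path_square_def intro!: sum_nonneg)

lemma integrable_path_norm: "integrable M (\<lambda>x. path_norm n x powr p)"
proof (rule integrable_powr_mono)
  show "integrable M (\<lambda>x. (\<Sum>j\<in>J. norm (F n j x)) powr p)"
    using finite_J p Lp measurable_F by (intro integrable_powr_sum) auto
  show "path_norm n x \<le> (\<Sum>j\<in>J. norm (F n j x))" for x
    using L2_set_le_sum[of J "\<lambda>j. norm (F n j x)"] by (simp add: path_norm_def L2_set_def)
qed (use p measurable_path[of n] in auto)

lemma sq_step_martingale:
  "sq_step (path_norm n x) (path_square n x) (\<Sum>j\<in>J. inner (F n j x) (F (Suc n) j x - F n j x)) (path_norm (Suc n) x) (path_square (Suc n) x)"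
proof -
  define h where "h j = F (Suc n) j x - F n j x" for j
  define H where "H = sqrt (\<Sum>j\<in>J. (norm (h j))\<^sup>2)"
  have 1: "(path_norm (Suc n) x)\<^sup>2 = (path_norm n x)\<^sup>2 + 2 * (\<Sum>j\<in>J. inner (F n j x) (h j)) + H\<^sup>2"
  proof -
    have "(norm (F (Suc n) j x))\<^sup>2 = (norm (F n j x))\<^sup>2 + 2 * inner (F n j x) (h j) + (norm (h j))\<^sup>2" for j
      using dot_norm[of "F n j x" "h j"] by (simp add: h_def)
    moreover have "(path_norm m x)\<^sup>2 = (\<Sum>j\<in>J. (norm (F m j x))\<^sup>2)" for m
      by (simp add: path_norm_def sum_nonneg)
    moreover have "H\<^sup>2 = (\<Sum>j\<in>J. (norm (h j))\<^sup>2)"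
      by (simp add: H_def sum_nonneg)
    ultimately show ?thesis
      by (simp add: sum.distrib sum_distrib_left)
  qed
  have 2: "(path_square (Suc n) x)\<^sup>2 = (path_square n x)\<^sup>2 + H\<^sup>2"
    by (simp add: path_square_def H_def h_def sum_nonneg)
  have "\<bar>\<Sum>j\<in>J. inner (F n j x) (h j)\<bar> \<le> (\<Sum>j\<in>J. norm (F n j x) * norm (h j))"
    by (intro order.trans[OF sum_abs] sum_mono Cauchy_Schwarz_ineq2)
  also have "\<dots> \<le> path_norm n x * H"
    using L2_set_mult_ineq[of "\<lambda>j. norm (F n j x)" "\<lambda>j. norm (h j)" J] by (simp add: path_norm_def H_def L2_set_def)
  finally have 3: "\<bar>\<Sum>j\<in>J. inner (F n j x) (h j)\<bar> \<le> path_norm n x * H" .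
  have "0 \<le> H" by (simp add: H_def sum_nonneg)
  then show ?thesis unfolding sq_step_def using 1 2 3 by (auto simp: h_def intro!: exI[of _ H])
qed

lemma integrable_path_sum: "integrable M (\<lambda>x. (path_norm n x + path_square n x) powr p)"
proof (induction n)
  case 0
  then show ?case using integrable_path_norm[of 0] by simp
next
  case (Suc n)
  have "integrable M (\<lambda>x. ((path_norm n x + path_square n x) + 2 * path_norm (Suc n) x) powr p)"
  proof (rule integrable_powr_add)
    show "integrable M (\<lambda>x. (2 * path_norm (Suc n) x) powr p)"
      using integrable_path_norm by (simp add: powr_mult)
  qed (use Suc p measurable_path[of n] measurable_path[of "Suc n"] in auto)
  then show ?case
  proof (rule integrable_powr_mono)
    show "path_norm (Suc n) x + path_square (Suc n) x \<le> (path_norm n x + path_square n x) + 2 * path_norm (Suc n) x" for x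
      using sq_stepD(6)[OF sq_step_martingale[of n x]] by simp
  qed (use p measurable_path[of "Suc n"] in auto)
qed

lemma integrable_path_square: "integrable M (\<lambda>x. path_square n x powr p)"
  by (rule integrable_powr_mono[OF integrable_path_sum[of n]]) (use p measurable_path[of n] in auto)

lemma integrable_majorant:
  assumes "\<And>X y. X \<ge> 0 \<Longrightarrow> y \<ge> 0 \<Longrightarrow> \<bar>U X y\<bar> \<le> C * (X + y) powr p"
  shows "integrable M (\<lambda>x. U (path_norm n x) (path_square n x))"
proof (rule Bochner_Integration.integrable_bound)
  show "integrable M (\<lambda>x. C * (path_norm n x + path_square n x) powr p)" using integrable_path_sum by simp
  show "(\<lambda>x. U (path_norm n x) (path_square n x)) \<in> borel_measurable M"
    by (rule measurable_of_index[of n]) (metis path_norm_const path_square_const)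
  show "AE x in M. norm (U (path_norm n x) (path_square n x)) \<le> norm (C * (path_norm n x + path_square n x) powr p)"
    using order.trans[OF assms abs_ge_self] by (intro AE_I2) auto
qed

lemma set_integrable_F: "j \<in> J \<Longrightarrow> set_integrable M {x. \<pi> n x = \<pi> n z} (F m j)"
  using measurable_F Lp p sets_fiber finite_fiber by (intro set_integrable_powr) auto

text \<open>
  On a fiber of \<open>\<pi> n\<close> the coefficient \<open>A\<close> and the vector \<open>F n\<close> are constant, so the integral of the linear
  term over the fiber is a fixed linear functional of the mean increment, which vanishes.
\<close>
lemma supermartingale_step:
  assumes bd: "\<And>X y. X \<ge> 0 \<Longrightarrow> y \<ge> 0 \<Longrightarrow> \<bar>U X y\<bar> \<le> C * (X + y) powr p"
    and st: "\<And>X y c X' y'. sq_step X y c X' y' \<Longrightarrow> U X' y' \<le> U X y + A X y * c"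
  shows "(LINT x|M. U (path_norm (Suc n) x) (path_square (Suc n) x)) \<le> (LINT x|M. U (path_norm n x) (path_square n x))"
proof (rule integral_le_fibers[OF measurable_index space integrable_majorant[OF bd] integrable_majorant[OF bd]])
  fix z
  let ?Q = "{x. \<pi> n x = \<pi> n z}"
  define c where "c x = (\<Sum>j\<in>J. inner (F n j z) (F (Suc n) j x - F n j x))" for x
  have si: "set_integrable M ?Q (\<lambda>x. U (path_norm m x) (path_square m x))" for m
    unfolding set_integrable_def using integrable_majorant[OF bd] sets_fiber
    by (intro integrable_mult_indicator) auto
  have ci: "set_integrable M ?Q (\<lambda>x. inner (F n j z) (F (Suc n) j x - F n j x))" if "j \<in> J" for j
  proof -
    have "set_integrable M ?Q (\<lambda>x. F (Suc n) j x - F n j x)"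
      using set_integrable_F[OF that] by (intro set_integral_diff) auto
    then have "integrable M (\<lambda>x. inner (F n j z) (indicator ?Q x *\<^sub>R (F (Suc n) j x - F n j x)))"
      unfolding set_integrable_def by (rule integrable_inner_right)
    then show ?thesis unfolding set_integrable_def by (simp add: inner_scaleR_right)
  qed
  have c0: "(LINT x:?Q|M. inner (F n j z) (F (Suc n) j x - F n j x)) = 0" if "j \<in> J" for j
  proof -
    have i: "set_integrable M ?Q (\<lambda>x. F (Suc n) j x - F n j x)"
      using set_integrable_F[OF that] by (intro set_integral_diff) auto
    have "(LINT x:?Q|M. inner (F n j z) (F (Suc n) j x - F n j x)) =
       (LINT x|M. inner (F n j z) (indicator ?Q x *\<^sub>R (F (Suc n) j x - F n j x)))"
      unfolding set_lebesgue_integral_def by (simp add: inner_scaleR_right)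
    also have "\<dots> = inner (F n j z) (LINT x:?Q|M. F (Suc n) j x - F n j x)"
      using i unfolding set_lebesgue_integral_def set_integrable_def by (intro integral_inner_right) 
    also have "(LINT x:?Q|M. F (Suc n) j x - F n j x) = 0"
      using mart[OF that, of n z] set_integrable_F[OF that] by (simp add: set_integral_diff)
    finally show ?thesis by simp
  qed
  have cint: "set_integrable M ?Q c"
    unfolding set_integrable_def c_def
    using ci unfolding scaleR_sum_right set_integrable_def by (intro Bochner_Integration.integrable_sum)
  have "(LINT x:?Q|M. c x) = 0"
    unfolding c_def set_lebesgue_integral_def scaleR_sum_right
    using ci c0 by (subst Bochner_Integration.integral_sum) (auto simp: set_integrable_def set_lebesgue_integral_def)
  have "(LINT x:?Q|M. U (path_norm (Suc n) x) (path_square (Suc n) x)) \<le>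
     (LINT x:?Q|M. U (path_norm n x) (path_square n x) + A (path_norm n z) (path_square n z) * c x)"
  proof (rule set_integral_mono)
    show "set_integrable M ?Q (\<lambda>x. U (path_norm n x) (path_square n x) + A (path_norm n z) (path_square n z) * c x)"
      using si cint by (intro set_integral_add set_integrable_mult_right) auto
    fix x assume "x \<in> ?Q"
    then have x: "\<pi> n x = \<pi> n z" by simp
    have "(\<Sum>j\<in>J. inner (F n j x) (F (Suc n) j x - F n j x)) = c x"
      unfolding c_def by (intro sum.cong refl) (metis const x)
    then show "U (path_norm (Suc n) x) (path_square (Suc n) x) \<le> U (path_norm n x) (path_square n x) + A (path_norm n z) (path_square n z) * c x"
      using st[OF sq_step_martingale[of n x]] path_norm_const[OF x] path_square_const[OF x] by simp
  qed (rule si)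
  also have "\<dots> = (LINT x:?Q|M. U (path_norm n x) (path_square n x)) + (LINT x:?Q|M. A (path_norm n z) (path_square n z) * c x)"
    using si cint by (intro set_integral_add set_integrable_mult_right) auto
  also have "\<dots> = (LINT x:?Q|M. U (path_norm n x) (path_square n x))"
    using \<open>(LINT x:?Q|M. c x) = 0\<close> by simp
  finally show "(LINT x:?Q|M. U (path_norm (Suc n) x) (path_square (Suc n) x)) \<le> (LINT x:?Q|M. U (path_norm n x) (path_square n x))" .
qed

lemma supermartingale:
  assumes bd: "\<And>X y. X \<ge> 0 \<Longrightarrow> y \<ge> 0 \<Longrightarrow> \<bar>U X y\<bar> \<le> C * (X + y) powr p"
    and st: "\<And>X y c X' y'. sq_step X y c X' y' \<Longrightarrow> U X' y' \<le> U X y + A X y * c"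
  shows "(LINT x|M. U (path_norm n x) (path_square n x)) \<le> (LINT x|M. U (path_norm 0 x) 0)"
proof (induction n)
  case (Suc n)
  then show ?case using supermartingale_step[OF bd st, of n] by linarith
qed simp

theorem square_function_le:
  assumes C: "square_majorants p C"
  shows "(LINT x|M. path_square n x powr p) \<le> C * (LINT x|M. path_norm n x powr p)"
proof -
  obtain U A where
    st: "\<And>X y c X' y'. sq_step X y c X' y' \<Longrightarrow> U X' y' \<le> U X y + A X y * c" and
    bd: "\<And>X y. X \<ge> 0 \<Longrightarrow> y \<ge> 0 \<Longrightarrow> \<bar>U X y\<bar> \<le> C * (X + y) powr p" and
    lo: "\<And>X y. X \<ge> 0 \<Longrightarrow> y \<ge> 0 \<Longrightarrow> y powr p - C * X powr p \<le> U X y" and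
    ze: "\<And>X. X \<ge> 0 \<Longrightarrow> U X 0 \<le> 0"
    using C unfolding square_majorants_def by (metis order_refl)
  have "(LINT x|M. path_square n x powr p) - C * (LINT x|M. path_norm n x powr p) = (LINT x|M. path_square n x powr p - C * path_norm n x powr p)"
    using integrable_path_square integrable_path_norm by simp
  also have "\<dots> \<le> (LINT x|M. U (path_norm n x) (path_square n x))"
    using integrable_path_square integrable_path_norm integrable_majorant[OF bd] lo by (intro integral_mono) auto
  also have "\<dots> \<le> (LINT x|M. U (path_norm 0 x) 0)" by (rule supermartingale[OF bd st])
  also have "\<dots> \<le> (LINT x|M. 0)" 
    using integrable_majorant[OF bd, of 0] ze by (intro integral_mono) auto
  finally show ?thesis by simp
qed

theorem le_square_function:
  assumes C: "square_majorants p C"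
  shows "(LINT x|M. path_norm n x powr p) \<le> C * (LINT x|M. path_square n x powr p) + C * (LINT x|M. path_norm 0 x powr p)"
proof -
  obtain V B where
    st: "\<And>X y c X' y'. sq_step X y c X' y' \<Longrightarrow> V X' y' \<le> V X y + B X y * c" and
    bd: "\<And>X y. X \<ge> 0 \<Longrightarrow> y \<ge> 0 \<Longrightarrow> \<bar>V X y\<bar> \<le> C * (X + y) powr p" and
    lo: "\<And>X y. X \<ge> 0 \<Longrightarrow> y \<ge> 0 \<Longrightarrow> X powr p - C * y powr p \<le> V X y" and
    ze: "\<And>X. X \<ge> 0 \<Longrightarrow> V X 0 \<le> C * X powr p"
    using C unfolding square_majorants_def by (metis order_refl)
  have "(LINT x|M. path_norm n x powr p) - C * (LINT x|M. path_square n x powr p) = (LINT x|M. path_norm n x powr p - C * path_square n x powr p)"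
    using integrable_path_square integrable_path_norm by simp
  also have "\<dots> \<le> (LINT x|M. V (path_norm n x) (path_square n x))"
    using integrable_path_square integrable_path_norm integrable_majorant[OF bd] lo by (intro integral_mono) auto
  also have "\<dots> \<le> (LINT x|M. V (path_norm 0 x) 0)" by (rule supermartingale[OF bd st])
  also have "\<dots> \<le> (LINT x|M. C * path_norm 0 x powr p)" 
    using integrable_majorant[OF bd, of 0] integrable_path_norm ze by (intro integral_mono) auto
  finally show ?thesis by simp
qed

end

section \<open>Averages over a two-parameter grid\<close>

text \<open>
  The tangent line of \<open>t powr p\<close> at \<open>s\<close>. With \<open>s\<close> the mean it yields Jensen's inequality on a cell.
\<close>
lemma powr_tangent:
  fixes s t p :: real
  assumes "0 \<le> s" "0 \<le> t" "1 \<le> p"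
  shows "s powr p + p * s powr (p - 1) * (t - s) \<le> t powr p"
proof (cases "s = 0 \<or> t = 0")
  case True
  have "s powr (p - 1) * s = s powr p"
    using powr_add[of s "p - 1" 1] assms by (cases "s = 0") auto
  then have "s powr p + p * s powr (p - 1) * (0 - s) = (1 - p) * s powr p"
    by (simp add: algebra_simps)
  also have "\<dots> \<le> 0" using assms by (intro mult_nonpos_nonneg) auto
  finally show ?thesis using True by auto
next
  case False
  then have "s > 0" "t > 0" using assms by auto
  have "p * s powr (p - 1) * (t - s) \<le> t powr p - s powr p"
  proof (rule convex_on_imp_above_tangent)
    show "convex_on {0<..} (\<lambda>x. x powr p)" using assms by (intro powr_convex)
    show "((\<lambda>x. x powr p) has_real_derivative p * s powr (p - 1)) (at s within {0<..})"
      using \<open>s > 0\<close> by (auto intro!: derivative_eq_intros)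
  qed (use \<open>s > 0\<close> \<open>t > 0\<close> in \<open>auto simp: interior_open\<close>)
  then show ?thesis by simp
qed

definition in_Lp :: "'a measure \<Rightarrow> real \<Rightarrow> ('a \<Rightarrow> 'b::real_normed_vector) \<Rightarrow> bool" where
  "in_Lp M p f \<longleftrightarrow> f \<in> borel_measurable M \<and> integrable M (\<lambda>x. norm (f x) powr p)"

lemma in_Lp_diff:
  fixes f g :: "'a \<Rightarrow> 'b::{banach, second_countable_topology}"
  assumes f: "in_Lp M p f" and g: "in_Lp M p g" and p: "p \<ge> 0"
  shows "in_Lp M p (\<lambda>x. f x - g x)"
    and "(LINT x|M. norm (f x - g x) powr p) \<le> 2 powr p * ((LINT x|M. norm (f x) powr p) + (LINT x|M. norm (g x) powr p))"
proof -
  have [measurable]: "f \<in> borel_measurable M" "g \<in> borel_measurable M" using f g by (auto simp: in_Lp_def)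
  have i: "integrable M (\<lambda>x. norm (f x) powr p)" "integrable M (\<lambda>x. norm (g x) powr p)"
    using f g by (auto simp: in_Lp_def)
  have "integrable M (\<lambda>x. (norm (f x) + norm (g x)) powr p)"
    using i p by (intro integrable_powr_add) auto
  then have j: "integrable M (\<lambda>x. norm (f x - g x) powr p)"
    by (rule integrable_powr_mono) (use p in \<open>auto intro: norm_triangle_ineq4\<close>)
  then show "in_Lp M p (\<lambda>x. f x - g x)" by (simp add: in_Lp_def)
  have "norm (f x - g x) powr p \<le> 2 powr p * (norm (f x) powr p + norm (g x) powr p)" for x
    by (rule order.trans[OF powr_mono2[OF p norm_ge_zero norm_triangle_ineq4] powr_add_le]) (use p in auto)
  then have "(LINT x|M. norm (f x - g x) powr p) \<le> (LINT x|M. 2 powr p * (norm (f x) powr p + norm (g x) powr p))"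
    using i j by (intro integral_mono) auto
  also have "\<dots> = 2 powr p * ((LINT x|M. norm (f x) powr p) + (LINT x|M. norm (g x) powr p))"
    using i by simp
  finally show "(LINT x|M. norm (f x - g x) powr p) \<le> 2 powr p * ((LINT x|M. norm (f x) powr p) + (LINT x|M. norm (g x) powr p))" .
qed

text \<open>
  The grid at level \<open>(k, l)\<close> has one cell for each pair consisting of a value of \<open>a k\<close> and a value of \<open>b l\<close>.
  The points \<open>y\<close> and \<open>z\<close> in the last assumption are unrelated: as the measure is positive, any value of
  \<open>a k\<close> occurs together with any value of \<open>b l\<close>, and this is where the grid is a product.
\<close>
locale product_grid =
  fixes M :: "'a measure" and a b :: "int \<Rightarrow> 'a \<Rightarrow> 'i::countable" and \<alpha> \<beta> :: "int \<Rightarrow> real"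
  assumes space: "space M = UNIV"
    and measurable_a: "\<And>k. a k \<in> measurable M (count_space UNIV)"
    and measurable_b: "\<And>l. b l \<in> measurable M (count_space UNIV)"
    and refine_a: "\<And>k x y. a (k + 1) x = a (k + 1) y \<Longrightarrow> a k x = a k y"
    and refine_b: "\<And>l x y. b (l + 1) x = b (l + 1) y \<Longrightarrow> b l x = b l y"
    and pos: "\<And>k. 0 < \<alpha> k" "\<And>l. 0 < \<beta> l"
    and emeasure_cell: "\<And>k l y z. emeasure M {x. a k x = a k y \<and> b l x = b l z} = ennreal (\<alpha> k * \<beta> l)"
begin

lemma pos_ab: "0 < \<alpha> k * \<beta> l"
  using pos by simp

definition cell :: "int \<Rightarrow> int \<Rightarrow> 'a \<Rightarrow> 'a set" where
  "cell k l x = {y. a k y = a k x \<and> b l y = b l x}"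

definition E :: "int \<Rightarrow> int \<Rightarrow> ('a \<Rightarrow> 'b) \<Rightarrow> 'a \<Rightarrow> 'b::euclidean_space" where
  "E k l f x = (LINT y:cell k l x|M. f y) /\<^sub>R (\<alpha> k * \<beta> l)"

lemma measurable_ab: "(\<lambda>x. (a k x, b l x)) \<in> measurable M (count_space UNIV)"
  using measurable_Pair[OF measurable_a measurable_b]
  by (simp add: pair_measure_countable[OF countableI_type countableI_type])

lemma cell_eq_fiber: "cell k l z = {x. (a k x, b l x) = (a k z, b l z)}"
  by (auto simp: cell_def)

lemma sets_cell: "cell k l x \<in> sets M"
  using measurable_sets[OF measurable_ab, of "{(a k x, b l x)}" k l] space by (simp add: cell_eq_fiber vimage_def)

lemma emeasure_cell_point: "emeasure M (cell k l x) = ennreal (\<alpha> k * \<beta> l)"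
  unfolding cell_def by (rule emeasure_cell)

lemma measure_cell: "measure M (cell k l x) = \<alpha> k * \<beta> l"
  using pos by (simp add: measure_def emeasure_cell_point less_imp_le)

lemma refine_a_le: "k \<le> k' \<Longrightarrow> a k' x = a k' y \<Longrightarrow> a k x = a k y"
  by (induction k' rule: int_ge_induct) (auto intro: refine_a)

lemma refine_b_le: "l \<le> l' \<Longrightarrow> b l' x = b l' y \<Longrightarrow> b l x = b l y"
  by (induction l' rule: int_ge_induct) (auto intro: refine_b)

lemma cell_cong: "a k x = a k y \<Longrightarrow> b l x = b l y \<Longrightarrow> cell k l x = cell k l y"
  by (simp add: cell_def)

lemma E_cong: "a k x = a k y \<Longrightarrow> b l x = b l y \<Longrightarrow> E k l f x = E k l f y"
  by (simp add: E_def cell_cong[of k x y l])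

lemma E_refine: "k \<le> k' \<Longrightarrow> l \<le> l' \<Longrightarrow> (a k' x, b l' x) = (a k' y, b l' y) \<Longrightarrow> E k l f x = E k l f y"
  using refine_a_le refine_b_le by (blast intro: E_cong)

lemma measurable_of_index:
  fixes g :: "'a \<Rightarrow> 'c::topological_space"
  assumes "\<And>x y. (a k x, b l x) = (a k y, b l y) \<Longrightarrow> g x = g y"
  shows "g \<in> borel_measurable M"
  by (rule measurable_const_on_fibers[OF measurable_ab assms]) simp_all

lemma measurable_E: "E k l f \<in> borel_measurable M"
  by (rule measurable_of_index) (auto intro: E_cong)

lemma set_integrable_cell: "in_Lp M p f \<Longrightarrow> p \<ge> 1 \<Longrightarrow> set_integrable M (cell k l x) f"
  for f :: "'a \<Rightarrow> 'b::euclidean_space"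
  unfolding in_Lp_def by (rule set_integrable_powr) (auto simp: sets_cell emeasure_cell_point)

lemma E_diff:
  assumes "in_Lp M p f" "in_Lp M p g" "p \<ge> 1"
  shows "E k l (\<lambda>x. f x - g x) x = E k l f x - E k l g x"
  unfolding E_def using assms
  by (subst set_integral_diff) (auto intro: set_integrable_cell simp: scaleR_diff_right)

lemma integral_const_cell:
  assumes "\<And>y. y \<in> cell k l x \<Longrightarrow> g y = c"
  shows "(LINT y:cell k l x|M. g y) = (\<alpha> k * \<beta> l) *\<^sub>R (c :: 'b::euclidean_space)"
proof -
  have "(LINT y:cell k l x|M. g y) = (LINT y:cell k l x|M. c)"
    using assms sets_cell by (intro set_lebesgue_integral_cong) auto
  also have "\<dots> = measure M (cell k l x) *\<^sub>R c"
    using sets_cell by (simp add: set_lebesgue_integral_def emeasure_cell_point space)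
  finally show ?thesis by (simp add: measure_cell)
qed

lemma norm_E_le:
  assumes "in_Lp M p f" "p \<ge> 1"
  shows "norm (E k l f x) * (\<alpha> k * \<beta> l) \<le> (LINT y:cell k l x|M. norm (f y))"
proof -
  have "norm (LINT y:cell k l x|M. f y) \<le> (LINT y:cell k l x|M. norm (f y))"
    unfolding set_lebesgue_integral_def
    using integral_norm_bound[of M "\<lambda>y. indicator (cell k l x) y *\<^sub>R f y"] by simp
  moreover have "norm (E k l f x) * (\<alpha> k * \<beta> l) = norm (LINT y:cell k l x|M. f y)"
    using pos[of k] pos(2)[of l] by (simp add: E_def abs_mult field_simps)
  ultimately show ?thesis by simp
qed

lemma set_integrable_const_cell: "set_integrable M (cell k l x) (\<lambda>y. c :: 'b::euclidean_space)"
  using sets_cell by (auto simp: set_integrable_def emeasure_cell_point)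

lemma norm_E_le_bound:
  assumes f: "in_Lp M p f" and p: "p \<ge> 1" and B: "\<And>x. norm (f x) \<le> B"
  shows "norm (E k l f x) \<le> B"
proof -
  have "norm (E k l f x) * (\<alpha> k * \<beta> l) \<le> (LINT y:cell k l x|M. norm (f y))"
    by (rule norm_E_le[OF f p])
  also have "\<dots> \<le> (LINT y:cell k l x|M. B)"
    by (intro set_integral_mono set_integrable_norm set_integrable_cell[OF f p] set_integrable_const_cell B)
  also have "\<dots> = B * (\<alpha> k * \<beta> l)"
    by (subst integral_const_cell[of _ _ _ _ B]) auto
  finally show ?thesis using pos_ab[of k l] by (simp only: mult_le_cancel_right_pos)
qed

lemma jensen_cell:
  assumes f: "in_Lp M p f" and p: "p \<ge> 1"
  shows "norm (E k l f x) powr p * (\<alpha> k * \<beta> l) \<le> (LINT y:cell k l x|M. norm (f y) powr p)"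
proof -
  let ?Q = "cell k l x"
  define s where "s = norm (E k l f x)"
  have i: "set_integrable M ?Q (\<lambda>y. norm (f y))"
    using set_integrable_cell[OF f p] by (rule set_integrable_norm)
  have j: "set_integrable M ?Q (\<lambda>y. norm (f y) powr p)"
    using f sets_cell integrable_mult_indicator unfolding in_Lp_def set_integrable_def by blast
  note c = set_integrable_const_cell[of k l x, where 'b = real]
  have "s powr p * (\<alpha> k * \<beta> l) \<le> s powr p * (\<alpha> k * \<beta> l) + p * s powr (p-1) * ((LINT y:?Q|M. norm (f y)) - s * (\<alpha> k * \<beta> l))"
    using norm_E_le[OF f p, of k l x] p by (simp add: s_def)
  also have "\<dots> = (LINT y:?Q|M. s powr p + p * s powr (p-1) * (norm (f y) - s))"
    using i c integral_const_cell[of k l x "\<lambda>_. s" s] integral_const_cell[of k l x "\<lambda>_. s powr p" "s powr p"]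
    by (simp add: set_integral_add set_integral_diff mult.commute)
  also have "\<dots> \<le> (LINT y:?Q|M. norm (f y) powr p)"
    using i j c p by (intro set_integral_mono powr_tangent set_integral_add set_integrable_mult_right set_integral_diff) (auto simp: s_def)
  finally show ?thesis by (simp add: s_def)
qed

lemma E_contraction:
  assumes f: "in_Lp M p f" and p: "p \<ge> 1"
  shows "in_Lp M p (E k l f)"
    and "(LINT x|M. norm (E k l f x) powr p) \<le> (LINT x|M. norm (f x) powr p)"
proof -
  note [measurable] = measurable_E
  have fm [measurable]: "f \<in> borel_measurable M" and fi: "integrable M (\<lambda>x. norm (f x) powr p)"
    using f by (auto simp: in_Lp_def)
  have *: "(\<integral>\<^sup>+x. ennreal (norm (E k l f x) powr p) \<partial>M) \<le> (\<integral>\<^sup>+x. ennreal (norm (f x) powr p) \<partial>M)"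
  proof (rule nn_integral_le_fibers[OF measurable_ab space])
    fix z
    let ?Q = "cell k l z"
    have [measurable]: "?Q \<in> sets M" by (rule sets_cell)
    have "(\<integral>\<^sup>+x. ennreal (norm (E k l f x) powr p) * indicator ?Q x \<partial>M) =
        (\<integral>\<^sup>+x. ennreal (norm (E k l f z) powr p) * indicator ?Q x \<partial>M)"
    proof (intro nn_integral_cong)
      fix x
      have "E k l f x = E k l f z" if "x \<in> ?Q"
        using that by (intro E_cong) (auto simp: cell_def)
      then show "ennreal (norm (E k l f x) powr p) * indicator ?Q x = ennreal (norm (E k l f z) powr p) * indicator ?Q x"
        by (auto simp: indicator_def)
    qed
    also have "\<dots> = ennreal (norm (E k l f z) powr p * (\<alpha> k * \<beta> l))"
      by (simp add: nn_integral_cmult_indicator emeasure_cell_point ennreal_mult')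
    also have "\<dots> \<le> ennreal (LINT y:?Q|M. norm (f y) powr p)"
      by (intro ennreal_leI jensen_cell f p)
    also have "\<dots> = (\<integral>\<^sup>+x. ennreal (norm (f x) powr p) * indicator ?Q x \<partial>M)"
    proof -
      have "integrable M (\<lambda>x. indicator ?Q x *\<^sub>R norm (f x) powr p)"
        using fi by (intro integrable_mult_indicator) auto
      then have "ennreal (LINT y:?Q|M. norm (f y) powr p) = (\<integral>\<^sup>+x. ennreal (indicator ?Q x *\<^sub>R norm (f x) powr p) \<partial>M)"
        unfolding set_lebesgue_integral_def by (intro nn_integral_eq_integral[symmetric]) auto
      also have "\<dots> = (\<integral>\<^sup>+x. ennreal (norm (f x) powr p) * indicator ?Q x \<partial>M)"
        by (intro nn_integral_cong) (auto simp: indicator_def)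
      finally show ?thesis .
    qed
    finally show "(\<integral>\<^sup>+x. ennreal (norm (E k l f x) powr p) * indicator {x. (a k x, b l x) = (a k z, b l z)} x \<partial>M)
       \<le> (\<integral>\<^sup>+x. ennreal (norm (f x) powr p) * indicator {x. (a k x, b l x) = (a k z, b l z)} x \<partial>M)"
      unfolding cell_eq_fiber .
  qed measurable
  have fin: "(\<integral>\<^sup>+x. ennreal (norm (f x) powr p) \<partial>M) = ennreal (LINT x|M. norm (f x) powr p)"
    using fi by (intro nn_integral_eq_integral) auto
  have i: "integrable M (\<lambda>x. norm (E k l f x) powr p)"
  proof (rule integrableI_bounded)
    show "(\<integral>\<^sup>+x. ennreal (norm (norm (E k l f x) powr p)) \<partial>M) < \<infinity>"
      using * unfolding fin by (simp add: le_less_trans[OF _ ennreal_less_top])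
  qed measurable
  then show "in_Lp M p (E k l f)" by (simp add: in_Lp_def measurable_E)
  have "ennreal (LINT x|M. norm (E k l f x) powr p) \<le> ennreal (LINT x|M. norm (f x) powr p)"
    using * unfolding fin using nn_integral_eq_integral[OF i] by simp
  then show "(LINT x|M. norm (E k l f x) powr p) \<le> (LINT x|M. norm (f x) powr p)"
    by (simp add: ennreal_le_iff)
qed

text \<open>
  The martingale property in the first index, tested on cells that may be finer in the second one. Each
  child of the coarse cell \<open>cell k l z\<close> meets \<open>cell k l' z\<close> in the same proportion \<open>\<beta> l' / \<beta> l\<close>, so the two
  integrals are the same multiple of the integral of \<open>f\<close> over \<open>cell k l z\<close>.
\<close>
lemma tower:
  assumes f: "in_Lp M p f" and p: "p \<ge> 1" and l: "l \<le> l'"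
  shows "(LINT x:cell k l' z|M. E (k + 1) l f x) = (LINT x:cell k l' z|M. E k l f x)"
proof -
  let ?Q = "cell k l' z" and ?P = "cell k l z"
  define B where "B n = {x. to_nat (a (k + 1) x) = n}" for n
  have 1: "(\<lambda>n. LINT x:?Q \<inter> B n|M. E (k + 1) l f x) sums (LINT x:?Q|M. E (k + 1) l f x)"
    unfolding B_def
    by (rule sums_fibers[OF measurable_a space sets_cell set_integrable_cell[OF E_contraction(1)[OF f p] p]])
  have "(\<lambda>n. LINT x:?P \<inter> B n|M. f x) sums (LINT x:?P|M. f x)"
    unfolding B_def by (rule sums_fibers[OF measurable_a space sets_cell set_integrable_cell[OF f p]])
  then have 2: "(\<lambda>n. (\<beta> l' / \<beta> l) *\<^sub>R (LINT x:?P \<inter> B n|M. f x)) sums ((\<beta> l' / \<beta> l) *\<^sub>R (LINT x:?P|M. f x))"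
    by (rule sums_scaleR_right)
  have 3: "(LINT x:?Q \<inter> B n|M. E (k + 1) l f x) = (\<beta> l' / \<beta> l) *\<^sub>R (LINT x:?P \<inter> B n|M. f x)" for n
  proof (cases "?P \<inter> B n = {}")
    case True
    moreover have "?Q \<subseteq> ?P" by (auto simp: cell_def intro: refine_b_le[OF l])
    ultimately have e: "?Q \<inter> B n = {}" by auto
    show ?thesis unfolding True e by (simp add: set_lebesgue_integral_def)
  next
    case False
    then obtain v where v: "v \<in> ?P" "v \<in> B n" by auto
    \<comment> \<open>the product structure provides a point of the fine cell in the same child\<close>
    have "emeasure M {x. a (k + 1) x = a (k + 1) v \<and> b l' x = b l' z} \<noteq> 0"
      unfolding emeasure_cell using pos by (simp add: ennreal_eq_0_iff not_le)
    then have "{x. a (k + 1) x = a (k + 1) v \<and> b l' x = b l' z} \<noteq> {}" by (metis emeasure_empty)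
    then obtain w where w: "a (k + 1) w = a (k + 1) v" "b l' w = b l' z" by auto
    have w': "a k w = a k z" "b l w = b l z" "to_nat (a (k + 1) w) = n"
      using refine_a[OF w(1)] refine_b_le[OF l w(2)] v w by (auto simp: cell_def B_def)
    have ra: "a k x = a k z" if "a (k + 1) x = a (k + 1) w" for x
      using refine_a[OF that] w'(1) by simp
    have Q: "?Q \<inter> B n = cell (k + 1) l' w" and P: "?P \<inter> B n = cell (k + 1) l w"
      using w(2) w' ra by (auto simp: cell_def B_def)
    have "(LINT x:?Q \<inter> B n|M. E (k + 1) l f x) = (\<alpha> (k + 1) * \<beta> l') *\<^sub>R E (k + 1) l f w"
      unfolding Q by (intro integral_const_cell E_cong) (auto simp: cell_def intro: refine_b_le[OF l])
    also have "\<dots> = (\<beta> l' / \<beta> l) *\<^sub>R (LINT x:?P \<inter> B n|M. f x)"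
      unfolding P E_def using pos[of "k+1"] pos(2)[of l] by (simp add: field_simps)
    finally show ?thesis .
  qed
  have "(LINT x:?Q|M. E (k + 1) l f x) = (\<beta> l' / \<beta> l) *\<^sub>R (LINT x:?P|M. f x)"
    using sums_unique2[OF 1 2[folded 3]] .
  also have "\<dots> = (\<alpha> k * \<beta> l') *\<^sub>R E k l f z"
    unfolding E_def using pos(1)[of k] pos(2)[of l] by (simp add: field_simps)
  also have "\<dots> = (LINT x:?Q|M. E k l f x)"
    by (intro integral_const_cell[symmetric] E_cong) (auto simp: cell_def intro: refine_b_le[OF l])
  finally show ?thesis .
qed

subsection \<open>Truncated square functions\<close>

definition delta :: "int \<Rightarrow> int \<Rightarrow> ('a \<Rightarrow> 'b) \<Rightarrow> 'a \<Rightarrow> 'b::euclidean_space" where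
  "delta k l f x = E (k + 1) (l + 1) f x - E (k + 1) l f x - E k (l + 1) f x + E k l f x"

text \<open>
  The bi-parameter square function restricted to levels in \<open>[-N, N)\<close>, and the square function in the second
  index alone at a fixed level of the first.
\<close>
definition square_trunc :: "nat \<Rightarrow> ('a \<Rightarrow> 'b::euclidean_space) \<Rightarrow> 'a \<Rightarrow> real" where
  "square_trunc N f x =
     sqrt (\<Sum>k\<in>{- int N..<int N}. \<Sum>l\<in>{- int N..<int N}. (norm (delta k l f x))\<^sup>2)"

definition square_row :: "nat \<Rightarrow> int \<Rightarrow> ('a \<Rightarrow> 'b::euclidean_space) \<Rightarrow> 'a \<Rightarrow> real" where
  "square_row N k f x = sqrt (\<Sum>l\<in>{- int N..<int N}. (norm (E k (l + 1) f x - E k l f x))\<^sup>2)"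

text \<open>
  Exchanging the indices gives another grid, which transfers results from one index to the other.
\<close>
lemma swapped: "product_grid M b a \<beta> \<alpha>"
proof
  fix k l y z
  have "{x. b k x = b k y \<and> a l x = a l z} = {x. a l x = a l z \<and> b k x = b k y}" by auto
  then show "emeasure M {x. b k x = b k y \<and> a l x = a l z} = ennreal (\<beta> k * \<alpha> l)"
    by (simp only: emeasure_cell mult.commute)
qed (rule space measurable_a measurable_b pos | erule refine_b refine_a)+

lemma swapped_cell: "product_grid.cell b a l k x = cell k l x"
  using product_grid.cell_def[OF swapped, of l k x] by (auto simp: cell_def)

lemma swapped_E: "product_grid.E M b a \<beta> \<alpha> l k f = E k l f"
  by (rule ext) (simp add: product_grid.E_def[OF swapped] E_def swapped_cell mult.commute)

lemma tower_swapped: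
  assumes f: "in_Lp M p f" and p: "p \<ge> 1" and k: "k \<le> k'"
  shows "(LINT x:cell k' l z|M. E k (l + 1) f x) = (LINT x:cell k' l z|M. E k l f x)"
  using product_grid.tower[OF swapped f p k, of l z] by (simp add: swapped_E swapped_cell)

lemma sum_int_shift: "(\<Sum>i<2 * N. g (int i - int N)) = (\<Sum>k\<in>{- int N..<int N}. g k)"
  by (rule sum.reindex_bij_witness[of _ "\<lambda>k. nat (k + int N)" "\<lambda>i. int i - int N"]) auto

text \<open>
  Cells of level \<open>N\<close> in the second index are fine enough to make all components of the row constant.
\<close>
lemma martingale_in_k:
  assumes f: "in_Lp M p f" and p: "p > 1"
  shows "atomic_martingale M (\<lambda>n x. (a (int n - int N) x, b (int N) x)) {- int N..<int N}
     (\<lambda>n l x. E (int n - int N) (l + 1) f x - E (int n - int N) l f x) p"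
proof
  fix n :: nat and x y z :: 'a and l
  let ?k = "int n - int N" and ?k' = "int (Suc n) - int N"
  have k': "?k' = ?k + 1" by simp
  have p1: "p \<ge> 1" using p by simp
  show "(\<lambda>x. (a ?k x, b (int N) x)) \<in> measurable M (count_space UNIV)" by (rule measurable_ab)
  show "(a ?k x, b (int N) x) = (a ?k y, b (int N) y)" if "(a ?k' x, b (int N) x) = (a ?k' y, b (int N) y)"
    using that unfolding k' by (auto dest: refine_a)
  show "emeasure M {x. (a ?k x, b (int N) x) = (a ?k z, b (int N) z)} < \<infinity>"
    unfolding cell_eq_fiber[symmetric] emeasure_cell_point by simp
  assume l: "l \<in> {- int N..<int N}"
  show "E ?k (l + 1) f x - E ?k l f x = E ?k (l + 1) f y - E ?k l f y"
    if "(a ?k x, b (int N) x) = (a ?k y, b (int N) y)"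
    using that l by (intro arg_cong2[of _ _ _ _ minus] E_refine[of ?k ?k _ "int N"]) auto
  show "integrable M (\<lambda>x. norm (E ?k (l + 1) f x - E ?k l f x) powr p)"
    using in_Lp_diff(1)[OF E_contraction(1)[OF f p1] E_contraction(1)[OF f p1]] p by (simp add: in_Lp_def)
  have i: "set_integrable M (cell k (int N) z) (E k' l' f)" for k k' l'
    by (rule set_integrable_cell[OF E_contraction(1)[OF f p1] p1])
  show "(LINT x:{x. (a ?k x, b (int N) x) = (a ?k z, b (int N) z)}|M. E ?k' (l + 1) f x - E ?k' l f x) =
     (LINT x:{x. (a ?k x, b (int N) x) = (a ?k z, b (int N) z)}|M. E ?k (l + 1) f x - E ?k l f x)"
    using l unfolding cell_eq_fiber[symmetric] k' by (simp add: set_integral_diff i tower[OF f p1])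
qed (use space p in auto)

lemma martingale_in_l:
  assumes f: "in_Lp M p f" and p: "p > 1"
  shows "atomic_martingale M (\<lambda>n x. (a k x, b (int n - int N) x)) {0::int}
     (\<lambda>n _. E k (int n - int N) f) p"
proof
  fix n :: nat and x y z :: 'a and j :: int
  let ?l = "int n - int N" and ?l' = "int (Suc n) - int N"
  have l': "?l' = ?l + 1" by simp
  have p1: "p \<ge> 1" using p by simp
  show "(\<lambda>x. (a k x, b ?l x)) \<in> measurable M (count_space UNIV)" by (rule measurable_ab)
  show "(a k x, b ?l x) = (a k y, b ?l y)" if "(a k x, b ?l' x) = (a k y, b ?l' y)"
    using that unfolding l' by (auto dest: refine_b)
  show "emeasure M {x. (a k x, b ?l x) = (a k z, b ?l z)} < \<infinity>"
    unfolding cell_eq_fiber[symmetric] emeasure_cell_point by simp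
  show "E k ?l f x = E k ?l f y" if "(a k x, b ?l x) = (a k y, b ?l y)"
    using that by (auto intro: E_cong)
  show "integrable M (\<lambda>x. norm (E k ?l f x) powr p)"
    using E_contraction(1)[OF f p1] by (simp add: in_Lp_def)
  show "(LINT x:{x. (a k x, b ?l x) = (a k z, b ?l z)}|M. E k ?l' f x) =
     (LINT x:{x. (a k x, b ?l x) = (a k z, b ?l z)}|M. E k ?l f x)"
    unfolding cell_eq_fiber[symmetric] l' by (rule tower_swapped[OF f p1]) simp
qed (use space p in auto)

lemma row_bounds:
  assumes f: "in_Lp M p f" and p: "p > 1" and C: "square_majorants p C"
  shows "(LINT x|M. square_row N k f x powr p) \<le> C * (LINT x|M. norm (E k (int N) f x) powr p)"
    and "(LINT x|M. norm (E k (int N) f x) powr p) \<le>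
      C * (LINT x|M. square_row N k f x powr p) + C * (LINT x|M. norm (E k (- int N) f x) powr p)"
proof -
  interpret m: atomic_martingale M "\<lambda>n x. (a k x, b (int n - int N) x)" "{0::int}" "\<lambda>n _. E k (int n - int N) f" p
    by (rule martingale_in_l[OF f p])
  have X: "m.path_norm n = (\<lambda>x. norm (E k (int n - int N) f x))" for n
    by (auto simp: m.path_norm_def)
  have S: "m.path_square (2 * N) = square_row N k f"
    using sum_int_shift[of "\<lambda>l. (norm (E k (l + 1) f x - E k l f x))\<^sup>2" N for x]
    by (intro ext) (simp add: m.path_square_def square_row_def algebra_simps)
  show "(LINT x|M. square_row N k f x powr p) \<le> C * (LINT x|M. norm (E k (int N) f x) powr p)"
    using m.square_function_le[OF C, of "2 * N"] unfolding S X by simp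
  show "(LINT x|M. norm (E k (int N) f x) powr p) \<le>
      C * (LINT x|M. square_row N k f x powr p) + C * (LINT x|M. norm (E k (- int N) f x) powr p)"
    using m.le_square_function[OF C, of "2 * N"] unfolding S X by simp
qed

text \<open>
  The row at level \<open>k\<close> has norm \<open>square_row N k f\<close>, and the increments of its components are the bi-parameter
  differences.
\<close>
lemma trunc_bounds:
  assumes f: "in_Lp M p f" and p: "p > 1" and C: "square_majorants p C"
  shows "(LINT x|M. square_trunc N f x powr p) \<le> C * (LINT x|M. square_row N (int N) f x powr p)"
    and "(LINT x|M. square_row N (int N) f x powr p) \<le>
      C * (LINT x|M. square_trunc N f x powr p) + C * (LINT x|M. square_row N (- int N) f x powr p)"
    and "integrable M (\<lambda>x. square_trunc N f x powr p)"
    and "square_trunc N f \<in> borel_measurable M"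
proof -
  interpret m: atomic_martingale M "\<lambda>n x. (a (int n - int N) x, b (int N) x)" "{- int N..<int N}"
     "\<lambda>n l x. E (int n - int N) (l + 1) f x - E (int n - int N) l f x" p
    by (rule martingale_in_k[OF f p])
  have X: "m.path_norm n = square_row N (int n - int N) f" for n
    by (auto simp: m.path_norm_def square_row_def)
  have S: "m.path_square (2 * N) = square_trunc N f"
  proof
    fix x
    have "(\<Sum>i<2*N. \<Sum>l\<in>{- int N..<int N}. (norm (delta (int i - int N) l f x))\<^sup>2) =
      (\<Sum>k\<in>{- int N..<int N}. \<Sum>l\<in>{- int N..<int N}. (norm (delta k l f x))\<^sup>2)"
      by (rule sum_int_shift)
    then show "m.path_square (2 * N) x = square_trunc N f x"
      by (simp add: m.path_square_def square_trunc_def delta_def algebra_simps)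
  qed
  show "(LINT x|M. square_trunc N f x powr p) \<le> C * (LINT x|M. square_row N (int N) f x powr p)"
    using m.square_function_le[OF C, of "2 * N"] unfolding S X by simp
  show "(LINT x|M. square_row N (int N) f x powr p) \<le>
      C * (LINT x|M. square_trunc N f x powr p) + C * (LINT x|M. square_row N (- int N) f x powr p)"
    using m.le_square_function[OF C, of "2 * N"] unfolding S X by simp
  show "integrable M (\<lambda>x. square_trunc N f x powr p)" using m.integrable_path_square[of "2 * N"] unfolding S .
  show "square_trunc N f \<in> borel_measurable M" using m.measurable_path(2)[of "2 * N"] unfolding S .
qed

lemma square_trunc_upper:
  assumes f: "in_Lp M p f" and p: "p > 1" and C: "square_majorants p C"
  shows "(LINT x|M. square_trunc N f x powr p) \<le> C\<^sup>2 * (LINT x|M. norm (f x) powr p)"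
proof -
  have C0: "C > 0" using C by (simp add: square_majorants_def)
  have "(LINT x|M. square_trunc N f x powr p) \<le> C * (LINT x|M. square_row N (int N) f x powr p)"
    by (rule trunc_bounds[OF f p C])
  also have "\<dots> \<le> C * (C * (LINT x|M. norm (E (int N) (int N) f x) powr p))"
    using C0 by (intro mult_left_mono row_bounds[OF f p C]) auto
  also have "\<dots> \<le> C * (C * (LINT x|M. norm (f x) powr p))"
    using C0 p by (intro mult_left_mono E_contraction[OF f]) auto
  finally show ?thesis by (simp add: power2_eq_square mult.assoc)
qed

text \<open>
  Applying the lower bound in both indices leaves the initial values of both martingales. The initial row,
  at level \<open>- N\<close>, is in turn controlled by the upper bound in the second index.
\<close>
lemma square_trunc_lower:
  assumes f: "in_Lp M p f" and p: "p > 1" and C: "square_majorants p C"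
  shows "(LINT x|M. norm (E (int N) (int N) f x) powr p) \<le>
     C\<^sup>2 * (LINT x|M. square_trunc N f x powr p) +
     C ^ 3 * (LINT x|M. norm (E (- int N) (int N) f x) powr p) +
     C * (LINT x|M. norm (E (int N) (- int N) f x) powr p)"
proof -
  have C0: "C > 0" using C by (simp add: square_majorants_def)
  have "(LINT x|M. square_row N (int N) f x powr p) \<le>
      C * (LINT x|M. square_trunc N f x powr p) + C * (C * (LINT x|M. norm (E (- int N) (int N) f x) powr p))"
    using trunc_bounds(2)[OF f p C, of N] mult_left_mono[OF row_bounds(1)[OF f p C, of N "- int N"], of C] C0 by linarith
  from mult_left_mono[OF this, of C] row_bounds(2)[OF f p C, of "int N" N] C0
  show ?thesis by (simp add: power2_eq_square power3_eq_cube algebra_simps)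
qed

end

section \<open>Averages over long cells\<close>

lemma in_Lp_one: "integrable M f \<Longrightarrow> in_Lp M 1 f" for f :: "'a \<Rightarrow> 'b::{banach, second_countable_topology}"
  by (auto simp: in_Lp_def)

lemma in_Lp_one_iff: "in_Lp M 1 f \<longleftrightarrow> integrable M f" for f :: "'a \<Rightarrow> 'b::{banach, second_countable_topology}"
  by (auto simp: in_Lp_def integrable_norm_iff)

text \<open>
  The density argument of Banach and Steinhaus. It reduces the limits in \<open>L\<^sup>p\<close> below to bounded functions
  supported in finitely many cells, and those in \<open>L\<^sup>1\<close> to indicators of open sets.
\<close>
lemma approximation_principle:
  fixes T :: "nat \<Rightarrow> ('a \<Rightarrow> 'b::{banach, second_countable_topology}) \<Rightarrow> 'a \<Rightarrow> 'b"
  assumes p: "p \<ge> 0" and K: "K \<ge> 0"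
    and T: "\<And>n f. in_Lp M p f \<Longrightarrow> in_Lp M p (T n f)"
    and bound: "\<And>n f. in_Lp M p f \<Longrightarrow> (LINT x|M. norm (T n f x) powr p) \<le> K * (LINT x|M. norm (f x) powr p)"
    and diff: "\<And>n f g x. in_Lp M p f \<Longrightarrow> in_Lp M p g \<Longrightarrow> T n (\<lambda>x. f x - g x) x = T n f x - T n g x"
    and f: "in_Lp M p f" and g: "\<And>j. in_Lp M p (g j)"
    and lim: "(\<lambda>j. LINT x|M. norm (f x - g j x) powr p) \<longlonglongrightarrow> 0"
    and Tg: "\<And>j. (\<lambda>n. LINT x|M. norm (T n (g j) x) powr p) \<longlonglongrightarrow> 0"
  shows "(\<lambda>n. LINT x|M. norm (T n f x) powr p) \<longlonglongrightarrow> 0"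
proof (rule LIMSEQ_I)
  fix r :: real assume r: "0 < r"
  define q where "q = 2 powr p"
  have q: "q > 0" by (simp add: q_def)
  have *: "(LINT x|M. norm (T n f x) powr p) \<le> q * (K * (LINT x|M. norm (f x - g j x) powr p) + (LINT x|M. norm (T n (g j) x) powr p))" for n j
  proof -
    have d: "in_Lp M p (\<lambda>x. f x - g j x)" by (rule in_Lp_diff(1)[OF f g p])
    have m: "in_Lp M p (\<lambda>x. - T n (g j) x)" using T[OF g] by (simp add: in_Lp_def)
    have "(LINT x|M. norm (T n f x) powr p) = (LINT x|M. norm (T n (\<lambda>x. f x - g j x) x - - T n (g j) x) powr p)"
      by (simp add: diff[OF f g])
    also have "\<dots> \<le> q * ((LINT x|M. norm (T n (\<lambda>x. f x - g j x) x) powr p) + (LINT x|M. norm (- T n (g j) x) powr p))"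
      unfolding q_def by (rule in_Lp_diff(2)[OF T[OF d] m p])
    also have "\<dots> \<le> q * (K * (LINT x|M. norm (f x - g j x) powr p) + (LINT x|M. norm (T n (g j) x) powr p))"
      using bound[OF d] q by simp
    finally show ?thesis .
  qed
  \<comment> \<open>chosen so that \<open>K * e \<le> r / (2 * q)\<close>, with \<open>K + 1\<close> because \<open>K\<close> may be \<open>0\<close>\<close>
  define e where "e = r / (2 * q * (K + 1))"
  have e: "e > 0" using r q K by (simp add: e_def)
  obtain j where j: "(LINT x|M. norm (f x - g j x) powr p) < e"
    using LIMSEQ_D[OF lim e] by auto
  obtain n0 where n0: "\<And>n. n \<ge> n0 \<Longrightarrow> (LINT x|M. norm (T n (g j) x) powr p) < r / (2 * q)"
    using LIMSEQ_D[OF Tg[of j], of "r / (2 * q)"] r q by auto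
  have "norm ((LINT x|M. norm (T n f x) powr p) - 0) < r" if "n \<ge> n0" for n
  proof -
    have "K * (LINT x|M. norm (f x - g j x) powr p) \<le> K * e" using j K by (intro mult_left_mono) auto
    also have "K * e = r / (2 * q) * (K / (K + 1))" using r q K by (simp add: e_def)
    also have "\<dots> \<le> r / (2 * q)" using r q K by (intro mult_left_le) auto
    finally have "q * (K * (LINT x|M. norm (f x - g j x) powr p) + (LINT x|M. norm (T n (g j) x) powr p)) < q * (r / (2 * q) + r / (2 * q))"
      using n0[OF that] q by (intro mult_strict_left_mono) auto
    also have "\<dots> = r" using q by simp
    finally show ?thesis using *[of n j] by simp
  qed
  then show "\<exists>no. \<forall>n\<ge>no. norm ((LINT x|M. norm (T n f x) powr p) - 0) < r" by blast
qed

lemma integral_powr_bounded: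
  fixes h :: "'a \<Rightarrow> 'b::{banach, second_countable_topology}"
  assumes h: "integrable M h" and B: "\<And>x. norm (h x) \<le> B" and p: "p > 1"
  shows "(LINT x|M. norm (h x) powr p) \<le> B powr (p - 1) * (LINT x|M. norm (h x))"
proof -
  have *: "norm (h x) powr p \<le> B powr (p - 1) * norm (h x)" for x
  proof -
    have "norm (h x) powr p = norm (h x) powr (p - 1) * norm (h x)"
      using powr_add[of "norm (h x)" "p - 1" 1] p by (cases "norm (h x) = 0") auto
    also have "\<dots> \<le> B powr (p - 1) * norm (h x)"
      using B p by (intro mult_right_mono powr_mono2) auto
    finally show ?thesis .
  qed
  have "(LINT x|M. norm (h x) powr p) \<le> (LINT x|M. B powr (p - 1) * norm (h x))"
    by (rule integral_mono') (use h * in auto)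
  then show ?thesis by simp
qed

context product_grid
begin

text \<open>
  The windows exhaust the space and have finite measure; any enumeration of the cells of level \<open>(0, 0)\<close> serves
  this purpose.
\<close>
definition window :: "nat \<Rightarrow> 'a set" where
  "window j = {x. to_nat (a 0 x) \<le> j \<and> to_nat (b 0 x) \<le> j}"

definition truncate :: "nat \<Rightarrow> ('a \<Rightarrow> 'b::euclidean_space) \<Rightarrow> 'a \<Rightarrow> 'b" where
  "truncate j f x = indicator (window j \<inter> {x. norm (f x) \<le> real j}) x *\<^sub>R f x"

lemma emeasure_strip:
  "{y. to_nat (a k y) \<le> j \<and> b l y = b l x} \<in> sets M"
  "emeasure M {y. to_nat (a k y) \<le> j \<and> b l y = b l x} \<le> ennreal (real (Suc j) * (\<alpha> k * \<beta> l))"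
proof -
  let ?S = "\<lambda>c. {y. to_nat (a k y) = c \<and> b l y = b l x}"
  have S: "?S c = {} \<or> (\<exists>y. ?S c = cell k l y)" for c
  proof (cases "?S c = {}")
    case False
    then obtain y where "to_nat (a k y) = c" "b l y = b l x" by auto
    then have "?S c = cell k l y" by (auto simp: cell_def)
    then show ?thesis by blast
  qed auto
  have m: "?S c \<in> sets M" "emeasure M (?S c) \<le> ennreal (\<alpha> k * \<beta> l)" for c
  proof -
    have "?S c \<in> sets M \<and> emeasure M (?S c) \<le> ennreal (\<alpha> k * \<beta> l)"
      using S[of c] by (elim disjE exE) (simp_all only: sets_cell emeasure_cell_point emeasure_empty sets.empty_sets order_refl zero_le simp_thms)
    then show "?S c \<in> sets M" "emeasure M (?S c) \<le> ennreal (\<alpha> k * \<beta> l)" by auto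
  qed
  have U: "{y. to_nat (a k y) \<le> j \<and> b l y = b l x} = (\<Union>c\<le>j. ?S c)" by auto
  show "{y. to_nat (a k y) \<le> j \<and> b l y = b l x} \<in> sets M"
    unfolding U using m(1) by (intro sets.finite_UN) auto
  have "emeasure M (\<Union>c\<le>j. ?S c) \<le> (\<Sum>c\<le>j. emeasure M (?S c))"
    using m(1) by (intro emeasure_subadditive_finite) auto
  also have "\<dots> \<le> (\<Sum>c\<le>j. ennreal (\<alpha> k * \<beta> l))" by (intro sum_mono m(2))
  also have "\<dots> = ennreal (real (Suc j) * (\<alpha> k * \<beta> l))"
    using pos_ab[of k l] by (simp add: ennreal_mult ennreal_of_nat_eq_real_of_nat[symmetric] flip: ennreal_of_nat_eq_real_of_nat)
  finally show "emeasure M {y. to_nat (a k y) \<le> j \<and> b l y = b l x} \<le> ennreal (real (Suc j) * (\<alpha> k * \<beta> l))"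
    unfolding U .
qed

lemma emeasure_window: "window j \<in> sets M" "emeasure M (window j) < \<infinity>"
proof -
  let ?S = "\<lambda>d. {y. to_nat (a 0 y) \<le> j \<and> to_nat (b 0 y) = d}"
  have S: "?S d \<in> sets M \<and> emeasure M (?S d) < \<infinity>" for d
  proof (cases "?S d = {}")
    case False
    then obtain x where "to_nat (b 0 x) = d" by auto
    then have e: "?S d = {y. to_nat (a 0 y) \<le> j \<and> b 0 y = b 0 x}" by auto
    show ?thesis unfolding e using emeasure_strip[of 0 j 0 x] le_less_trans by fastforce
  next
    case True
    show ?thesis unfolding True by simp
  qed
  have U: "window j = (\<Union>d\<le>j. ?S d)" by (auto simp: window_def)
  show "window j \<in> sets M" unfolding U using S by (intro sets.finite_UN) auto
  have "emeasure M (\<Union>d\<le>j. ?S d) \<le> (\<Sum>d\<le>j. emeasure M (?S d))"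
    using S by (intro emeasure_subadditive_finite) auto
  also have "\<dots> < \<infinity>" using S by (simp add: less_top[symmetric])
  finally show "emeasure M (window j) < \<infinity>" unfolding U .
qed

lemma truncate_Lp:
  fixes f :: "'a \<Rightarrow> 'b::euclidean_space"
  assumes f: "in_Lp M p f" and p: "p \<ge> 1"
  shows "in_Lp M p (truncate j f)" "integrable M (truncate j f)" "norm (truncate j f x) \<le> real j"
    "(\<lambda>j. LINT x|M. norm (f x - truncate j f x) powr p) \<longlonglongrightarrow> 0"
proof -
  have fm [measurable]: "f \<in> borel_measurable M" and fi: "integrable M (\<lambda>x. norm (f x) powr p)"
    using f by (auto simp: in_Lp_def)
  have R [measurable]: "window j \<inter> {x. norm (f x) \<le> real j} \<in> sets M" for j
  proof -
    have "{x\<in>space M. norm (f x) \<le> real j} \<in> sets M" by measurable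
    then show ?thesis using emeasure_window(1) space by auto
  qed
  have tm [measurable]: "truncate j f \<in> borel_measurable M" for j
    unfolding truncate_def[abs_def] by measurable
  show "norm (truncate j f x) \<le> real j" by (auto simp: truncate_def indicator_def)
  have le: "norm (truncate j f x) \<le> norm (f x)" for x j by (auto simp: truncate_def indicator_def)
  show "in_Lp M p (truncate j f)" unfolding in_Lp_def
    using le p by (auto intro!: integrable_powr_mono[OF fi])
  have "set_integrable M (window j \<inter> {x. norm (f x) \<le> real j}) f"
  proof (rule set_integrable_powr[OF fm fi p R])
    have "emeasure M (window j \<inter> {x. norm (f x) \<le> real j}) \<le> emeasure M (window j)"
      using emeasure_window by (intro emeasure_mono) auto
    then show "emeasure M (window j \<inter> {x. norm (f x) \<le> real j}) < \<infinity>" using emeasure_window(2) by (rule le_less_trans)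
  qed
  then show "integrable M (truncate j f)" by (simp add: set_integrable_def truncate_def[abs_def])
  have "(\<lambda>j. LINT x|M. norm (f x - truncate j f x) powr p) \<longlonglongrightarrow> (LINT x|M. 0)"
  proof (rule integral_dominated_convergence[OF _ _ fi])
    show "AE x in M. (\<lambda>j. norm (f x - truncate j f x) powr p) \<longlonglongrightarrow> 0"
    proof (rule AE_I2)
      fix x
      obtain j0 where j0: "norm (f x) \<le> real j0" using real_arch_simple by blast
      define n where "n = max j0 (max (to_nat (a 0 x)) (to_nat (b 0 x)))"
      have "truncate j f x = f x" if "j \<ge> n" for j
        using that j0 by (auto simp: truncate_def window_def n_def indicator_def)
      then have "eventually (\<lambda>j. norm (f x - truncate j f x) powr p = 0) sequentially"
        unfolding eventually_sequentially using p by (intro exI[of _ n]) auto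
      then show "(\<lambda>j. norm (f x - truncate j f x) powr p) \<longlonglongrightarrow> 0" by (rule tendsto_eventually)
    qed
    show "AE x in M. norm (norm (f x - truncate j f x) powr p) \<le> norm (f x) powr p" for j
      using p by (intro AE_I2) (auto intro!: powr_mono2 simp: truncate_def indicator_def)
  qed measurable
  then show "(\<lambda>j. LINT x|M. norm (f x - truncate j f x) powr p) \<longlonglongrightarrow> 0" by simp
qed

text \<open>
  The support of the truncation meets a cell only inside \<open>Suc j\<close> strips that have level \<open>0\<close> in the first
  index, so the average over a cell decays as its extent in this index grows, uniformly in \<open>l\<close>.
\<close>
lemma norm_E_truncate_le:
  assumes f: "in_Lp M p f" and p: "p \<ge> 1" 
  shows "norm (E (- int n) l (truncate j f) x) \<le> real j * real (Suc j) * \<alpha> 0 / \<alpha> (- int n)"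
proof -
  let ?k = "- int n"
  let ?S = "{y. to_nat (a 0 y) \<le> j \<and> b l y = b l x}"
  have "norm (E ?k l (truncate j f) x) * (\<alpha> ?k * \<beta> l) \<le> (LINT y:cell ?k l x|M. norm (truncate j f y))"
    by (rule norm_E_le[OF truncate_Lp(1)[OF f p] p])
  also have "\<dots> \<le> (LINT y|M. real j * indicator ?S y)"
    unfolding set_lebesgue_integral_def
  proof (rule integral_mono)
    show "integrable M (\<lambda>y. indicat_real (cell ?k l x) y *\<^sub>R norm (truncate j f y))"
      using truncate_Lp(2)[OF f p] sets_cell by (intro integrable_mult_indicator) auto
    have "emeasure M ?S < \<infinity>" using emeasure_strip(2)[of 0 j l x] by (rule le_less_trans) simp
    then show "integrable M (\<lambda>y. real j * indicator ?S y)" using emeasure_strip(1)[of 0 j l x] by (intro integrable_mult_right integrable_real_indicator)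
    show "indicat_real (cell ?k l x) y *\<^sub>R norm (truncate j f y) \<le> real j * indicator ?S y" for y
      by (auto simp: indicator_def truncate_def window_def cell_def)
  qed
  also have "\<dots> = real j * measure M ?S" using emeasure_strip(1)[of 0 j l x] by (simp add: space)
  also have "\<dots> \<le> real j * (real (Suc j) * (\<alpha> 0 * \<beta> l))"
  proof (rule mult_left_mono)
    show "measure M ?S \<le> real (Suc j) * (\<alpha> 0 * \<beta> l)"
      using emeasure_strip(2)[of 0 j l x] pos_ab[of 0 l] unfolding measure_def by (intro enn2real_leI) auto
  qed simp
  finally have "norm (E ?k l (truncate j f) x) * \<alpha> ?k * \<beta> l \<le> real j * real (Suc j) * \<alpha> 0 * \<beta> l"
    by (simp only: mult.assoc)
  then have "norm (E ?k l (truncate j f) x) * \<alpha> ?k \<le> real j * real (Suc j) * \<alpha> 0"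
    using pos(2)[of l] by (simp only: mult_le_cancel_right_pos)
  then show ?thesis using pos(1)[of ?k] by (simp only: pos_le_divide_eq)
qed

text \<open>
  For a truncation, uniform smallness combines with the bound in \<open>L\<^sup>1\<close>, as
  \<open>|h|\<^sup>p \<le> (sup |h|)\<^sup>p\<^sup>-\<^sup>1 |h|\<close>. The first factor tends to \<open>0\<close> precisely because \<open>p > 1\<close>.
\<close>
lemma E_vanishes:
  fixes f :: "'a \<Rightarrow> 'b::euclidean_space"
  assumes f: "in_Lp M p f" and p: "p > 1" and grow: "filterlim (\<lambda>n. \<alpha> (- int n)) at_top sequentially"
  shows "(\<lambda>n. LINT x|M. norm (E (- int n) (l n) f x) powr p) \<longlonglongrightarrow> 0"
proof (rule approximation_principle[where K = 1 and g = "\<lambda>j. truncate j f" and T = "\<lambda>n. E (- int n) (l n)"])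
  have p1: "p \<ge> 1" using p by simp
  show "in_Lp M p (E (- int n) (l n) h)" if "in_Lp M p h" for n and h :: "'a \<Rightarrow> 'b" using E_contraction(1)[OF that p1] .
  show "(LINT x|M. norm (E (- int n) (l n) h x) powr p) \<le> 1 * (LINT x|M. norm (h x) powr p)"
    if "in_Lp M p h" for n and h :: "'a \<Rightarrow> 'b" using E_contraction(2)[OF that p1] by simp
  show "E (- int n) (l n) (\<lambda>x. h x - g x) x = E (- int n) (l n) h x - E (- int n) (l n) g x"
    if "in_Lp M p h" "in_Lp M p g" for n x and g h :: "'a \<Rightarrow> 'b" using E_diff[OF that p1] .
  show "in_Lp M p (truncate j f)" for j by (rule truncate_Lp(1)[OF f p1])
  show "(\<lambda>j. LINT x|M. norm (f x - truncate j f x) powr p) \<longlonglongrightarrow> 0" by (rule truncate_Lp(4)[OF f p1])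
  fix j
  define c where "c = real j * real (Suc j) * \<alpha> 0"
  define I where "I = (LINT x|M. norm (truncate j f x))"
  have t1: "in_Lp M 1 (truncate j f)" using truncate_Lp(2)[OF f p1] by (rule in_Lp_one)
  have up: "(LINT x|M. norm (E (- int n) (l n) (truncate j f) x) powr p) \<le> (c / \<alpha> (- int n)) powr (p-1) * I" for n
  proof -
    have "integrable M (E (- int n) (l n) (truncate j f))"
      using E_contraction(1)[OF t1] by (simp add: in_Lp_one_iff)
    then have "(LINT x|M. norm (E (- int n) (l n) (truncate j f) x) powr p) \<le>
       (c / \<alpha> (- int n)) powr (p-1) * (LINT x|M. norm (E (- int n) (l n) (truncate j f) x))"
      using norm_E_truncate_le[OF f p1] p by (intro integral_powr_bounded) (auto simp: c_def)
    also have "\<dots> \<le> (c / \<alpha> (- int n)) powr (p-1) * I"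
      using E_contraction(2)[OF t1, of "- int n" "l n"] by (intro mult_left_mono) (auto simp: I_def)
    finally show ?thesis .
  qed
  have "(\<lambda>n. c / \<alpha> (- int n)) \<longlonglongrightarrow> 0"
    by (intro real_tendsto_divide_at_top[OF tendsto_const] grow)
  then have "(\<lambda>n. (c / \<alpha> (- int n)) powr (p-1) * I) \<longlonglongrightarrow> 0 powr (p-1) * I"
    using p pos by (intro tendsto_intros tendsto_powr') (auto simp: c_def less_imp_le)
  then have lim: "(\<lambda>n. (c / \<alpha> (- int n)) powr (p-1) * I) \<longlonglongrightarrow> 0" by simp
  show "(\<lambda>n. LINT x|M. norm (E (- int n) (l n) (truncate j f) x) powr p) \<longlonglongrightarrow> 0"
    by (rule tendsto_sandwich[OF _ _ tendsto_const lim]) (use up in auto)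
qed (use p f in auto)

lemma E_integral:
  assumes f: "integrable M (f :: 'a \<Rightarrow> real)"
  shows "(LINT x|M. E k l f x) = (LINT x|M. f x)"
proof -
  have f1: "in_Lp M 1 f" using f by (rule in_Lp_one)
  have i: "integrable M (E k l f)" using E_contraction(1)[OF f1] by (simp add: in_Lp_one_iff)
  have *: "(LINT x:cell k l z|M. E k l f x) = (LINT x:cell k l z|M. f x)" for z
  proof -
    have "(LINT x:cell k l z|M. E k l f x) = (\<alpha> k * \<beta> l) *\<^sub>R E k l f z"
      by (intro integral_const_cell E_cong) (auto simp: cell_def)
    then show ?thesis using pos(1)[of k] pos(2)[of l] by (simp add: E_def field_simps)
  qed
  show ?thesis
    using integral_le_fibers[OF measurable_ab[of k l] space i f] integral_le_fibers[OF measurable_ab[of k l] space f i] *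
    by (simp add: cell_eq_fiber antisym)
qed

end

section \<open>Averages over small cells\<close>

lemma squeeze_0:
  fixes u v :: "nat \<Rightarrow> real"
  assumes "\<And>n. 0 \<le> u n" "\<And>n. u n \<le> v n" "v \<longlonglongrightarrow> 0"
  shows "u \<longlonglongrightarrow> 0"
  by (rule tendsto_sandwich[OF _ _ tendsto_const assms(3)]) (use assms in simp_all)

text \<open>
  A grid whose cells shrink to points when both levels increase, and whose volume factors are unbounded as
  the levels decrease.
\<close>
locale generating_grid = product_grid lebesgue a b \<alpha> \<beta>
  for a b :: "int \<Rightarrow> 'a::euclidean_space \<Rightarrow> 'i::countable" and \<alpha> \<beta> :: "int \<Rightarrow> real" +
  assumes shrink: "\<And>U x. open U \<Longrightarrow> x \<in> U \<Longrightarrow> eventually (\<lambda>n. cell (int n) (int n) x \<subseteq> U) sequentially"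
    and large_a: "filterlim (\<lambda>n. \<alpha> (- int n)) at_top sequentially"
    and large_b: "filterlim (\<lambda>n. \<beta> (- int n)) at_top sequentially"
begin

definition deviation :: "nat \<Rightarrow> ('a \<Rightarrow> 'b) \<Rightarrow> 'a \<Rightarrow> 'b::euclidean_space" where
  "deviation n f x = E (int n) (int n) f x - f x"

lemma deviation_Lp:
  fixes f :: "'a \<Rightarrow> 'b::euclidean_space"
  assumes f: "in_Lp lebesgue p f" and p: "p \<ge> 1"
  shows "in_Lp lebesgue p (deviation n f)"
    and "(LINT x|lebesgue. norm (deviation n f x) powr p) \<le> 2 powr p * 2 * (LINT x|lebesgue. norm (f x) powr p)"
proof -
  note c = E_contraction[OF f p, of "int n" "int n"]
  have p0: "p \<ge> 0" using p by simp
  show "in_Lp lebesgue p (deviation n f)"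
    unfolding deviation_def[abs_def] by (rule in_Lp_diff(1)[OF c(1) f p0])
  have "(LINT x|lebesgue. norm (deviation n f x) powr p) \<le>
     2 powr p * ((LINT x|lebesgue. norm (E (int n) (int n) f x) powr p) + (LINT x|lebesgue. norm (f x) powr p))"
    unfolding deviation_def[abs_def] by (rule in_Lp_diff(2)[OF c(1) f p0])
  also have "\<dots> \<le> 2 powr p * ((LINT x|lebesgue. norm (f x) powr p) + (LINT x|lebesgue. norm (f x) powr p))"
    using c(2) by (intro mult_left_mono add_right_mono) auto
  finally show "(LINT x|lebesgue. norm (deviation n f x) powr p) \<le> 2 powr p * 2 * (LINT x|lebesgue. norm (f x) powr p)"
    by simp
qed

lemma deviation_diff:
  fixes f g :: "'a \<Rightarrow> 'b::euclidean_space"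
  assumes "in_Lp lebesgue p f" "in_Lp lebesgue p g" "p \<ge> 1"
  shows "deviation n (\<lambda>x. f x - g x) x = deviation n f x - deviation n g x"
  using E_diff[OF assms] by (simp add: deviation_def)

lemma deviation_approximation:
  fixes f :: "'a \<Rightarrow> 'b::euclidean_space"
  assumes "p \<ge> 1" "in_Lp lebesgue p f" "\<And>j. in_Lp lebesgue p (g j)"
    "(\<lambda>j. LINT x|lebesgue. norm (f x - g j x) powr p) \<longlonglongrightarrow> 0"
    "\<And>j. (\<lambda>n. LINT x|lebesgue. norm (deviation n (g j) x) powr p) \<longlonglongrightarrow> 0"
  shows "(\<lambda>n. LINT x|lebesgue. norm (deviation n f x) powr p) \<longlonglongrightarrow> 0"
  by (rule approximation_principle[where T = deviation and K = "2 powr p * 2" and g = g])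
     (use assms in \<open>auto intro: deviation_Lp deviation_diff\<close>)

lemma integrable_deviation:
  fixes f :: "'a \<Rightarrow> 'b::euclidean_space"
  shows "integrable lebesgue f \<Longrightarrow> integrable lebesgue (deviation n f)"
  using deviation_Lp(1)[OF in_Lp_one, of f n] by (simp add: in_Lp_one_iff)

text \<open>
  The deviation has mean zero, so its \<open>L\<^sup>1\<close> norm is twice the integral of its negative part. The latter is
  at most \<open>indicator U\<close> and vanishes eventually at each point of \<open>U\<close>, since small cells around
  the point lie in \<open>U\<close>.
\<close>
lemma deviation_open_tendsto_0:
  assumes U: "open U" and fin: "emeasure lebesgue U < \<infinity>"
  shows "(\<lambda>n. LINT x|lebesgue. \<bar>deviation n (indicat_real U) x\<bar>) \<longlonglongrightarrow> 0"
proof -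
  let ?d = "\<lambda>n. deviation n (indicat_real U)"
  have Um [measurable]: "U \<in> sets lebesgue" using U by (simp add: borel_open)
  have i: "integrable lebesgue (indicat_real U)" using fin Um by (intro integrable_real_indicator)
  have di: "integrable lebesgue (?d n)" for n by (rule integrable_deviation[OF i])
  have zero: "(LINT x|lebesgue. ?d n x) = 0" for n
  proof -
    have "integrable lebesgue (E (int n) (int n) (indicat_real U))"
      using E_contraction(1)[OF in_Lp_one[OF i]] by (simp add: in_Lp_one_iff)
    then show ?thesis using i E_integral[OF i, of "int n" "int n"]
      unfolding deviation_def[abs_def] by simp
  qed
  have nn: "0 \<le> E k l (indicat_real U) x" for k l x
  proof -
    have "0 \<le> (LINT y:cell k l x|lebesgue. indicat_real U y)"
      unfolding set_lebesgue_integral_def by (rule Bochner_Integration.integral_nonneg) simp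
    then show ?thesis using pos(1)[of k] pos(2)[of l] unfolding E_def by (intro scaleR_nonneg_nonneg) (auto simp: less_imp_le)
  qed
  have "(\<lambda>n. LINT x|lebesgue. max 0 (- ?d n x)) \<longlonglongrightarrow> integral\<^sup>L lebesgue (\<lambda>x::'a. 0 :: real)"
  proof (rule integral_dominated_convergence[where w = "indicat_real U"])
    show "(\<lambda>x. max 0 (- ?d n x)) \<in> borel_measurable lebesgue" for n
      using di[of n] by (intro borel_measurable_max borel_measurable_uminus) auto
    show "AE x in lebesgue. norm (max 0 (- ?d n x)) \<le> indicat_real U x" for n
      using nn by (intro AE_I2) (auto simp: deviation_def max_def)
    show "AE x in lebesgue. (\<lambda>n. max 0 (- ?d n x)) \<longlonglongrightarrow> 0"
    proof (rule AE_I2)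
      fix x
      show "(\<lambda>n. max 0 (- ?d n x)) \<longlonglongrightarrow> 0"
      proof (cases "x \<in> U")
        case True
        have "eventually (\<lambda>n. max 0 (- ?d n x) = 0) sequentially"
          using shrink[OF U True]
        proof eventually_elim
          case (elim n)
          have "(LINT y:cell (int n) (int n) x|lebesgue. indicat_real U y) = (\<alpha> (int n) * \<beta> (int n)) *\<^sub>R 1"
            using elim by (intro integral_const_cell) auto
          then show ?case using True pos(1)[of "int n"] pos(2)[of "int n"] by (simp add: deviation_def E_def field_simps)
        qed
        then show ?thesis by (rule tendsto_eventually)
      next
        case False
        then have "max 0 (- ?d n x) = 0" for n using nn[of "int n" "int n" x] by (simp add: deviation_def)
        then show ?thesis by simp
      qed
    qed
  qed (use i in simp_all)
  moreover have "(LINT x|lebesgue. \<bar>?d n x\<bar>) = 2 * (LINT x|lebesgue. max 0 (- ?d n x))" for n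
  proof -
    have m: "integrable lebesgue (\<lambda>x. max 0 (- ?d n x))" using di[of n] by (intro integrable_max) auto
    have "(LINT x|lebesgue. \<bar>?d n x\<bar>) = (LINT x|lebesgue. 2 * max 0 (- ?d n x) + ?d n x)"
      by (intro Bochner_Integration.integral_cong) (auto simp: max_def)
    also have "\<dots> = 2 * (LINT x|lebesgue. max 0 (- ?d n x))" using m di[of n] zero[of n] by simp
    finally show ?thesis .
  qed
  ultimately show ?thesis using tendsto_mult_left[of _ 0 _ "2::real"] by fastforce
qed

text \<open>
  Outer regularity reduces a measurable set to open sets.
\<close>
lemma deviation_indicator_tendsto_0:
  assumes A: "A \<in> sets lebesgue" and fin: "emeasure lebesgue A < \<infinity>"
  shows "(\<lambda>n. LINT x|lebesgue. norm (deviation n (indicat_real A) x) powr 1) \<longlonglongrightarrow> 0"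
proof -
  have "\<exists>U. open U \<and> A \<subseteq> U \<and> U - A \<in> lmeasurable \<and> emeasure lebesgue (U - A) < ennreal (1 / real (Suc j))" for j
  proof -
    have "0 < 1 / real (Suc j)" by simp
    from sets_lebesgue_outer_open[OF A this] show ?thesis by metis
  qed
  then have "\<exists>U. \<forall>j. open (U j) \<and> A \<subseteq> U j \<and> U j - A \<in> lmeasurable \<and> emeasure lebesgue (U j - A) < ennreal (1 / real (Suc j))"
    by (intro choice) blast
  then obtain U where U: "\<And>j. open (U j)" "\<And>j. A \<subseteq> U j" "\<And>j. U j - A \<in> lmeasurable"
     "\<And>j. emeasure lebesgue (U j - A) < ennreal (1 / real (Suc j))"
    by blast
  have Um: "U j \<in> sets lebesgue" for j using U(1) by (simp add: borel_open)
  have Ufin: "emeasure lebesgue (U j) < \<infinity>" for j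
  proof -
    have "U j - A \<in> sets lebesgue" using Um A by (rule sets.Diff)
    then have "emeasure lebesgue (A \<union> (U j - A)) \<le> emeasure lebesgue A + emeasure lebesgue (U j - A)"
      by (rule emeasure_subadditive[OF A])
    also have "A \<union> (U j - A) = U j" using U(2)[of j] by blast
    also have "emeasure lebesgue A + emeasure lebesgue (U j - A) < \<infinity>"
      using fin less_trans[OF U(4)[of j] ennreal_less_top] by (simp only: infinity_ennreal_def ennreal_add_less_top)
    finally show ?thesis .
  qed
  have one: "in_Lp lebesgue 1 (indicat_real B)" if "B \<in> sets lebesgue" "emeasure lebesgue B < \<infinity>" for B
    using that by (intro in_Lp_one integrable_real_indicator)
  show ?thesis
  proof (rule deviation_approximation[where g = "\<lambda>j. indicat_real (U j)"])
    show "in_Lp lebesgue 1 (indicat_real A)" by (rule one[OF A fin])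
    show "in_Lp lebesgue 1 (indicat_real (U j))" for j by (rule one[OF Um Ufin])
    show "(\<lambda>n. LINT x|lebesgue. norm (deviation n (indicat_real (U j)) x) powr 1) \<longlonglongrightarrow> 0" for j
      using deviation_open_tendsto_0[OF U(1) Ufin, of j] by simp
    have eq: "(LINT x|lebesgue. norm (indicat_real A x - indicat_real (U j) x) powr 1) = measure lebesgue (U j - A)" for j
    proof -
      have "(LINT x|lebesgue. norm (indicat_real A x - indicat_real (U j) x) powr 1) = (LINT x|lebesgue. indicat_real (U j - A) x)"
      proof (rule Bochner_Integration.integral_cong[OF refl])
        fix x show "norm (indicat_real A x - indicat_real (U j) x) powr 1 = indicat_real (U j - A) x"
          using subsetD[OF U(2)[of j], of x] by (cases "x \<in> A"; cases "x \<in> U j") simp_all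
      qed
      then show ?thesis by simp
    qed
    have le: "measure lebesgue (U j - A) \<le> 1 / real (Suc j)" for j
      unfolding measure_def by (rule enn2real_leI[OF _ less_imp_le[OF U(4)]]) simp
    have l0: "(\<lambda>j. 1 / real (Suc j)) \<longlonglongrightarrow> 0"
      using LIMSEQ_inverse_real_of_nat by (simp add: inverse_eq_divide)
    show "(\<lambda>j. LINT x|lebesgue. norm (indicat_real A x - indicat_real (U j) x) powr 1) \<longlonglongrightarrow> 0"
      unfolding eq by (rule squeeze_0[OF _ le l0]) simp
  qed simp
qed

lemma deviation_L1_tendsto_0:
  fixes f :: "'a \<Rightarrow> 'b::euclidean_space"
  assumes "integrable lebesgue f"
  shows "(\<lambda>n. LINT x|lebesgue. norm (deviation n f x) powr 1) \<longlonglongrightarrow> 0"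
  using assms
proof (induction f rule: integrable_induct)
  case (base A c)
  have i: "integrable lebesgue (indicat_real A)" using base by (intro integrable_real_indicator)
  have "deviation n (\<lambda>x. indicat_real A x *\<^sub>R c) x = deviation n (indicat_real A) x *\<^sub>R c" for n x
  proof -
    have "set_integrable lebesgue (cell (int n) (int n) x) (indicat_real A)"
      using set_integrable_cell[OF in_Lp_one[OF i]] by simp
    then have "(LINT y:cell (int n) (int n) x|lebesgue. indicat_real A y *\<^sub>R c) =
       (LINT y:cell (int n) (int n) x|lebesgue. indicat_real A y) *\<^sub>R c"
      unfolding set_lebesgue_integral_def set_integrable_def
      by (subst integral_scaleR_left[symmetric]) auto
    then show ?thesis by (simp add: deviation_def E_def scaleR_diff_left)
  qed
  then have "(LINT x|lebesgue. norm (deviation n (\<lambda>x. indicat_real A x *\<^sub>R c) x) powr 1) =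
     (LINT x|lebesgue. norm (deviation n (indicat_real A) x) powr 1) * norm c" for n
    by simp
  then show ?case using tendsto_mult_right[OF deviation_indicator_tendsto_0[OF base], of "norm c"] by simp
next
  case (add f g)
  have g': "in_Lp lebesgue 1 (\<lambda>x. - g x)" using add by (intro in_Lp_one) auto
  note f1 = in_Lp_one[OF add(1)] and g1 = in_Lp_one[OF add(2)]
  have z: "in_Lp lebesgue 1 (\<lambda>x. 0 :: 'b)" by (simp add: in_Lp_def)
  have *: "deviation n (\<lambda>x. f x + g x) x = deviation n f x + deviation n g x" for n x
    using E_diff[OF f1 g', of "int n" "int n" x] E_diff[OF z g1, of "int n" "int n" x]
    by (simp add: deviation_def E_def set_lebesgue_integral_def)
  have "(LINT x|lebesgue. norm (deviation n (\<lambda>x. f x + g x) x)) \<le>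
     (LINT x|lebesgue. norm (deviation n f x) + norm (deviation n g x))" for n
    unfolding * using integrable_deviation[OF add(1)] integrable_deviation[OF add(2)]
    by (intro integral_mono) (auto intro: norm_triangle_ineq)
  also have "(LINT x|lebesgue. norm (deviation n f x) + norm (deviation n g x)) =
     (LINT x|lebesgue. norm (deviation n f x)) + (LINT x|lebesgue. norm (deviation n g x))" for n
    using integrable_deviation[OF add(1)] integrable_deviation[OF add(2)] by simp
  finally have le: "(LINT x|lebesgue. norm (deviation n (\<lambda>x. f x + g x) x)) \<le>
     (LINT x|lebesgue. norm (deviation n f x)) + (LINT x|lebesgue. norm (deviation n g x))" for n .
  have sum0: "(\<lambda>n. (LINT x|lebesgue. norm (deviation n f x)) + (LINT x|lebesgue. norm (deviation n g x))) \<longlonglongrightarrow> 0"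
    using tendsto_add[OF add.IH] by simp
  have "(\<lambda>n. LINT x|lebesgue. norm (deviation n (\<lambda>x. f x + g x) x)) \<longlonglongrightarrow> 0"
    by (rule squeeze_0[OF _ le sum0]) simp
  then show ?case by simp
next
  case (lim f s)
  have s1: "in_Lp lebesgue 1 (s j)" for j using lim by (intro in_Lp_one)
  show ?case
  proof (rule deviation_approximation[where g = s])
    have "(\<lambda>j. LINT x|lebesgue. norm (f x - s j x)) \<longlonglongrightarrow> integral\<^sup>L lebesgue (\<lambda>x::'a. 0 :: real)"
    proof (rule integral_dominated_convergence)
      show "integrable lebesgue (\<lambda>x. 3 * norm (f x))" using lim by auto
      show "AE x in lebesgue. (\<lambda>j. norm (f x - s j x)) \<longlonglongrightarrow> 0"
      proof (rule AE_I2)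
        fix x
        have "(\<lambda>j. s j x) \<longlonglongrightarrow> f x" using lim by auto
        then show "(\<lambda>j. norm (f x - s j x)) \<longlonglongrightarrow> 0"
          using tendsto_norm[OF tendsto_diff[OF tendsto_const, of "\<lambda>j. s j x" "f x" sequentially "f x"]] by simp
      qed
      show "AE x in lebesgue. norm (norm (f x - s j x)) \<le> 3 * norm (f x)" for j
      proof (rule AE_I2)
        fix x
        have "norm (s j x) \<le> 2 * norm (f x)" using lim by auto
        then show "norm (norm (f x - s j x)) \<le> 3 * norm (f x)" using norm_triangle_ineq4[of "f x" "s j x"] by simp
      qed
      show "(\<lambda>x. norm (f x - s j x)) \<in> borel_measurable lebesgue" for j using lim by auto
    qed simp
    then show "(\<lambda>j. LINT x|lebesgue. norm (f x - s j x) powr 1) \<longlonglongrightarrow> 0" by simp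
  qed (use lim s1 in_Lp_one in auto)
qed

lemma deviation_tendsto_0:
  fixes f :: "'a \<Rightarrow> 'b::euclidean_space"
  assumes f: "in_Lp lebesgue p f" and p: "p > 1"
  shows "(\<lambda>n. LINT x|lebesgue. norm (deviation n f x) powr p) \<longlonglongrightarrow> 0"
proof (rule deviation_approximation[where g = "\<lambda>j. truncate j f"])
  have p1: "p \<ge> 1" using p by simp
  then show "1 \<le> p" .
  show "in_Lp lebesgue p f" by (rule f)
  show "in_Lp lebesgue p (truncate j f)" for j by (rule truncate_Lp(1)[OF f p1])
  show "(\<lambda>j. LINT x|lebesgue. norm (f x - truncate j f x) powr p) \<longlonglongrightarrow> 0" by (rule truncate_Lp(4)[OF f p1])
  fix j
  let ?t = "truncate j f"
  have ti: "integrable lebesgue ?t" by (rule truncate_Lp(2)[OF f p1])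
  have bt: "norm (?t x) \<le> real j" for x by (rule truncate_Lp(3)[OF f p1])
  have "norm (E k l ?t x) \<le> real j" for k l x
    by (rule norm_E_le_bound[OF in_Lp_one[OF ti] _ bt]) simp
  then have b: "norm (deviation n ?t x) \<le> 2 * real j" for n x
    unfolding deviation_def mult_2 by (intro order.trans[OF norm_triangle_ineq4 add_mono[OF _ bt]])
  have up: "(LINT x|lebesgue. norm (deviation n ?t x) powr p) \<le> (2 * real j) powr (p-1) * (LINT x|lebesgue. norm (deviation n ?t x))" for n
    by (rule integral_powr_bounded[OF integrable_deviation[OF ti] b p])
  have "(\<lambda>n. (2 * real j) powr (p-1) * (LINT x|lebesgue. norm (deviation n ?t x))) \<longlonglongrightarrow> (2 * real j) powr (p-1) * 0"
    using deviation_L1_tendsto_0[OF ti] by (intro tendsto_mult tendsto_const) simp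
  then show "(\<lambda>n. LINT x|lebesgue. norm (deviation n ?t x) powr p) \<longlonglongrightarrow> 0"
    by (intro squeeze_0[OF _ up]) simp_all
qed

text \<open>
  The average over fine cells is bounded by \<open>square_trunc_lower\<close>, whose boundary terms tend to \<open>0\<close>, as does
  its distance to \<open>f\<close>.
\<close>
lemma norm_le_of_square_trunc:
  fixes f :: "'a \<Rightarrow> 'b::euclidean_space"
  assumes f: "in_Lp lebesgue p f" and p: "p > 1" and C: "square_majorants p C"
    and B: "\<And>N. (LINT x|lebesgue. square_trunc N f x powr p) \<le> B"
  shows "(LINT x|lebesgue. norm (f x) powr p) \<le> 2 powr p * C\<^sup>2 * B"
proof -
  have C0: "C > 0" using C by (simp add: square_majorants_def)
  have p1: "p \<ge> 1" and p0: "p \<ge> 0" using p by auto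
  define r where "r N = 2 powr p * (C\<^sup>2 * B + C ^ 3 * (LINT x|lebesgue. norm (E (- int N) (int N) f x) powr p) +
     C * (LINT x|lebesgue. norm (E (int N) (- int N) f x) powr p) + (LINT x|lebesgue. norm (deviation N f x) powr p))" for N
  have le: "(LINT x|lebesgue. norm (f x) powr p) \<le> r N" for N
  proof -
    have "(LINT x|lebesgue. norm (f x) powr p) = (LINT x|lebesgue. norm (E (int N) (int N) f x - deviation N f x) powr p)"
      by (simp add: deviation_def)
    also have "\<dots> \<le> 2 powr p * ((LINT x|lebesgue. norm (E (int N) (int N) f x) powr p) + (LINT x|lebesgue. norm (deviation N f x) powr p))"
      by (rule in_Lp_diff(2)[OF E_contraction(1)[OF f p1] deviation_Lp(1)[OF f p1] p0])
    also have "\<dots> \<le> r N"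
      unfolding r_def using square_trunc_lower[OF f p C, of N] mult_left_mono[OF B[of N], of "C\<^sup>2"]
      by (intro mult_left_mono) auto
    finally show ?thesis .
  qed
  have 1: "(\<lambda>N. LINT x|lebesgue. norm (E (- int N) (int N) f x) powr p) \<longlonglongrightarrow> 0"
    by (rule E_vanishes[OF f p large_a])
  have 2: "(\<lambda>N. LINT x|lebesgue. norm (E (int N) (- int N) f x) powr p) \<longlonglongrightarrow> 0"
    using product_grid.E_vanishes[OF swapped f p large_b, of int] by (simp add: swapped_E)
  have "r \<longlonglongrightarrow> 2 powr p * (C\<^sup>2 * B + C ^ 3 * 0 + C * 0 + 0)"
    unfolding r_def by (intro tendsto_intros 1 2 deviation_tendsto_0[OF f p])
  then have "r \<longlonglongrightarrow> 2 powr p * C\<^sup>2 * B" by (simp add: mult.assoc)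
  then show ?thesis by (rule LIMSEQ_le_const) (use le in auto)
qed

end

section \<open>The full square function\<close>

text \<open>
  Every finite set of index pairs lies in one of the boxes, so the boxes decide about an unordered sum of nonnegative terms.
\<close>
lemma has_sum_int_boxes:
  fixes g :: "int \<times> int \<Rightarrow> real"
  assumes nn: "\<And>k. 0 \<le> g k"
  defines "s \<equiv> \<lambda>N. \<Sum>k\<in>{- int N..<int N} \<times> {- int N..<int N}. g k"
  shows "incseq s" and "g summable_on UNIV \<longleftrightarrow> bdd_above (range s)"
    and "g summable_on UNIV \<Longrightarrow> s \<longlonglongrightarrow> infsum g UNIV"
proof -
  define Q where "Q N = {- int N..<int N} \<times> {- int N..<int N}" for N
  have s: "s N = sum g (Q N)" for N by (simp add: s_def Q_def)
  have Qfin: "finite (Q N)" for N by (simp add: Q_def)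
  show inc: "incseq s"
    unfolding incseq_def s using nn by (intro allI impI sum_mono2) (auto simp: Q_def)
  have cover: "\<exists>N. F \<subseteq> Q N" if "finite F" for F
  proof -
    define N where "N = Suc (\<Sum>k\<in>F. nat \<bar>fst k\<bar> + nat \<bar>snd k\<bar>)"
    have "k \<in> Q N" if "k \<in> F" for k
    proof -
      have "nat \<bar>fst k\<bar> + nat \<bar>snd k\<bar> \<le> (\<Sum>k\<in>F. nat \<bar>fst k\<bar> + nat \<bar>snd k\<bar>)"
        using \<open>finite F\<close> that by (intro member_le_sum) auto
      then have "nat \<bar>fst k\<bar> < N" "nat \<bar>snd k\<bar> < N" by (auto simp: N_def)
      then show ?thesis by (cases k) (auto simp: Q_def)
    qed
    then show ?thesis by blast
  qed
  have bdd: "bdd_above (range s)" if "g summable_on UNIV"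
  proof (rule bdd_aboveI2)
    show "s N \<le> infsum g UNIV" for N
      unfolding s using that nn Qfin by (intro finite_sum_le_infsum) auto
  qed
  have summ: "g summable_on UNIV" if b: "bdd_above (range s)"
  proof -
    obtain B where B: "\<And>N. s N \<le> B" using b by (auto simp: bdd_above_def)
    have "sum g F \<le> B" if "finite F" for F
    proof -
      obtain N where "F \<subseteq> Q N" using cover[OF \<open>finite F\<close>] by auto
      then have "sum g F \<le> s N" unfolding s using nn Qfin by (intro sum_mono2) auto
      then show ?thesis using B[of N] by linarith
    qed
    then show ?thesis
      using nn by (intro nonneg_bdd_above_summable_on) (auto simp: bdd_above_def)
  qed
  show "g summable_on UNIV \<longleftrightarrow> bdd_above (range s)" by (rule iffI[OF bdd summ])
  show "s \<longlonglongrightarrow> infsum g UNIV" if sm: "g summable_on UNIV"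
  proof -
    have sup: "s \<longlonglongrightarrow> (SUP N. s N)" by (rule LIMSEQ_incseq_SUP[OF bdd[OF sm] inc])
    have "infsum g UNIV \<le> (SUP N. s N)"
    proof (rule infsum_le_finite_sums[OF sm])
      fix F :: "(int \<times> int) set" assume "finite F"
      then obtain N where "F \<subseteq> Q N" using cover by auto
      then have "sum g F \<le> s N" unfolding s using nn Qfin by (intro sum_mono2) auto
      also have "\<dots> \<le> (SUP N. s N)" by (intro cSUP_upper bdd[OF sm]) auto
      finally show "sum g F \<le> (SUP N. s N)" .
    qed
    moreover have "(SUP N. s N) \<le> infsum g UNIV"
      unfolding s using sm nn Qfin by (intro cSUP_least finite_sum_le_infsum) auto
    ultimately have "(SUP N. s N) = infsum g UNIV" by (intro antisym)
    then show ?thesis using sup by simp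
  qed
qed

context generating_grid
begin

definition square :: "('a \<Rightarrow> 'b::euclidean_space) \<Rightarrow> 'a \<Rightarrow> real" where
  "square f x = sqrt (\<Sum>\<^sub>\<infinity>k\<in>UNIV. (norm (delta (fst k) (snd k) f x))\<^sup>2)"

text \<open>
  The function \<open>G\<close> in the proof is the \<open>p\<close>-th power of the square function with values in \<open>[0, \<infinity>]\<close>, a
  monotone limit of truncations. Where it is infinite, both \<open>square f x\<close> and \<open>enn2real (G x)\<close> have the
  default value \<open>0\<close>, so \<open>square f x powr p = enn2real (G x)\<close> holds at every point and gives measurability.
\<close>
theorem square_function:
  fixes f :: "'a \<Rightarrow> 'b::euclidean_space"
  assumes f: "in_Lp lebesgue p f" and p: "p > 1" and C: "square_majorants p C"
  shows "AE x in lebesgue. (\<lambda>k. (norm (delta (fst k) (snd k) f x))\<^sup>2) summable_on UNIV"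
    and "in_Lp lebesgue p (square f)"
    and "(LINT x|lebesgue. norm (square f x) powr p) \<le> C\<^sup>2 * (LINT x|lebesgue. norm (f x) powr p)"
    and "(LINT x|lebesgue. norm (f x) powr p) \<le> 2 powr p * C\<^sup>2 * (LINT x|lebesgue. norm (square f x) powr p)"
proof -
  define g where "g x k = (norm (delta (fst k) (snd k) f x))\<^sup>2" for x k
  define s where "s N x = (\<Sum>k\<in>{- int N..<int N} \<times> {- int N..<int N}. g x k)" for N x
  define I where "I = C\<^sup>2 * (LINT x|lebesgue. norm (f x) powr p)"
  define G where "G x = (SUP N. ennreal (square_trunc N f x powr p))" for x
  note box = has_sum_int_boxes[of "g x" for x, folded s_def]
  have gx: "g x = (\<lambda>k. (norm (delta (fst k) (snd k) f x))\<^sup>2)" for x by (rule ext) (simp add: g_def)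
  have gnn: "0 \<le> g x k" for x k by (simp add: g_def)
  have snn: "0 \<le> s N x" for N x unfolding s_def by (intro sum_nonneg gnn)
  have st: "square_trunc N f x = sqrt (s N x)" for N x
    by (simp add: square_trunc_def s_def g_def sum.cartesian_product case_prod_beta)
  have inc: "s m x \<le> s n x" if "m \<le> n" for m n x
    using box(1)[of x] gnn that unfolding incseq_def s_def by auto
  have stinc: "square_trunc m f x powr p \<le> square_trunc n f x powr p" if "m \<le> n" for m n x
    using inc[OF that, of x] p snn by (auto simp: st intro!: powr_mono2)
  have mt [measurable]: "square_trunc N f \<in> borel_measurable lebesgue" for N by (rule trunc_bounds(4)[OF f p C])
  have Gm [measurable]: "G \<in> borel_measurable lebesgue" unfolding G_def[abs_def] by measurable
  have I0: "0 \<le> I" unfolding I_def by simp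
  have "(\<integral>\<^sup>+x. G x \<partial>lebesgue) = (SUP N. \<integral>\<^sup>+x. ennreal (square_trunc N f x powr p) \<partial>lebesgue)"
    unfolding G_def using stinc
    by (intro nn_integral_monotone_convergence_SUP) (auto simp: incseq_def le_fun_def intro!: ennreal_leI)
  also have "\<dots> \<le> ennreal I"
  proof (rule SUP_least)
    fix N
    have "(\<integral>\<^sup>+x. ennreal (square_trunc N f x powr p) \<partial>lebesgue) = ennreal (LINT x|lebesgue. square_trunc N f x powr p)"
      using trunc_bounds(3)[OF f p C] by (intro nn_integral_eq_integral) auto
    then show "(\<integral>\<^sup>+x. ennreal (square_trunc N f x powr p) \<partial>lebesgue) \<le> ennreal I"
      using square_trunc_upper[OF f p C, of N] by (simp add: I_def ennreal_leI)
  qed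
  finally have GI: "(\<integral>\<^sup>+x. G x \<partial>lebesgue) \<le> ennreal I" .
  have AEG: "AE x in lebesgue. G x \<noteq> \<infinity>"
    by (rule nn_integral_PInf_AE[OF Gm]) (use le_less_trans[OF GI ennreal_less_top] in auto)
  have summ: "g x summable_on UNIV \<longleftrightarrow> G x \<noteq> \<infinity>" for x
  proof
    assume "g x summable_on UNIV"
    then have "bdd_above (range (\<lambda>N. s N x))" using box(2)[of x] gnn by (simp add: s_def)
    then obtain B where B: "\<And>N. s N x \<le> B" by (auto simp: bdd_above_def)
    have "G x \<le> ennreal (sqrt B powr p)" unfolding G_def st
      using B p snn by (intro SUP_least ennreal_leI powr_mono2) auto
    also have "\<dots> < \<infinity>" by simp
    finally show "G x \<noteq> \<infinity>" by simp
  next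
    assume fin: "G x \<noteq> \<infinity>"
    have "s N x \<le> (enn2real (G x) powr (1 / p))\<^sup>2" for N
    proof -
      have "ennreal (square_trunc N f x powr p) \<le> G x" unfolding G_def by (intro SUP_upper) auto
      then have "square_trunc N f x powr p \<le> enn2real (G x)"
        using fin by (metis enn2real_ennreal enn2real_mono infinity_ennreal_def less_top powr_ge_zero)
      then have "(square_trunc N f x powr p) powr (1 / p) \<le> enn2real (G x) powr (1 / p)"
        using p by (intro powr_mono2) auto
      then have "sqrt (s N x) \<le> enn2real (G x) powr (1 / p)"
        using p snn by (simp add: st powr_powr)
      then have "(sqrt (s N x))\<^sup>2 \<le> (enn2real (G x) powr (1 / p))\<^sup>2"
        using snn by (intro power_mono) auto
      then show ?thesis using snn by simp
    qed
    then have "bdd_above (range (\<lambda>N. s N x))" by (intro bdd_aboveI2)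
    then show "g x summable_on UNIV" using box(2)[of x] gnn by (simp add: s_def)
  qed
  show AEs: "AE x in lebesgue. (\<lambda>k. (norm (delta (fst k) (snd k) f x))\<^sup>2) summable_on UNIV"
    using AEG by eventually_elim (simp only: summ gx[symmetric] simp_thms)
  have sq: "square f x = sqrt (infsum (g x) UNIV)" for x by (simp add: square_def gx)
  have sqnn: "0 \<le> square f x" for x unfolding sq using gnn by (simp add: infsum_nonneg)
  have sqG: "square f x powr p = enn2real (G x)" for x
  proof (cases "g x summable_on UNIV")
    case True
    then have "(\<lambda>N. s N x) \<longlonglongrightarrow> infsum (g x) UNIV"
      using box(3)[of x] gnn by (simp add: s_def)
    then have "(\<lambda>N. square_trunc N f x powr p) \<longlonglongrightarrow> square f x powr p"
      unfolding st sq using p snn by (intro tendsto_powr' tendsto_real_sqrt) auto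
    then have "(\<lambda>N. ennreal (square_trunc N f x powr p)) \<longlonglongrightarrow> ennreal (square f x powr p)"
      by (intro tendsto_ennrealI)
    moreover have "(\<lambda>N. ennreal (square_trunc N f x powr p)) \<longlonglongrightarrow> G x"
      unfolding G_def using stinc by (intro LIMSEQ_SUP) (auto simp: incseq_def intro!: ennreal_leI)
    ultimately have "G x = ennreal (square f x powr p)" using LIMSEQ_unique by blast
    then show ?thesis by simp
  next
    case False
    then have "G x = \<infinity>" using summ by auto
    moreover have "square f x = 0" unfolding sq using False by (simp add: infsum_not_exists)
    ultimately show ?thesis by simp
  qed
  have sqm: "square f \<in> borel_measurable lebesgue"
  proof -
    have "square f x = enn2real (G x) powr (1 / p)" for x
      using sqG[of x, symmetric] p sqnn[of x] by (simp add: powr_powr)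
    then have "square f = (\<lambda>x. enn2real (G x) powr (1 / p))" by auto
    then show ?thesis by simp
  qed
  have nnle: "(\<integral>\<^sup>+x. ennreal (square f x powr p) \<partial>lebesgue) \<le> ennreal I"
    using GI by (rule order.trans[rotated]) (auto simp: sqG intro!: nn_integral_mono simp: ennreal_enn2real_if)
  have int: "integrable lebesgue (\<lambda>x. square f x powr p)"
    using sqm nnle by (intro integrableI_bounded) (auto simp: le_less_trans[OF _ ennreal_less_top])
  then show "in_Lp lebesgue p (square f)" using sqm sqnn by (simp add: in_Lp_def)
  have "ennreal (LINT x|lebesgue. square f x powr p) \<le> ennreal I"
    using nnle nn_integral_eq_integral[OF int] by simp
  then show "(LINT x|lebesgue. norm (square f x) powr p) \<le> C\<^sup>2 * (LINT x|lebesgue. norm (f x) powr p)"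
    using I0 sqnn by (simp add: I_def)
  have "(LINT x|lebesgue. square_trunc N f x powr p) \<le> (LINT x|lebesgue. square f x powr p)" for N
  proof (rule integral_mono_AE[OF trunc_bounds(3)[OF f p C] int])
    show "AE x in lebesgue. square_trunc N f x powr p \<le> square f x powr p"
      using AEG
    proof eventually_elim
      case (elim x)
      have "ennreal (square_trunc N f x powr p) \<le> G x" unfolding G_def by (intro SUP_upper) auto
      then show ?case unfolding sqG
        using elim by (metis enn2real_ennreal enn2real_mono infinity_ennreal_def less_top powr_ge_zero)
    qed
  qed
  from norm_le_of_square_trunc[OF f p C this]
  show "(LINT x|lebesgue. norm (f x) powr p) \<le> 2 powr p * C\<^sup>2 * (LINT x|lebesgue. norm (square f x) powr p)"
    using sqnn by simp
qed

end

section \<open>Twisted dyadic cells\<close>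

text \<open>
  The integer vector that labels the dyadic cube of level \<open>k\<close> containing \<open>v\<close>.
\<close>
definition cube_index :: "int \<Rightarrow> real^'m \<Rightarrow> 'm \<Rightarrow> int" where
  "cube_index k v = (\<lambda>j. \<lfloor>v $ j * 2 powi k\<rfloor>)"

lemma cube_index_eq_iff:
  "cube_index k v = n \<longleftrightarrow>
     (\<forall>j. of_int (n j) * 2 powi (- k) \<le> v $ j \<and> v $ j < (of_int (n j) + 1) * 2 powi (- k))"
proof -
  have d: "(2::real) powi k > 0" by simp
  have "\<lfloor>t * 2 powi k\<rfloor> = c \<longleftrightarrow> of_int c * 2 powi (- k) \<le> t \<and> t < (of_int c + 1) * 2 powi (- k)" for t :: real and c
    unfolding floor_eq_iff using d by (simp add: power_int_minus divide_inverse[symmetric] pos_divide_le_eq pos_less_divide_eq)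
  then show ?thesis by (simp add: cube_index_def fun_eq_iff)
qed

lemma dyadic_cubes_eq: "dyadic_cubes k = {{v. cube_index k v = n} | n. True}"
  unfolding dyadic_cubes_def cube_index_eq_iff ..

lemma cube_index_refine: "cube_index (k + 1) u = cube_index (k + 1) v \<Longrightarrow> cube_index k u = cube_index k v"
proof -
  have "\<lfloor>t * 2 powi k\<rfloor> = \<lfloor>t * 2 powi (k + 1)\<rfloor> div 2" for t :: real
    using floor_divide_real_eq_div[of 2 "t * 2 powi (k + 1)"] by (simp add: power_int_add)
  then show "cube_index (k + 1) u = cube_index (k + 1) v \<Longrightarrow> cube_index k u = cube_index k v"
    by (simp add: cube_index_def fun_eq_iff)
qed

definition cube_volume :: "'m::finite itself \<Rightarrow> int \<Rightarrow> real" where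
  "cube_volume _ k = (2 powi (- k)) ^ CARD('m)"

lemma sets_cube: "{v :: real^'m. cube_index k v = n} \<in> sets borel"
  by (rule dyadic_cube_props(2)[of _ k]) (auto simp: dyadic_cubes_eq)

lemma emeasure_cube: "emeasure lborel {v :: real^'m. cube_index k v = n} = ennreal (cube_volume TYPE('m) k)"
proof -
  define a b :: "real^'m" where "a = (\<chi> j. of_int (n j) * 2 powi (- k))"
    and "b = (\<chi> j. (of_int (n j) + 1) * 2 powi (- k))"
  let ?I = "{v :: real^'m. cube_index k v = n}"
  have ab: "a $ j < b $ j" "b $ j - a $ j = 2 powi (- k)" for j
    by (simp_all add: a_def b_def algebra_simps)
  have sub: "box a b \<subseteq> ?I" "?I \<subseteq> cbox a b"
    unfolding cube_index_eq_iff a_def b_def by (auto simp: mem_box_cart less_imp_le)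
  have ne: "cbox a b \<noteq> {}" using ab(1) by (auto simp: interval_ne_empty_cart less_imp_le)
  have "measure lborel (cbox a b) = cube_volume TYPE('m) k"
    using content_cbox_cart[OF ne] by (simp add: ab(2) cube_volume_def)
  then have e: "emeasure lborel (cbox a b) = ennreal (cube_volume TYPE('m) k)"
    using emeasure_eq_ennreal_measure[of lborel "cbox a b"] emeasure_lborel_cbox_finite[of a b] by (simp add: less_top)
  have "emeasure lborel ?I \<le> emeasure lborel (cbox a b)"
    by (rule emeasure_mono[OF sub(2)]) simp
  moreover have "emeasure lborel (box a b) \<le> emeasure lborel ?I"
    by (rule emeasure_mono[OF sub(1)]) (simp add: sets_cube)
  moreover have "emeasure lborel (box a b) = emeasure lborel (cbox a b)"
    by (simp add: emeasure_lborel_box_eq emeasure_lborel_cbox_eq)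
  ultimately show ?thesis using e by simp
qed

lemma emeasure_translate:
  fixes I :: "'a::euclidean_space set"
  assumes "I \<in> sets borel"
  shows "emeasure lborel {x. x - v \<in> I} = emeasure lborel I"
proof -
  have "emeasure lborel I = emeasure (distr lborel borel ((+) (- v))) I" by (simp add: lborel_distr_plus)
  also have "\<dots> = emeasure lborel ((+) (- v) -` I \<inter> space lborel)"
    using assms by (intro emeasure_distr) auto
  also have "(+) (- v) -` I \<inter> space lborel = {x. x - v \<in> I}" by auto
  finally show ?thesis ..
qed

lemma borel_twist_vimage:
  fixes I J :: "(real^'m) set"
  assumes "I \<in> sets borel" "J \<in> sets borel"
  shows "twist i -` (I \<times> J) \<in> sets borel"
proof -
  have "I \<times> J \<in> sets borel" using pair_measureI[OF assms] unfolding borel_prod .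
  then show ?thesis
    by (rule measurable_sets_borel[OF borel_measurable_continuous_onI[OF continuous_twist]])
qed

text \<open>
  The twists are shears, hence preserve volume: by Fubini, integrating first in the coordinate that is
  sheared, each section is a translate of \<open>I\<close> or \<open>J\<close>.
\<close>
lemma emeasure_twist_vimage:
  fixes I J :: "(real^'m) set"
  assumes I: "I \<in> sets borel" and J: "J \<in> sets borel"
  shows "emeasure lborel (twist i -` (I \<times> J)) = emeasure lborel I * emeasure lborel J"
proof (cases "i = 3")
  case True
  let ?X = "twist i -` (I \<times> J)"
  have X: "?X \<in> sets (lborel \<Otimes>\<^sub>M lborel)"
    using borel_twist_vimage[OF I J] by (simp only: lborel_prod sets_lborel)
  have "emeasure (lborel \<Otimes>\<^sub>M lborel) ?X = (\<integral>\<^sup>+u. emeasure lborel (Pair u -` ?X) \<partial>lborel)"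
    by (rule lborel.emeasure_pair_measure_alt[OF X])
  also have "\<dots> = (\<integral>\<^sup>+u. emeasure lborel J * indicator I u \<partial>lborel)"
  proof (intro nn_integral_cong)
    fix u :: "real^'m"
    have "Pair u -` ?X = (if u \<in> I then {v. v - u \<in> J} else {})" using True by (auto simp: twist_def)
    then show "emeasure lborel (Pair u -` ?X) = emeasure lborel J * indicator I u"
      using emeasure_translate[OF J] by simp
  qed
  also have "\<dots> = emeasure lborel I * emeasure lborel J"
    using I by (subst nn_integral_cmult_indicator) (auto simp: mult.commute)
  finally show ?thesis by (simp add: lborel_prod)
next
  case False
  let ?X = "twist i -` (I \<times> J)"
  have X: "?X \<in> sets (lborel \<Otimes>\<^sub>M lborel)"
    using borel_twist_vimage[OF I J] by (simp only: lborel_prod sets_lborel)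
  have "emeasure (lborel \<Otimes>\<^sub>M lborel) ?X = (\<integral>\<^sup>+v. emeasure lborel ((\<lambda>u. (u, v :: real^'m)) -` ?X) \<partial>lborel)"
    by (rule lborel_pair.emeasure_pair_measure_alt2[OF X])
  also have "\<dots> = (\<integral>\<^sup>+v. emeasure lborel I * indicator J v \<partial>lborel)"
  proof (intro nn_integral_cong)
    fix v :: "real^'m"
    \<comment> \<open>the identity is the shear by \<open>0\<close>\<close>
    define w where "w = (if i = 2 then v else 0)"
    have "(\<lambda>u. (u, v)) -` ?X = (if v \<in> J then {u. u - w \<in> I} else {})" using False by (auto simp: twist_def w_def)
    then show "emeasure lborel ((\<lambda>u. (u, v)) -` ?X) = emeasure lborel I * indicator J v"
      using emeasure_translate[OF I] by simp
  qed
  also have "\<dots> = emeasure lborel I * emeasure lborel J"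
    using J by (subst nn_integral_cmult_indicator) auto
  finally show ?thesis by (simp add: lborel_prod)
qed

definition untwist :: "nat \<Rightarrow> (real^'m) \<times> (real^'m) \<Rightarrow> (real^'m) \<times> (real^'m)" where
  "untwist i = (\<lambda>(u, v). if i = 2 then (u + v, v) else if i = 3 then (u, v + u) else (u, v))"

lemma untwist_twist: "untwist i (twist i x) = x"
  by (cases x) (simp add: twist_def untwist_def)

lemma continuous_untwist: "continuous_on UNIV (untwist i)"
  unfolding untwist_def case_prod_unfold
  by (cases "i = 2"; cases "i = 3") (auto intro!: continuous_intros)

abbreviation index_fst :: "nat \<Rightarrow> int \<Rightarrow> (real^'m) \<times> (real^'m) \<Rightarrow> 'm \<Rightarrow> int" where
  "index_fst i k x \<equiv> cube_index k (fst (twist i x))"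

abbreviation index_snd :: "nat \<Rightarrow> int \<Rightarrow> (real^'m) \<times> (real^'m) \<Rightarrow> 'm \<Rightarrow> int" where
  "index_snd i l x \<equiv> cube_index l (snd (twist i x))"

lemma dist_same_cube:
  fixes u v :: "real^'m"
  assumes "cube_index (int n) u = cube_index (int n) v"
  shows "dist u v \<le> real CARD('m) * (1 / 2) ^ n"
proof -
  have "\<bar>u $ j - v $ j\<bar> \<le> (1 / 2) ^ n" for j
  proof -
    have c: "\<lfloor>u $ j * 2 ^ n\<rfloor> = \<lfloor>v $ j * 2 ^ n\<rfloor>" using fun_cong[OF assms, of j] by (simp add: cube_index_def)
    have "\<bar>u $ j * 2 ^ n - v $ j * 2 ^ n\<bar> \<le> 1" using c by linarith
    then have "\<bar>u $ j - v $ j\<bar> * 2 ^ n \<le> 1" by (simp add: left_diff_distrib[symmetric] abs_mult)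
    then show ?thesis by (simp add: power_one_over field_simps)
  qed
  then have "(\<Sum>j\<in>UNIV. \<bar>(u - v) $ j\<bar>) \<le> (\<Sum>j\<in>(UNIV :: 'm set). (1 / 2) ^ n)" by (intro sum_mono) simp
  then show ?thesis using norm_le_l1_cart[of "u - v"] by (simp add: dist_norm)
qed

lemma twisted_grid:
  "generating_grid (index_fst i :: int \<Rightarrow> (real^'m) \<times> (real^'m) \<Rightarrow> 'm \<Rightarrow> int) (index_snd i)
     (cube_volume TYPE('m)) (cube_volume TYPE('m))"
proof -
  let ?a = "index_fst i :: int \<Rightarrow> (real^'m) \<times> (real^'m) \<Rightarrow> 'm \<Rightarrow> int" and ?b = "index_snd i :: int \<Rightarrow> (real^'m) \<times> (real^'m) \<Rightarrow> 'm \<Rightarrow> int"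
  let ?v = "cube_volume TYPE('m)"
  have ma: "?a k \<in> measurable lebesgue (count_space UNIV)" for k
  proof (subst measurable_count_space_eq2_countable; safe?)
    fix n
    have "?a k -` {n} = twist i -` ({v. cube_index k v = n} \<times> UNIV)" by (auto simp: mem_Times_iff)
    then show "?a k -` {n} \<inter> space lebesgue \<in> sets lebesgue"
      using borel_twist_vimage[OF sets_cube[of k n], of UNIV i] by simp
  qed simp_all
  have mb: "?b k \<in> measurable lebesgue (count_space UNIV)" for k
  proof (subst measurable_count_space_eq2_countable; safe?)
    fix n
    have "?b k -` {n} = twist i -` (UNIV \<times> {v. cube_index k v = n})" by (auto simp: mem_Times_iff)
    then show "?b k -` {n} \<inter> space lebesgue \<in> sets lebesgue"
      using borel_twist_vimage[OF _ sets_cube[of k n], of UNIV i] by simp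
  qed simp_all
  have em: "emeasure lebesgue {x. ?a k x = c \<and> ?b l x = d} = ennreal (?v k * ?v l)" for k l c d
  proof -
    let ?I = "{v :: real^'m. cube_index k v = c}" and ?J = "{v :: real^'m. cube_index l v = d}"
    have "{x. ?a k x = c \<and> ?b l x = d} = twist i -` (?I \<times> ?J)" by (auto simp: mem_Times_iff)
    moreover have "emeasure lebesgue (twist i -` (?I \<times> ?J)) = emeasure lborel (twist i -` (?I \<times> ?J))"
      using borel_twist_vimage[OF sets_cube[of k c] sets_cube[of l d]] by simp
    ultimately show ?thesis
      by (simp add: emeasure_twist_vimage[OF sets_cube sets_cube] emeasure_cube ennreal_mult cube_volume_def)
  qed
  have pos: "0 < ?v k" for k by (simp add: cube_volume_def)
  have grid: "product_grid lebesgue ?a ?b ?v ?v"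
  proof
    show "space lebesgue = UNIV" by simp
  qed (fact ma mb em pos | erule cube_index_refine)+
  have large: "filterlim (\<lambda>n. ?v (- int n)) at_top sequentially"
  proof (rule filterlim_at_top_mono[of "\<lambda>n. real n"])
    show "eventually (\<lambda>n. real n \<le> ?v (- int n)) sequentially"
    proof (rule always_eventually, rule allI)
      fix n
      have "real n \<le> 2 ^ n" using less_exp[of n] by (metis less_imp_le of_nat_le_iff of_nat_numeral of_nat_power)
      also have "\<dots> \<le> (2 ^ n) ^ CARD('m)" by (rule self_le_power) auto
      finally show "real n \<le> ?v (- int n)" by (simp add: cube_volume_def)
    qed
  qed (rule filterlim_real_sequentially)
  show ?thesis
  proof (intro generating_grid.intro grid generating_grid_axioms.intro large)
    fix U :: "((real^'m) \<times> (real^'m)) set" and x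
    assume U: "open U" "x \<in> U"
    have "open (untwist i -` U)" using continuous_untwist U by (intro open_vimage)
    moreover have "twist i x \<in> untwist i -` U" using U by (simp add: untwist_twist)
    ultimately obtain e where e: "e > 0" "ball (twist i x) e \<subseteq> untwist i -` U"
      by (meson openE)
    have "(\<lambda>n. 2 * (real CARD('m) * (1 / 2) ^ n)) \<longlonglongrightarrow> 2 * (real CARD('m) * 0)"
      by (intro tendsto_intros LIMSEQ_power_zero) auto
    then have "eventually (\<lambda>n. 2 * (real CARD('m) * (1 / 2) ^ n) < e) sequentially"
      using e(1) by (intro order_tendstoD(2)[where y = "0::real"]) auto
    then show "eventually (\<lambda>n. product_grid.cell ?a ?b (int n) (int n) x \<subseteq> U) sequentially"
    proof eventually_elim
      case (elim n)
      show ?case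
      proof
        fix y assume "y \<in> product_grid.cell ?a ?b (int n) (int n) x"
        then have c: "?a (int n) y = ?a (int n) x" "?b (int n) y = ?b (int n) x"
          by (auto simp: product_grid.cell_def[OF grid])
        have "dist (twist i x) (twist i y) \<le> dist (fst (twist i x)) (fst (twist i y)) + dist (snd (twist i x)) (snd (twist i y))"
          unfolding dist_prod_def by (rule sqrt_sum_squares_le_sum) auto
        also have "\<dots> \<le> 2 * (real CARD('m) * (1 / 2) ^ n)"
          using dist_same_cube[OF c(1)[symmetric]] dist_same_cube[OF c(2)[symmetric]] by simp
        finally have "twist i y \<in> ball (twist i x) e" using elim by simp
        then show "y \<in> U" using e(2) untwist_twist[of i y] by (metis subsetD vimageE)
      qed
    qed
  qed
qed

lemma twisted_cell_eq:
  "twisted_cell i (k, l) x = {y. index_fst i k y = index_fst i k x \<and> index_snd i l y = index_snd i l x}"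
  unfolding twisted_cell_def
proof (rule the1_equality[OF ex1_twisted_cell], intro conjI)
  show "{y. index_fst i k y = index_fst i k x \<and> index_snd i l y = index_snd i l x} \<in> twisted_cells i (k, l)"
    unfolding twisted_cells_def dyadic_cubes_eq
  proof (intro CollectI exI conjI)
    show "{y. index_fst i k y = index_fst i k x \<and> index_snd i l y = index_snd i l x} =
      twist i -` ({v. cube_index k v = index_fst i k x} \<times> {v. cube_index l v = index_snd i l x})"
      by (auto simp: mem_Times_iff)
  qed auto
qed simp

theorem twisted_square_function:
  fixes f :: "(real^'m) \<times> (real^'m) \<Rightarrow> 'b::euclidean_space"
  assumes p: "1 < p" and C: "square_majorants p C" and f: "f \<in> Lp_space p"
  shows "mart_square_converges i f" and "mart_square i f \<in> Lp_space p"
    and "Lp_norm p (mart_square i f) \<le> (C\<^sup>2) powr (1 / p) * Lp_norm p f"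
    and "Lp_norm p f \<le> (2 powr p * C\<^sup>2) powr (1 / p) * Lp_norm p (mart_square i f)"
proof -
  interpret generating_grid "index_fst i :: int \<Rightarrow> (real^'m) \<times> (real^'m) \<Rightarrow> 'm \<Rightarrow> int" "index_snd i"
     "cube_volume TYPE('m)" "cube_volume TYPE('m)"
    by (rule twisted_grid)
  have cell: "twisted_cell i (k, l) x = cell k l x" for k l x
    by (simp add: twisted_cell_eq cell_def)
  have avg: "cond_avg i (k, l) f = E k l f" for k l
    by (rule ext) (simp add: cond_avg_def E_def cell measure_cell)
  have dl: "mart_diff i k f x = delta (fst k) (snd k) f x" for k x
    by (cases k) (simp add: mart_diff_def delta_def avg)
  have sq: "mart_square i f = square f"
    by (rule ext) (simp add: mart_square_def square_def dl)
  have fL: "in_Lp lebesgue p f" using f by (simp add: Lp_space_def in_Lp_def)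
  note main = square_function[OF fL p C]
  show "mart_square_converges i f" unfolding mart_square_converges_def dl by (rule main(1))
  show "mart_square i f \<in> Lp_space p" using main(2) by (simp add: sq Lp_space_def in_Lp_def)
  have root: "Lp_norm p g \<le> K powr (1 / p) * Lp_norm p h"
    if "(LINT x|lebesgue. norm (g x) powr p) \<le> K * (LINT x|lebesgue. norm (h x) powr p)" "K \<ge> 0"
    for g :: "(real^'m) \<times> (real^'m) \<Rightarrow> 'c::real_normed_vector"
    and h :: "(real^'m) \<times> (real^'m) \<Rightarrow> 'd::real_normed_vector" and K
  proof -
    have nn: "0 \<le> (LINT x|lebesgue. norm (h x) powr p)" "0 \<le> (LINT x|lebesgue. norm (g x) powr p)" by simp_all
    have "Lp_norm p g \<le> (K * (LINT x|lebesgue. norm (h x) powr p)) powr (1 / p)"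
      unfolding Lp_norm_def using that p nn by (intro powr_mono2) auto
    then show ?thesis using that nn by (simp add: Lp_norm_def powr_mult)
  qed
  show "Lp_norm p (mart_square i f) \<le> (C\<^sup>2) powr (1 / p) * Lp_norm p f"
    unfolding sq using main(3) by (rule root) simp
  show "Lp_norm p f \<le> (2 powr p * C\<^sup>2) powr (1 / p) * Lp_norm p (mart_square i f)"
    unfolding sq using main(4) by (rule root) simp
qed

theorem theorem3p2:
  fixes p :: real
  assumes "1 < p"
  shows "(\<forall>i\<in>{1, 2, 3}. \<exists>B\<ge>0. \<forall>f :: (real^'m) \<times> (real^'m) \<Rightarrow> complex.
            f \<in> Lp_space p \<longrightarrow>
              mart_square_converges i f \<and> mart_square i f \<in> Lp_space p \<and>
              Lp_norm p (mart_square i f) \<le> B * Lp_norm p f) \<and>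
         (\<exists>c C. 0 < c \<and> c \<le> C \<and>
            (\<forall>i\<in>{1, 2, 3}. \<forall>f :: (real^'m) \<times> (real^'m) \<Rightarrow> complex.
               f \<in> Lp_space p \<longrightarrow>
                 c * Lp_norm p f \<le> Lp_norm p (mart_square i f) \<and>
                 Lp_norm p (mart_square i f) \<le> C * Lp_norm p f))"
proof -
  obtain K where K: "square_majorants p K" using ex_square_majorants[OF assms] by blast
  then have K0: "K > 0" by (simp add: square_majorants_def)
  define B where "B = (K\<^sup>2) powr (1 / p)"
  define D where "D = (2 powr p * K\<^sup>2) powr (1 / p)"
  have B0: "B \<ge> 0" and D0: "D > 0" using K0 by (auto simp: B_def D_def)
  note main = twisted_square_function[OF assms K, where 'b = complex, folded B_def D_def]
  have nn: "0 \<le> Lp_norm p f" for f :: "(real^'m) \<times> (real^'m) \<Rightarrow> complex" by (simp add: Lp_norm_def)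
  have lower: "1 / D * Lp_norm p f \<le> Lp_norm p (mart_square i f)" if "f \<in> Lp_space p"
    for i and f :: "(real^'m) \<times> (real^'m) \<Rightarrow> complex"
    using main(4)[OF that, of i] D0 by (simp add: field_simps)
  have upper: "Lp_norm p (mart_square i f) \<le> max (1 / D) B * Lp_norm p f" if "f \<in> Lp_space p"
    for i and f :: "(real^'m) \<times> (real^'m) \<Rightarrow> complex"
    by (rule order.trans[OF main(3)[OF that]]) (intro mult_right_mono nn max.cobounded2)
  show ?thesis
  proof (intro conjI)
    show "\<forall>i\<in>{1, 2, 3}. \<exists>B\<ge>0. \<forall>f :: (real^'m) \<times> (real^'m) \<Rightarrow> complex.
            f \<in> Lp_space p \<longrightarrow>
              mart_square_converges i f \<and> mart_square i f \<in> Lp_space p \<and>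
              Lp_norm p (mart_square i f) \<le> B * Lp_norm p f"
      using main(1-3) B0 by blast
    show "\<exists>c C. 0 < c \<and> c \<le> C \<and>
            (\<forall>i\<in>{1, 2, 3}. \<forall>f :: (real^'m) \<times> (real^'m) \<Rightarrow> complex.
               f \<in> Lp_space p \<longrightarrow>
                 c * Lp_norm p f \<le> Lp_norm p (mart_square i f) \<and>
                 Lp_norm p (mart_square i f) \<le> C * Lp_norm p f)"
      using lower upper D0 by (intro exI[of _ "1 / D"] exI[of _ "max (1 / D) B"]) auto
  qed
qed

end
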